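(* There exist topologically numerically transitive operators on $\ell_2(\mathbb N)$, and C*-transitive operators on $B_0(H)$, $B_2(H)$ and $\tilde\ell_2(B_0(H))$, that are not Li–Yorke chaotic nor distributionally chaotic of type 3.
   Context: $H$ is a complex separable Hilbert space with an orthonormal basis $\{e_j\}_{j\in\mathbb Z}$; $B_0(H)$ is the C*-algebra of compact operators (operator norm), $B_2(H)$ the Hilbert–Schmidt operators (Hilbert–Schmidt norm), $B_1(H)$ the trace class operators (trace norm). $\tilde\ell_2(B_0(H))$ is the standard Hilbert module over $B_0(H)$: sequences $x=(x_j)_{j\in\mathbb N}$ in $B_0(H)$ with $\sum_j x_j^*x_j$ norm convergent, with norm $\|\sum_jx_j^*x_j\|^{1/2}$. In each case let $\varphi:X\times X\to\mathcal M$ be: $X=\mathcal M=B_0(H)$, $\varphi(A,B)=B^*A$; $X=B_2(H)$, $\mathcal M=B_1(H)$, $\varphi(A,B)=B^*A$; $X=\tilde\ell_2(B_0(H))$, $\mathcal M=B_0(H)$, $\varphi(x,y)=\sum_jy_j^*x_j$. With $S(X)$ the unit sphere, $T\in\mathcal B(X)$ is C*-transitive if for every nonempty open $W\subseteq S(X)\times S(X)$ and nonempty open $O\subseteq\mathcal M$ there exist $n\in\mathbb N$ and $(x,y)\in W$ with $\varphi(T^nx,y)\in O$. For a complex Banach space $X$, $\Pi(X):=\{(x,x^* )\in S_X\times S_{X^*}:x^*(x)=1\}$ with the topology induced by the norm $\max\{\|x\|,\|x^*\|\}$; $T\in\mathcal B(X)$ is topologically numerically transitive if for every nonempty open $U\subset\Pi(X)$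 and nonempty open $V\subset\mathbb C$ there exist $n\ge0$ and $(x,x^* )\in U$ with $x^*(T^nx)\in V$. $T\in\mathcal B(X)$ is Li–Yorke chaotic if and only if there are $x\in X$ and a strictly increasing sequence $(n_k)$ in $\mathbb N$ with $\lim_k\|T^{n_k}x\|=0$ and $\sup_n\|T^nx\|=\infty$. $T$ is distributionally chaotic of type 3 if there is an uncountable set $\Gamma\subseteq X$ such that for all distinct $x,y\in\Gamma$ there is a nondegenerate interval $J\subset(0,\infty)$ such that for all $\tau\in J$, $\liminf_{n}\frac1n\#\{0\le i<n:\|T^ix-T^iy\|<\tau\}<\limsup_{n}\frac1n\#\{0\le i<n:\|T^ix-T^iy\|<\tau\}$. *)

theory Defs
  imports "HOL-Analysis.Analysis" "HOL-Library.Function_Algebras"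
begin

section \<open>Complex vector spaces and Hilbert spaces\<close>

class complex_vector = ab_group_add +
  fixes scaleC :: "complex \<Rightarrow> 'a \<Rightarrow> 'a" (infixr \<open>*\<^sub>C\<close> 75)
  assumes scaleC_add_right: "c *\<^sub>C (x + y) = c *\<^sub>C x + c *\<^sub>C y"
    and scaleC_add_left: "(c + d) *\<^sub>C x = c *\<^sub>C x + d *\<^sub>C x"
    and scaleC_scaleC: "c *\<^sub>C d *\<^sub>C x = (c * d) *\<^sub>C x"
    and scaleC_one: "1 *\<^sub>C x = x"

interpretation complex_vector:
  vector_space "scaleC :: complex \<Rightarrow> 'a \<Rightarrow> 'a::complex_vector"
  by standard (simp_all add: scaleC_add_right scaleC_add_left scaleC_scaleC scaleC_one)

text \<open>The inner product is linear in the first argument.\<close>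

class chilbert_space = complex_vector + banach +
  fixes cinner :: "'a \<Rightarrow> 'a \<Rightarrow> complex"
  assumes scaleR_scaleC: "r *\<^sub>R x = complex_of_real r *\<^sub>C x"
    and cinner_commute: "cinner x y = cnj (cinner y x)"
    and cinner_add_left: "cinner (x + y) z = cinner x z + cinner y z"
    and cinner_scaleC_left: "cinner (c *\<^sub>C x) y = c * cinner x y"
    and cinner_nonneg: "0 \<le> Re (cinner x x)"
    and norm_eq_sqrt_cinner: "norm x = sqrt (Re (cinner x x))"

instantiation complex :: complex_vector
begin
definition "scaleC (c::complex) (x::complex) = c * x"
instance by standard (simp_all add: scaleC_complex_def algebra_simps)
end

instantiation "fun" :: (type, complex_vector) complex_vector
begin
definition "scaleC c (f :: 'a \<Rightarrow> 'b) = (\<lambda>x. c *\<^sub>C f x)"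
instance
  by standard
    (simp_all add: scaleC_fun_def fun_eq_iff scaleC_add_right scaleC_add_left
      scaleC_scaleC scaleC_one)
end

lemma norm_scaleC: "norm (c *\<^sub>C x) = cmod c * norm (x::'h::chilbert_space)"
proof -
  have "cinner (c *\<^sub>C x) (c *\<^sub>C x) = c * cnj c * cinner x x"
    by (metis cinner_commute cinner_scaleC_left complex_cnj_mult mult.assoc)
  also have "\<dots> = complex_of_real ((cmod c)\<^sup>2) * cinner x x"
    by (simp only: complex_norm_square)
  finally show ?thesis
    by (simp add: norm_eq_sqrt_cinner real_sqrt_mult)
qed

lemma bounded_linear_scaleC: "bounded_linear (\<lambda>x::'h::chilbert_space. c *\<^sub>C x)"
  by (rule bounded_linear_intro[where K = "cmod c"])
    (simp_all add: scaleC_add_right scaleR_scaleC scaleC_scaleC norm_scaleC mult.commute)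

instantiation blinfun :: (real_normed_vector, chilbert_space) complex_vector
begin
definition "scaleC c (T :: 'a \<Rightarrow>\<^sub>L 'b) = Blinfun (\<lambda>x. c *\<^sub>C blinfun_apply T x)"
instance
proof -
  have ap: "blinfun_apply (c *\<^sub>C T) x = c *\<^sub>C blinfun_apply T x"
    for c and T :: "'a \<Rightarrow>\<^sub>L 'b" and x
    unfolding scaleC_blinfun_def
    by (subst bounded_linear_Blinfun_apply)
      (auto intro: bounded_linear_compose[OF bounded_linear_scaleC] blinfun.bounded_linear_right)
  show "OFCLASS('a \<Rightarrow>\<^sub>L 'b, complex_vector_class)"
    by standard
      (auto intro!: blinfun_eqI simp: ap blinfun.add_left scaleC_add_right scaleC_add_left
        scaleC_scaleC scaleC_one)
qed
end

definition orthonormal_basis :: "('i \<Rightarrow> 'h::chilbert_space) \<Rightarrow> bool" where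
  "orthonormal_basis e \<longleftrightarrow>
     (\<forall>i j. cinner (e i) (e j) = (if i = j then 1 else 0)) \<and>
     closure (complex_vector.span (range e)) = UNIV"


section \<open>Normed spaces given by a carrier and a norm\<close>

text \<open>A complex normed space is given by a complex subspace \<^term>\<open>X\<close> of some
  ambient \<^class>\<open>complex_vector\<close> type and a function \<^term>\<open>nrm\<close> whose values
  on \<^term>\<open>X\<close> are the norm.

  The locale \<^locale>\<open>Metric_space\<close> asks for nonnegativity and symmetry of
  the distance on the whole type; as \<^term>\<open>nrm\<close> is meaningless off the
  carrier, the distance is set to 0 there. This does not affect the topology.\<close>

definition norm_topology :: "'x::ab_group_add set \<Rightarrow> ('x \<Rightarrow> real) \<Rightarrow> 'x topology" where
  "norm_topology S nrm =
     Metric_space.mtopology S (\<lambda>x y. if x \<in> S \<and> y \<in> S then nrm (x - y) else 0)"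

definition unit_sphere :: "'x set \<Rightarrow> ('x \<Rightarrow> real) \<Rightarrow> 'x set" where
  "unit_sphere X nrm = {x \<in> X. nrm x = 1}"

definition bounded_clinear_on ::
    "'x::complex_vector set \<Rightarrow> ('x \<Rightarrow> real) \<Rightarrow> 'y::complex_vector set \<Rightarrow> ('y \<Rightarrow> real)
      \<Rightarrow> ('x \<Rightarrow> 'y) \<Rightarrow> bool" where
  "bounded_clinear_on X nrmX Y nrmY T \<longleftrightarrow>
     (\<forall>x\<in>X. T x \<in> Y) \<and>
     (\<forall>x\<in>X. \<forall>y\<in>X. T (x + y) = T x + T y) \<and>
     (\<forall>c. \<forall>x\<in>X. T (c *\<^sub>C x) = c *\<^sub>C T x) \<and>
     (\<exists>K. \<forall>x\<in>X. nrmY (T x) \<le> K * nrmX x)"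

abbreviation bounded_op :: "'x::complex_vector set \<Rightarrow> ('x \<Rightarrow> real) \<Rightarrow> ('x \<Rightarrow> 'x) \<Rightarrow> bool" where
  "bounded_op X nrm \<equiv> bounded_clinear_on X nrm X nrm"

text \<open>Functionals are extended by 0 off the carrier, so that they are determined by their
  values on it.\<close>

definition dual_space :: "'x::complex_vector set \<Rightarrow> ('x \<Rightarrow> real) \<Rightarrow> ('x \<Rightarrow> complex) set" where
  "dual_space X nrm = {f. bounded_clinear_on X nrm UNIV norm f \<and> (\<forall>x. x \<notin> X \<longrightarrow> f x = 0)}"

definition dual_norm :: "'x set \<Rightarrow> ('x \<Rightarrow> real) \<Rightarrow> ('x \<Rightarrow> complex) \<Rightarrow> real" where
  "dual_norm X nrm f = (SUP x\<in>{x\<in>X. nrm x \<le> 1}. norm (f x))"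


section \<open>Dynamical properties\<close>

definition Pi_states ::
    "'x::complex_vector set \<Rightarrow> ('x \<Rightarrow> real) \<Rightarrow> ('x \<times> ('x \<Rightarrow> complex)) set" where
  "Pi_states X nrm =
     {(x, f). x \<in> unit_sphere X nrm \<and>
              f \<in> unit_sphere (dual_space X nrm) (dual_norm X nrm) \<and> f x = 1}"

definition topologically_numerically_transitive ::
    "'x::complex_vector set \<Rightarrow> ('x \<Rightarrow> real) \<Rightarrow> ('x \<Rightarrow> 'x) \<Rightarrow> bool" where
  "topologically_numerically_transitive X nrm T \<longleftrightarrow>
     (\<forall>U V. openin (norm_topology (Pi_states X nrm)
                     (\<lambda>(x, f). max (nrm x) (dual_norm X nrm f))) U \<and> U \<noteq> {} \<and>
            open V \<and> V \<noteq> {} \<longrightarrow>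
            (\<exists>n. \<exists>(x, f)\<in>U. f ((T ^^ n) x) \<in> V))"

definition cstar_transitive ::
    "'x::complex_vector set \<Rightarrow> ('x \<Rightarrow> real) \<Rightarrow> 'm::complex_vector set \<Rightarrow> ('m \<Rightarrow> real)
      \<Rightarrow> ('x \<Rightarrow> 'x \<Rightarrow> 'm) \<Rightarrow> ('x \<Rightarrow> 'x) \<Rightarrow> bool" where
  "cstar_transitive X nrmX M nrmM \<phi> T \<longleftrightarrow>
     (\<forall>W V. openin (prod_topology (norm_topology (unit_sphere X nrmX) nrmX)
                                  (norm_topology (unit_sphere X nrmX) nrmX)) W \<and> W \<noteq> {} \<and>
            openin (norm_topology M nrmM) V \<and> V \<noteq> {} \<longrightarrow>
            (\<exists>n. \<exists>(x, y)\<in>W. \<phi> ((T ^^ n) x) y \<in> V))"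

definition Li_Yorke_chaotic :: "'x set \<Rightarrow> ('x \<Rightarrow> real) \<Rightarrow> ('x \<Rightarrow> 'x) \<Rightarrow> bool" where
  "Li_Yorke_chaotic X nrm T \<longleftrightarrow>
     (\<exists>x\<in>X. (\<exists>r::nat \<Rightarrow> nat. strict_mono r \<and> (\<lambda>k. nrm ((T ^^ r k) x)) \<longlonglongrightarrow> 0) \<and>
             \<not> bdd_above (range (\<lambda>n. nrm ((T ^^ n) x))))"

definition orbit_closeness ::
    "('x::ab_group_add \<Rightarrow> real) \<Rightarrow> ('x \<Rightarrow> 'x) \<Rightarrow> 'x \<Rightarrow> 'x \<Rightarrow> real \<Rightarrow> nat \<Rightarrow> ereal" where
  "orbit_closeness nrm T x y \<tau> n =
     ereal (real (card {i. i < n \<and> nrm ((T ^^ i) x - (T ^^ i) y) < \<tau>}) / real n)"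

definition distributionally_chaotic_3 ::
    "'x::ab_group_add set \<Rightarrow> ('x \<Rightarrow> real) \<Rightarrow> ('x \<Rightarrow> 'x) \<Rightarrow> bool" where
  "distributionally_chaotic_3 X nrm T \<longleftrightarrow>
     (\<exists>\<Gamma>\<subseteq>X. uncountable \<Gamma> \<and>
       (\<forall>x\<in>\<Gamma>. \<forall>y\<in>\<Gamma>. x \<noteq> y \<longrightarrow>
         (\<exists>J::real set. is_interval J \<and> J \<subseteq> {0<..} \<and> (\<exists>a\<in>J. \<exists>b\<in>J. a < b) \<and>
           (\<forall>\<tau>\<in>J. liminf (orbit_closeness nrm T x y \<tau>) < limsup (orbit_closeness nrm T x y \<tau>)))))"


section \<open>The spaces\<close>

definition ell2 :: "(nat \<Rightarrow> complex) set" where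
  "ell2 = {x. summable (\<lambda>j. (cmod (x j))\<^sup>2)}"

definition ell2_norm :: "(nat \<Rightarrow> complex) \<Rightarrow> real" where
  "ell2_norm x = sqrt (\<Sum>j. (cmod (x j))\<^sup>2)"

text \<open>The elements of the type of bounded operators \<^typ>\<open>'h \<Rightarrow>\<^sub>L 'h\<close> are only
  real-linear; complex linearity has to be required separately.\<close>

definition clinear_ops :: "('h::chilbert_space \<Rightarrow>\<^sub>L 'h) set" where
  "clinear_ops = {A. \<forall>c x. blinfun_apply A (c *\<^sub>C x) = c *\<^sub>C blinfun_apply A x}"

definition cadjoint :: "('h::chilbert_space \<Rightarrow>\<^sub>L 'h) \<Rightarrow> ('h \<Rightarrow>\<^sub>L 'h)" where
  "cadjoint A = (THE B. \<forall>x y. cinner (blinfun_apply A x) y = cinner x (blinfun_apply B y))"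

definition positive_op :: "('h::chilbert_space \<Rightarrow>\<^sub>L 'h) \<Rightarrow> bool" where
  "positive_op P \<longleftrightarrow> P \<in> clinear_ops \<and> (\<forall>x. cinner (blinfun_apply P x) x \<in> \<real>\<^sub>\<ge>\<^sub>0)"

definition abs_op :: "('h::chilbert_space \<Rightarrow>\<^sub>L 'h) \<Rightarrow> ('h \<Rightarrow>\<^sub>L 'h)" where
  "abs_op A = (THE P. positive_op P \<and> P o\<^sub>L P = cadjoint A o\<^sub>L A)"

definition compact_ops :: "('h::chilbert_space \<Rightarrow>\<^sub>L 'h) set" where
  "compact_ops = {A \<in> clinear_ops. compact (closure (blinfun_apply A ` cball 0 1))}"

text \<open>The Hilbert--Schmidt and trace norms are computed in a given orthonormal basis
  \<^term>\<open>e\<close>; they do not depend on its choice.\<close>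

definition hilbert_schmidt_ops :: "('i \<Rightarrow> 'h::chilbert_space) \<Rightarrow> ('h \<Rightarrow>\<^sub>L 'h) set" where
  "hilbert_schmidt_ops e =
     {A \<in> clinear_ops. (\<lambda>j. (norm (blinfun_apply A (e j)))\<^sup>2) summable_on UNIV}"

definition hilbert_schmidt_norm :: "('i \<Rightarrow> 'h::chilbert_space) \<Rightarrow> ('h \<Rightarrow>\<^sub>L 'h) \<Rightarrow> real" where
  "hilbert_schmidt_norm e A = sqrt (\<Sum>\<^sub>\<infinity>j. (norm (blinfun_apply A (e j)))\<^sup>2)"

definition trace_class_ops :: "('i \<Rightarrow> 'h::chilbert_space) \<Rightarrow> ('h \<Rightarrow>\<^sub>L 'h) set" where
  "trace_class_ops e =
     {A \<in> clinear_ops. (\<lambda>j. Re (cinner (blinfun_apply (abs_op A) (e j)) (e j))) summable_on UNIV}"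

definition trace_norm :: "('i \<Rightarrow> 'h::chilbert_space) \<Rightarrow> ('h \<Rightarrow>\<^sub>L 'h) \<Rightarrow> real" where
  "trace_norm e A = (\<Sum>\<^sub>\<infinity>j. Re (cinner (blinfun_apply (abs_op A) (e j)) (e j)))"

definition op_product :: "('h::chilbert_space \<Rightarrow>\<^sub>L 'h) \<Rightarrow> ('h \<Rightarrow>\<^sub>L 'h) \<Rightarrow> ('h \<Rightarrow>\<^sub>L 'h)" where
  "op_product A B = cadjoint B o\<^sub>L A"

text \<open>The standard Hilbert module over the compact operators. The series are series in
  the normed space \<^typ>\<open>'h \<Rightarrow>\<^sub>L 'h\<close>, that is, they converge in operator norm.\<close>

definition std_module :: "(nat \<Rightarrow> ('h::chilbert_space \<Rightarrow>\<^sub>L 'h)) set" where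
  "std_module =
     {x. (\<forall>j. x j \<in> compact_ops) \<and> summable (\<lambda>j. cadjoint (x j) o\<^sub>L x j)}"

definition module_product ::
    "(nat \<Rightarrow> ('h::chilbert_space \<Rightarrow>\<^sub>L 'h)) \<Rightarrow> (nat \<Rightarrow> ('h \<Rightarrow>\<^sub>L 'h)) \<Rightarrow> ('h \<Rightarrow>\<^sub>L 'h)" where
  "module_product x y = (\<Sum>j. cadjoint (y j) o\<^sub>L x j)"

definition module_norm :: "(nat \<Rightarrow> ('h::chilbert_space \<Rightarrow>\<^sub>L 'h)) \<Rightarrow> real" where
  "module_norm x = sqrt (norm (\<Sum>j. cadjoint (x j) o\<^sub>L x j))"

end

theory Submission
  imports Defs "HOL-Library.Nat_Bijection"
begin

text \<open>In each space we take \<open>T\<close> to be four times an isometric shift. Then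
  \<open>\<parallel>T\<^sup>n x\<parallel> = 4\<^sup>n \<parallel>x\<parallel>\<close>, so every nonzero orbit tends to infinity and neither form of chaos can
  occur. For transitivity, truncate \<open>x\<close> and \<open>y\<close> to the first \<open>N\<close> coordinates and add the small
  terms \<open>2\<^sup>-\<^sup>n S\<^sup>N E\<close> and \<open>2\<^sup>-\<^sup>n S\<^sup>N\<^sup>+\<^sup>n F\<close>, where \<open>S\<close> is the shift: for \<open>n \<ge> N\<close> all cross terms of
  \<open>\<phi>(T\<^sup>n x, y)\<close> vanish by orthogonality and what remains is exactly \<open>\<phi>(E, F)\<close>. It is therefore enough
  that the products \<open>F\<^sup>* E\<close> are dense in the target; for trace class operators this follows from
  the factorization \<open>C = (W \<bar>C\<bar>\<^sup>1\<^sup>/\<^sup>2) \<bar>C\<bar>\<^sup>1\<^sup>/\<^sup>2\<close> given by the polar decomposition \<open>C = W \<bar>C\<bar>\<close>.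
  For numerical transitivity on \<open>\<ell>\<^sub>2\<close>, where \<open>y = x\<close>, both small terms are added to the same vector.\<close>

text \<open>The two requirements do not collide, because transitivity constrains only pairings such
  as \<open>\<phi> ((T ^^ n) x) y\<close>: an orbit may escape at a fixed rate as long as the part
  of it that \<open>y\<close> sees starts small enough. The rate 4 is 2 * 2: each perturbation has
  size about \<open>2^-n\<close> and moves its vector arbitrarily little, while the pairing of both,
  amplified by \<open>4^n\<close>, keeps its size. The perturbed vectors are no longer unit vectors;
  dividing by their norms multiplies the value by a scalar close to 1, which the open target
  absorbs. The shift is one-sided because its powers must leave every initial segment of
  coordinates. On \<open>ell2\<close> a state is determined by its vector, so that neighbourhoods of
  states are controlled by neighbourhoods on the sphere. Much of the work comes from
  \<open>cadjoint\<close> and \<open>abs_op\<close> being definite descriptions: adjoints and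
  positive square roots have to be constructed and shown unique before products and trace norms can
  be handled, and the triangle inequality for the trace norm already uses polar
  decomposition.\<close>

lemma scaleC_minus_one: "(-1) *\<^sub>C x = - (x::'a::complex_vector)"
  using complex_vector.scale_minus_left[of 1 x] by (simp add: scaleC_one)

lemma scaleC_diff_right: "c *\<^sub>C (x - y) = c *\<^sub>C x - c *\<^sub>C (y::'a::complex_vector)"
  by (rule complex_vector.scale_right_diff_distrib)

lemma scaleC_diff_left: "(c - d) *\<^sub>C x = c *\<^sub>C x - d *\<^sub>C (x::'a::complex_vector)"
  by (rule complex_vector.scale_left_diff_distrib)

section \<open>Inner products\<close>

lemma cinner_add_right: "cinner x (y + z) = cinner x y + cinner x z"
  by (metis cinner_add_left cinner_commute complex_cnj_add)

lemma cinner_scaleC_right: "cinner x (c *\<^sub>C y) = cnj c * cinner x y"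
  by (metis cinner_commute cinner_scaleC_left complex_cnj_mult)

lemma cinner_zero_left [simp]: "cinner 0 y = 0"
  using cinner_scaleC_left[of 0 0 y] by simp

lemma cinner_zero_right [simp]: "cinner y 0 = 0"
  using cinner_scaleC_right[of y 0 0] by simp

lemma cinner_minus_left: "cinner (- x) y = - cinner x y"
  using cinner_scaleC_left[of "-1" x y] by (simp add: scaleC_minus_one)

lemma cinner_minus_right: "cinner x (- y) = - cinner x y"
  using cinner_scaleC_right[of x "-1" y] by (simp add: scaleC_minus_one)

lemma cinner_diff_left: "cinner (x - y) z = cinner x z - cinner y z"
  using cinner_add_left[of x "-y" z] by (simp add: cinner_minus_left)

lemma cinner_diff_right: "cinner x (y - z) = cinner x y - cinner x z"
  using cinner_add_right[of x y "-z"] by (simp add: cinner_minus_right)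

lemma cinner_sum_left: "cinner (sum f A) y = (\<Sum>i\<in>A. cinner (f i) y)"
  by (induction A rule: infinite_finite_induct) (simp_all add: cinner_add_left)

lemma cinner_sum_right: "cinner y (sum f A) = (\<Sum>i\<in>A. cinner y (f i))"
  by (induction A rule: infinite_finite_induct) (simp_all add: cinner_add_right)

lemma cinner_self: "cinner x x = complex_of_real ((norm x)\<^sup>2)"
proof -
  have "Im (cinner x x) = 0"
    using arg_cong[OF cinner_commute[of x x], of Im] by simp
  moreover have "Re (cinner x x) = (norm x)\<^sup>2"
    using cinner_nonneg[of x] by (simp add: norm_eq_sqrt_cinner)
  ultimately show ?thesis by (simp add: complex_eq_iff)
qed

lemma norm_add_square: "(norm (x + y))\<^sup>2 = (norm x)\<^sup>2 + 2 * Re (cinner x y) + (norm y)\<^sup>2"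
proof -
  have "complex_of_real ((norm (x + y))\<^sup>2) = cinner (x + y) (x + y)"
    by (simp only: cinner_self)
  also have "\<dots> = cinner x x + cinner x y + cnj (cinner x y) + cinner y y"
    by (simp add: cinner_add_left cinner_add_right cinner_commute[of y x, symmetric])
  finally show ?thesis
    by (simp add: cinner_self complex_eq_iff)
qed

text \<open>The pairing \<open>g\<close> is only assumed positive semidefinite, so that the inequality also applies
  to the form of a positive operator.\<close>

lemma Cauchy_Schwarz_form:
  fixes g :: "'a::complex_vector \<Rightarrow> 'a \<Rightarrow> complex"
  assumes add: "\<And>x y z. g (x + y) z = g x z + g y z"
    and scale: "\<And>c x y. g (c *\<^sub>C x) y = c * g x y"
    and comm: "\<And>x y. g x y = cnj (g y x)"
    and pos: "\<And>x. 0 \<le> Re (g x x)"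
  shows "(cmod (g x y))\<^sup>2 \<le> Re (g x x) * Re (g y y)"
proof -
  have addr: "g x (y + z) = g x y + g x z" for x y z
    by (metis add comm complex_cnj_add)
  have scaler: "g x (c *\<^sub>C y) = cnj c * g x y" for x y c
    by (metis scale comm complex_cnj_mult)
  define a where "a = g x y"
  have key: "0 \<le> Re (g x x) + 2 * t * (cmod a)\<^sup>2 + t\<^sup>2 * (cmod a)\<^sup>2 * Re (g y y)" for t :: real
  proof -
    define c where "c = complex_of_real t * a"
    have "0 \<le> Re (g (x + c *\<^sub>C y) (x + c *\<^sub>C y))" by (rule pos)
    also have "g (x + c *\<^sub>C y) (x + c *\<^sub>C y) = g x x + cnj c * g x y + c * g y x + c * cnj c * g y y"
      by (simp add: add addr scale scaler algebra_simps)
    also have "g y x = cnj a" using comm[of y x] by (simp add: a_def)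
    also have "c * cnj c = complex_of_real (t\<^sup>2 * (cmod a)\<^sup>2)"
      by (simp add: complex_norm_square c_def power2_eq_square[of t] del: of_real_power)
    also have "cnj c * g x y = complex_of_real (t * (cmod a)\<^sup>2)"
      by (simp add: complex_norm_square c_def a_def del: of_real_power)
    also have "c * cnj a = complex_of_real (t * (cmod a)\<^sup>2)"
      by (simp add: complex_norm_square c_def del: of_real_power)
    finally show ?thesis by (simp add: algebra_simps)
  qed
  have yy: "0 \<le> Re (g y y)" "0 \<le> Re (g x x)" by (rule pos)+
  show ?thesis
  proof (cases "Re (g y y) = 0")
    case True
    have "a = 0"
    proof (rule ccontr)
      assume "a \<noteq> 0"
      then have p: "(cmod a)\<^sup>2 > 0" by simp
      from key[of "- (Re (g x x) + 1) / (2 * (cmod a)\<^sup>2)"] p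
      show False by (simp add: True field_simps)
    qed
    then show ?thesis by (simp add: a_def[symmetric] yy)
  next
    case False
    with yy have p: "Re (g y y) > 0" by simp
    have "0 \<le> Re (g x x) + 2 * (- 1 / Re (g y y)) * (cmod a)\<^sup>2 + (- 1 / Re (g y y))\<^sup>2 * (cmod a)\<^sup>2 * Re (g y y)"
      by (rule key)
    also have "\<dots> = Re (g x x) - (cmod a)\<^sup>2 / Re (g y y)"
      using p by (simp add: power2_eq_square field_simps)
    finally show ?thesis using p by (simp add: a_def field_simps)
  qed
qed

lemma cinner_Cauchy_Schwarz: "cmod (cinner x y) \<le> norm x * norm y"
proof -
  have "(cmod (cinner x y))\<^sup>2 \<le> Re (cinner x x) * Re (cinner y y)"
    by (rule Cauchy_Schwarz_form[where g = cinner])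
      (auto simp: cinner_add_left cinner_scaleC_left cinner_nonneg intro: cinner_commute)
  then have "(cmod (cinner x y))\<^sup>2 \<le> (norm x * norm y)\<^sup>2"
    by (simp add: cinner_self power_mult_distrib)
  then show ?thesis by (rule power2_le_imp_le) simp
qed

text \<open>Real scalars do not see the conjugation in the second argument, so the form is bilinear
  over the reals and the general limit rules apply to it.\<close>

lemma bounded_bilinear_cinner: "bounded_bilinear (cinner :: 'h::chilbert_space \<Rightarrow> 'h \<Rightarrow> complex)"
proof
  show "cinner (r *\<^sub>R a) b = r *\<^sub>R cinner a b" for r and a b :: 'h
    by (simp add: scaleR_scaleC cinner_scaleC_left scaleR_conv_of_real)
  show "cinner a (r *\<^sub>R b) = r *\<^sub>R cinner a b" for r and a b :: 'h
    by (simp add: scaleR_scaleC cinner_scaleC_right scaleR_conv_of_real)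
  show "\<exists>K. \<forall>a b::'h. norm (cinner a b) \<le> norm a * norm b * K"
    by (rule exI[of _ 1]) (simp add: cinner_Cauchy_Schwarz)
qed (simp_all add: cinner_add_left cinner_add_right)

lemma cinner_ext_left:
  assumes "\<And>y. cinner x y = cinner z y"
  shows "x = z"
proof -
  have "cinner (x - z) (x - z) = 0" by (simp add: cinner_diff_left assms)
  then show ?thesis by (simp add: cinner_self)
qed

lemma cinner_ext_right:
  assumes "\<And>y. cinner y x = cinner y z"
  shows "x = z"
  by (rule cinner_ext_left) (metis assms cinner_commute)

lemmas cinner_tendsto = bounded_bilinear.tendsto[OF bounded_bilinear_cinner]

section \<open>Orthonormal sequences\<close>

text \<open>Kept apart from density because the shifted family \<open>\<lambda>j. f (Suc j)\<close>
  is orthonormal without spanning a dense subspace.\<close>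

definition orthonormal :: "('i \<Rightarrow> 'h::chilbert_space) \<Rightarrow> bool" where
  "orthonormal g \<longleftrightarrow> (\<forall>i j. cinner (g i) (g j) = (if i = j then 1 else 0))"

lemma orthonormal_sum_cinner:
  assumes "orthonormal g" "finite A"
  shows "cinner (\<Sum>i\<in>A. c i *\<^sub>C g i) (\<Sum>i\<in>A. d i *\<^sub>C g i) = (\<Sum>i\<in>A. c i * cnj (d i))"
proof -
  have "cinner (\<Sum>i\<in>A. c i *\<^sub>C g i) (\<Sum>i\<in>A. d i *\<^sub>C g i)
      = (\<Sum>i\<in>A. \<Sum>j\<in>A. c i * cnj (d j) * cinner (g i) (g j))"
    by (simp add: cinner_sum_left cinner_sum_right cinner_scaleC_left cinner_scaleC_right
        sum_distrib_left mult_ac) (rule sum.swap)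
  also have "\<dots> = (\<Sum>i\<in>A. \<Sum>j\<in>A. (if i = j then c i * cnj (d j) else 0))"
    using assms(1) by (auto simp: orthonormal_def intro!: sum.cong)
  also have "\<dots> = (\<Sum>i\<in>A. c i * cnj (d i))"
    using assms(2) by (simp add: sum.delta')
  finally show ?thesis .
qed

lemma orthonormal_sum_norm:
  assumes "orthonormal g" "finite A"
  shows "(norm (\<Sum>i\<in>A. c i *\<^sub>C g i))\<^sup>2 = (\<Sum>i\<in>A. (cmod (c i))\<^sup>2)"
proof -
  have "complex_of_real ((norm (\<Sum>i\<in>A. c i *\<^sub>C g i))\<^sup>2) = complex_of_real (\<Sum>i\<in>A. (cmod (c i))\<^sup>2)"
    by (simp only: cinner_self[symmetric] orthonormal_sum_cinner[OF assms] complex_norm_square of_real_sum)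
  then show ?thesis by (simp only: of_real_eq_iff)
qed

lemma orthonormal_cinner_sum:
  assumes "orthonormal g" "finite A"
  shows "cinner (\<Sum>i\<in>A. c i *\<^sub>C g i) (g j) = (if j \<in> A then c j else 0)"
proof -
  have "cinner (\<Sum>i\<in>A. c i *\<^sub>C g i) (g j) = (\<Sum>i\<in>A. if j = i then c i else 0)"
    using assms(1) by (auto simp: cinner_sum_left cinner_scaleC_left orthonormal_def intro!: sum.cong)
  then show ?thesis using assms(2) by simp
qed

text \<open>Pythagoras for \<open>x = (x - p) + p\<close> with \<open>p\<close> the projection onto
  the span. The exact identity gives contractivity of the projection and of its complement at
  once.\<close>

lemma Bessel_finite:
  assumes "orthonormal g" "finite A"
  shows "(\<Sum>i\<in>A. (cmod (cinner x (g i)))\<^sup>2) + (norm (x - (\<Sum>i\<in>A. cinner x (g i) *\<^sub>C g i)))\<^sup>2 = (norm x)\<^sup>2"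
proof -
  define p where "p = (\<Sum>i\<in>A. cinner x (g i) *\<^sub>C g i)"
  have "cinner x p = (\<Sum>i\<in>A. cinner x (g i) * cnj (cinner x (g i)))"
    by (simp add: p_def cinner_sum_right cinner_scaleC_right mult.commute)
  also have "\<dots> = cinner p p"
    unfolding p_def by (rule orthonormal_sum_cinner[OF assms, symmetric])
  finally have "cinner (x - p) p = 0" by (simp add: cinner_diff_left)
  then have "(norm ((x - p) + p))\<^sup>2 = (norm (x - p))\<^sup>2 + (norm p)\<^sup>2"
    by (subst norm_add_square) simp
  moreover have "(norm p)\<^sup>2 = (\<Sum>i\<in>A. (cmod (cinner x (g i)))\<^sup>2)"
    unfolding p_def by (rule orthonormal_sum_norm[OF assms])
  ultimately show ?thesis by (simp add: p_def)
qed

lemma Bessel_le: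
  assumes "orthonormal g" "finite A"
  shows "(\<Sum>i\<in>A. (cmod (cinner x (g i)))\<^sup>2) \<le> (norm x)\<^sup>2"
  using Bessel_finite[OF assms, of x] by (smt (verit) zero_le_power2)

text \<open>Pythagoras turns each block of the vector series into a block of the scalar series, so
  the Cauchy criterion carries over and completeness does the rest.\<close>

lemma Riesz_Fischer:
  fixes g :: "nat \<Rightarrow> 'h::chilbert_space"
  assumes g: "orthonormal g" and c: "summable (\<lambda>j. (cmod (c j))\<^sup>2)"
  shows "summable (\<lambda>j. c j *\<^sub>C g j)"
proof (subst summable_Cauchy, intro allI impI)
  fix \<epsilon> :: real assume "\<epsilon> > 0"
  then have "\<epsilon>\<^sup>2 > 0" by simp
  then obtain N where N: "\<And>m n. m \<ge> N \<Longrightarrow> norm (\<Sum>j=m..<n. (cmod (c j))\<^sup>2) < \<epsilon>\<^sup>2"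
    using c unfolding summable_Cauchy by blast
  have "norm (\<Sum>j=m..<n. c j *\<^sub>C g j) < \<epsilon>" if "m \<ge> N" for m n
  proof (rule power2_less_imp_less)
    have "(norm (\<Sum>j=m..<n. c j *\<^sub>C g j))\<^sup>2 = (\<Sum>j=m..<n. (cmod (c j))\<^sup>2)"
      by (rule orthonormal_sum_norm[OF g]) simp
    also have "\<dots> < \<epsilon>\<^sup>2" using N[OF that, of n] by simp
    finally show "(norm (\<Sum>j=m..<n. c j *\<^sub>C g j))\<^sup>2 < \<epsilon>\<^sup>2" .
  qed (use \<open>\<epsilon> > 0\<close> in simp)
  then show "\<exists>N. \<forall>m\<ge>N. \<forall>n. norm (\<Sum>j=m..<n. c j *\<^sub>C g j) < \<epsilon>" by blast
qed

text \<open>Indexed by the natural numbers although the given basis is indexed by the integers: the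
  powers of a one-sided shift push every vector off any fixed initial segment, which a bilateral
  shift does not do.\<close>

locale onb_sequence =
  fixes f :: "nat \<Rightarrow> 'h::chilbert_space"
  assumes ortho: "orthonormal f"
    and dense: "closure (complex_vector.span (range f)) = UNIV"
begin

definition trunc :: "nat \<Rightarrow> 'h \<Rightarrow> 'h" where
  "trunc N x = (\<Sum>j<N. cinner x (f j) *\<^sub>C f j)"

lemma trunc_add: "trunc N (x + y) = trunc N x + trunc N y"
  by (simp add: trunc_def cinner_add_left scaleC_add_left sum.distrib)

lemma trunc_scaleC: "trunc N (c *\<^sub>C x) = c *\<^sub>C trunc N x"
  by (simp add: trunc_def cinner_scaleC_left complex_vector.scale_sum_right scaleC_scaleC)

lemma trunc_diff: "trunc N (x - y) = trunc N x - trunc N y"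
  using trunc_add[of N "x - y" y] by simp

lemma norm_trunc_le: "norm (trunc N x) \<le> norm x"
proof (rule power2_le_imp_le)
  have "(norm (trunc N x))\<^sup>2 = (\<Sum>i<N. (cmod (cinner x (f i)))\<^sup>2)"
    unfolding trunc_def by (rule orthonormal_sum_norm[OF ortho]) simp
  then show "(norm (trunc N x))\<^sup>2 \<le> (norm x)\<^sup>2"
    using Bessel_le[OF ortho, of "{..<N}" x] by simp
qed simp

lemma norm_diff_trunc_le: "norm (x - trunc N x) \<le> norm x"
proof (rule power2_le_imp_le)
  show "(norm (x - trunc N x))\<^sup>2 \<le> (norm x)\<^sup>2"
    using Bessel_finite[OF ortho, of "{..<N}" x] unfolding trunc_def
    by (smt (verit) sum_nonneg zero_le_power2 finite_lessThan)
qed simp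

text \<open>The vectors for which this holds form a subspace containing the basis. It is closed
  because all maps \<open>\<lambda>x. x - trunc N x\<close> are contractions, so the error of an
  approximating vector is inherited uniformly in \<open>N\<close>; density then gives every
  vector.\<close>

lemma trunc_tendsto: "(\<lambda>N. trunc N x) \<longlonglongrightarrow> x"
proof -
  define G where "G = {x. (\<lambda>N. trunc N x) \<longlonglongrightarrow> x}"
  have "complex_vector.subspace G"
    unfolding complex_vector.subspace_def G_def
    by (auto simp: trunc_add trunc_scaleC intro: tendsto_add
        bounded_linear.tendsto[OF bounded_linear_scaleC]) (simp add: trunc_def)
  moreover have "f k \<in> G" for k
  proof -
    have "trunc N (f k) = f k" if "N > k" for N
    proof -
      have "trunc N (f k) = (\<Sum>j<N. if j = k then f k else 0)"
        unfolding trunc_def using ortho by (intro sum.cong) (auto simp: orthonormal_def scaleC_one)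
      then show ?thesis using that by simp
    qed
    then have "\<forall>\<^sub>F N in sequentially. trunc N (f k) = f k"
      by (auto simp: eventually_sequentially intro!: exI[of _ "Suc k"])
    then show ?thesis unfolding G_def by (simp add: tendsto_eventually)
  qed
  ultimately have "complex_vector.span (range f) \<subseteq> G"
    by (intro complex_vector.span_minimal) auto
  moreover have "closure G \<subseteq> G"
  proof
    fix x assume x: "x \<in> closure G"
    have "(\<lambda>N. x - trunc N x) \<longlonglongrightarrow> 0"
    proof (rule LIMSEQ_I)
      fix r :: real assume "r > 0"
      then obtain y where y: "y \<in> G" "dist y x < r / 2"
        using x unfolding closure_approachable by (meson half_gt_zero)
      then have "(\<lambda>N. y - trunc N y) \<longlonglongrightarrow> y - y"
        unfolding G_def by (intro tendsto_diff) auto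
      then obtain N0 where N0: "\<And>N. N \<ge> N0 \<Longrightarrow> norm (y - trunc N y) < r / 2"
        using LIMSEQ_D[of "\<lambda>N. y - trunc N y" 0 "r/2"] \<open>r > 0\<close> by auto
      have "norm (x - trunc N x - 0) < r" if "N \<ge> N0" for N
      proof -
        have "x - trunc N x = ((x - y) - trunc N (x - y)) + (y - trunc N y)"
          by (simp add: trunc_diff)
        then have "norm (x - trunc N x) \<le> norm ((x - y) - trunc N (x - y)) + norm (y - trunc N y)"
          by (metis norm_triangle_ineq)
        also have "\<dots> < r / 2 + r / 2"
          using norm_diff_trunc_le[of "x - y" N] y(2) N0[OF that]
          by (simp add: dist_norm norm_minus_commute)
        finally show ?thesis by simp
      qed
      then show "\<exists>N0. \<forall>N\<ge>N0. norm (x - trunc N x - 0) < r" by blast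
    qed
    then show "x \<in> G" unfolding G_def
      using tendsto_diff[OF tendsto_const[of x]] by fastforce
  qed
  ultimately have "closure (complex_vector.span (range f)) \<subseteq> G"
    using closure_mono by blast
  then show ?thesis using dense by (auto simp: G_def)
qed

lemma cinner_expansion: "(\<lambda>N. \<Sum>j<N. cinner x (f j) * cnj (cinner y (f j))) \<longlonglongrightarrow> cinner x y"
proof -
  have "(\<lambda>N. cinner (trunc N x) (trunc N y)) \<longlonglongrightarrow> cinner x y"
    by (intro cinner_tendsto trunc_tendsto)
  then show ?thesis
    by (simp add: trunc_def orthonormal_sum_cinner[OF ortho])
qed

end

section \<open>Complex linear operators\<close>

type_synonym 'h endo = "'h \<Rightarrow>\<^sub>L 'h"

lemma blinfun_apply_scaleC [simp]:
  "blinfun_apply (c *\<^sub>C T) x = c *\<^sub>C blinfun_apply (T :: 'a::real_normed_vector \<Rightarrow>\<^sub>L 'h::chilbert_space) x"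
  unfolding scaleC_blinfun_def
  by (subst bounded_linear_Blinfun_apply)
    (auto intro: bounded_linear_compose[OF bounded_linear_scaleC] blinfun.bounded_linear_right)

lemma norm_blinfun_scaleC_le:
  "norm (c *\<^sub>C T) \<le> cmod c * norm (T :: 'a::real_normed_vector \<Rightarrow>\<^sub>L 'h::chilbert_space)"
  by (rule norm_blinfun_bound)
    (auto simp: norm_scaleC mult.assoc intro: mult_left_mono norm_blinfun)

lemma norm_blinfun_scaleC:
  "norm (c *\<^sub>C T) = cmod c * norm (T :: 'a::real_normed_vector \<Rightarrow>\<^sub>L 'h::chilbert_space)"
proof (cases "c = 0")
  case False
  have "norm T = norm (inverse c *\<^sub>C c *\<^sub>C T)" using False by (simp add: scaleC_scaleC)
  also have "\<dots> \<le> cmod (inverse c) * norm (c *\<^sub>C T)" by (rule norm_blinfun_scaleC_le)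
  finally have "cmod c * norm T \<le> norm (c *\<^sub>C T)" using False by (simp add: norm_divide field_simps)
  then show ?thesis using norm_blinfun_scaleC_le[of c T] by simp
qed simp

lemma scaleC_of_real_blinfun:
  "of_real r *\<^sub>C T = r *\<^sub>R (T :: 'a::real_normed_vector \<Rightarrow>\<^sub>L 'h::chilbert_space)"
  by (rule blinfun_eqI) (simp add: blinfun.scaleR_left scaleR_scaleC)

lemma blinfun_compose_add_right: "C o\<^sub>L (A + B) = (C o\<^sub>L A) + (C o\<^sub>L B)"
  by (rule blinfun_eqI) (simp add: blinfun.add_left blinfun.add_right)

lemma clinear_opsD: "A \<in> clinear_ops \<Longrightarrow> A (c *\<^sub>C x) = c *\<^sub>C A x"
  by (simp add: clinear_ops_def)

lemma clinear_ops_zero: "0 \<in> clinear_ops"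
  by (simp add: clinear_ops_def)

lemma clinear_ops_id: "id_blinfun \<in> clinear_ops"
  by (simp add: clinear_ops_def)

lemma clinear_ops_add: "A \<in> clinear_ops \<Longrightarrow> B \<in> clinear_ops \<Longrightarrow> A + B \<in> clinear_ops"
  by (simp add: clinear_ops_def blinfun.add_left scaleC_add_right)

lemma clinear_ops_diff: "A \<in> clinear_ops \<Longrightarrow> B \<in> clinear_ops \<Longrightarrow> A - B \<in> clinear_ops"
  by (simp add: clinear_ops_def blinfun.diff_left scaleC_diff_right)

lemma clinear_ops_scaleC: "A \<in> clinear_ops \<Longrightarrow> c *\<^sub>C A \<in> clinear_ops"
  by (simp add: clinear_ops_def scaleC_scaleC mult.commute)

lemma clinear_ops_scaleR: "A \<in> clinear_ops \<Longrightarrow> r *\<^sub>R A \<in> clinear_ops"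
  using clinear_ops_scaleC[of A "complex_of_real r"] by (simp add: scaleC_of_real_blinfun)

lemma clinear_ops_compose: "A \<in> clinear_ops \<Longrightarrow> B \<in> clinear_ops \<Longrightarrow> A o\<^sub>L B \<in> clinear_ops"
  by (simp add: clinear_ops_def)

lemma clinear_ops_sum: "(\<And>i. i \<in> I \<Longrightarrow> A i \<in> clinear_ops) \<Longrightarrow> sum A I \<in> clinear_ops"
  by (induction I rule: infinite_finite_induct) (auto intro: clinear_ops_add clinear_ops_zero)

text \<open>Limits are formed in a type that records only real linearity, so complex linearity has
  to be carried along; this serves the square root iteration and the Gram series of the
  module.\<close>

lemma clinear_ops_closed:
  assumes "\<And>n. A n \<in> clinear_ops" "A \<longlonglongrightarrow> L"
  shows "L \<in> clinear_ops"
proof -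
  have ap: "(\<lambda>n. (A n) x) \<longlonglongrightarrow> L x" for x
    by (intro blinfun.tendsto assms tendsto_const)
  have "(\<lambda>n. c *\<^sub>C (A n) x) \<longlonglongrightarrow> L (c *\<^sub>C x)" for c x
    using ap[of "c *\<^sub>C x"] assms(1) by (simp add: clinear_opsD)
  moreover have "(\<lambda>n. c *\<^sub>C (A n) x) \<longlonglongrightarrow> c *\<^sub>C L x" for c x
    by (intro bounded_linear.tendsto[OF bounded_linear_scaleC] ap)
  ultimately show ?thesis
    unfolding clinear_ops_def using LIMSEQ_unique by blast
qed

lemma clinear_op_of_function:
  fixes g :: "'h::chilbert_space \<Rightarrow> 'h"
  assumes "\<And>x y. g (x + y) = g x + g y" "\<And>c x. g (c *\<^sub>C x) = c *\<^sub>C g x"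
    and "\<And>x. norm (g x) \<le> norm x * K"
  obtains A where "A \<in> clinear_ops" "blinfun_apply A = g"
proof -
  have "bounded_linear g"
    by (rule bounded_linear_intro[where K = K]) (auto simp: assms scaleR_scaleC)
  then have "blinfun_apply (Blinfun g) = g" by (rule bounded_linear_Blinfun_apply)
  then show ?thesis by (intro that[of "Blinfun g"]) (simp_all add: clinear_ops_def assms)
qed

text \<open>Unlike the iterate \<open>(^^)\<close> of the underlying function, this power stays in
  the operator type and can be composed there.\<close>

primrec blinfun_power :: "('a::real_normed_vector \<Rightarrow>\<^sub>L 'a) \<Rightarrow> nat \<Rightarrow> ('a \<Rightarrow>\<^sub>L 'a)" where
  "blinfun_power A 0 = id_blinfun"
| "blinfun_power A (Suc n) = A o\<^sub>L blinfun_power A n"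

lemma blinfun_apply_power: "(blinfun_power A n) x = (blinfun_apply A ^^ n) x"
  by (induction n) auto

lemma clinear_ops_power: "A \<in> clinear_ops \<Longrightarrow> blinfun_power A n \<in> clinear_ops"
  by (induction n) (auto intro: clinear_ops_id clinear_ops_compose)

text \<open>The inner product separates vectors, so adjoints are unique and exhibiting one evaluates
  the definite description.\<close>

lemma cadjoint_eqI:
  assumes "\<And>x y. cinner (blinfun_apply A x) y = cinner x (blinfun_apply B y)"
  shows "cadjoint A = B"
  unfolding cadjoint_def
proof (rule the_equality)
  fix B' assume B': "\<forall>x y. cinner (blinfun_apply A x) y = cinner x (blinfun_apply B' y)"
  show "B' = B"
    by (rule blinfun_eqI, rule cinner_ext_right) (metis assms B')
qed (use assms in blast)

text \<open>Common source of the adjoint and of the shift: linear coefficients whose square sums are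
  bounded by \<open>(K * norm x)\<close> squared define an operator of norm at most
  \<open>K\<close>, by Riesz-Fischer and Pythagoras.\<close>

lemma series_operator:
  fixes g :: "nat \<Rightarrow> 'h::chilbert_space" and c :: "'h \<Rightarrow> nat \<Rightarrow> complex"
  assumes g: "orthonormal g"
    and c: "\<And>x y j. c (x + y) j = c x j + c y j" "\<And>d x j. c (d *\<^sub>C x) j = d * c x j"
    and K: "0 \<le> K" and bound: "\<And>x n. (\<Sum>j<n. (cmod (c x j))\<^sup>2) \<le> (K * norm x)\<^sup>2"
  obtains B where "B \<in> clinear_ops" "norm B \<le> K"
    "\<And>x. (\<lambda>n. \<Sum>j<n. c x j *\<^sub>C g j) \<longlonglongrightarrow> blinfun_apply B x"
proof -
  have sm: "summable (\<lambda>j. c x j *\<^sub>C g j)" for x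
    by (rule Riesz_Fischer[OF g], rule summableI_nonneg_bounded[OF _ bound]) simp
  define s where "s x = (\<Sum>j. c x j *\<^sub>C g j)" for x
  have lim: "(\<lambda>n. \<Sum>j<n. c x j *\<^sub>C g j) \<longlonglongrightarrow> s x" for x
    unfolding s_def by (rule summable_LIMSEQ[OF sm])
  have sadd: "s (x + y) = s x + s y" for x y
    unfolding s_def using sm by (simp add: suminf_add c scaleC_add_left)
  have sscale: "s (d *\<^sub>C x) = d *\<^sub>C s x" for d x
    unfolding s_def using bounded_linear.suminf[OF bounded_linear_scaleC sm, of d x]
    by (simp add: c scaleC_scaleC)
  have snorm: "norm (s x) \<le> norm x * K" for x
  proof (rule LIMSEQ_le_const2[OF tendsto_norm[OF lim]], intro exI allI impI)
    fix n
    have "(norm (\<Sum>j<n. c x j *\<^sub>C g j))\<^sup>2 \<le> (norm x * K)\<^sup>2"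
      using bound[of x n] by (simp add: orthonormal_sum_norm[OF g] mult.commute)
    then show "norm (\<Sum>j<n. c x j *\<^sub>C g j) \<le> norm x * K"
      by (rule power2_le_imp_le) (simp add: K)
  qed
  obtain B where B: "B \<in> clinear_ops" "blinfun_apply B = s"
    using clinear_op_of_function[of s, OF sadd sscale snorm] by blast
  have "norm B \<le> K"
    by (rule norm_blinfun_bound[OF K]) (use snorm in \<open>simp add: B(2) mult.commute[of K]\<close>)
  with B lim show ?thesis by (intro that[of B]) simp_all
qed

section \<open>Adjoints\<close>

context onb_sequence
begin

text \<open>The adjoint is assembled from the coefficients that it must have. On truncations the
  adjoint relation is an identity between finite sums, and both sides pass to the limit.\<close>

lemma adjoint_exists:
  fixes A :: "'h endo"
  assumes A: "A \<in> clinear_ops"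
  obtains B where "B \<in> clinear_ops" "\<And>x y. cinner (blinfun_apply A x) y = cinner x (blinfun_apply B y)"
    "norm B \<le> norm A"
proof -
  define c where "c y j = cinner y (A (f j))" for y j
  have bound: "(\<Sum>j<n. (cmod (c y j))\<^sup>2) \<le> (norm A * norm y)\<^sup>2" for y n
  proof -
    \<comment> \<open>Testing \<open>A\<close> on the partial sum itself gives \<open>norm u\<close>
      squared as \<open>cinner y (A u)\<close>, which is at most
      \<open>norm y * norm A * norm u\<close>; cancelling one factor \<open>norm u\<close> bounds
      the coefficients uniformly in \<open>n\<close>.\<close>
    define u where "u = (\<Sum>j<n. c y j *\<^sub>C f j)"
    have u: "(norm u)\<^sup>2 = (\<Sum>j<n. (cmod (c y j))\<^sup>2)"
      unfolding u_def by (rule orthonormal_sum_norm[OF ortho]) simp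
    have "cinner y (A u) = (\<Sum>j<n. complex_of_real ((cmod (c y j))\<^sup>2))"
      unfolding u_def
      by (simp add: blinfun.sum_right clinear_opsD[OF A] cinner_sum_right cinner_scaleC_right
          complex_norm_square c_def mult.commute del: of_real_power)
    also have "\<dots> = complex_of_real ((norm u)\<^sup>2)" by (simp only: u of_real_sum)
    finally have "(norm u)\<^sup>2 = cmod (cinner y (A u))"
      by (simp add: norm_power)
    also have "\<dots> \<le> norm y * (norm A * norm u)"
      by (rule order_trans[OF cinner_Cauchy_Schwarz]) (intro mult_left_mono norm_blinfun norm_ge_zero)
    finally have "norm u * norm u \<le> (norm A * norm y) * norm u"
      by (simp add: power2_eq_square mult_ac)
    then have "norm u \<le> norm A * norm y"
      by (cases "norm u = 0") auto
    then have "(norm u)\<^sup>2 \<le> (norm A * norm y)\<^sup>2" by (intro power_mono) auto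
    then show ?thesis by (simp add: u)
  qed
  obtain B where B: "B \<in> clinear_ops" "norm B \<le> norm A"
    "\<And>y. (\<lambda>n. \<Sum>j<n. c y j *\<^sub>C f j) \<longlonglongrightarrow> B y"
    by (rule series_operator[OF ortho _ _ norm_ge_zero bound])
      (simp_all add: c_def cinner_add_left cinner_scaleC_left)
  have "cinner (A x) y = cinner x (B y)" for x y
  proof -
    have eq: "cinner (A (trunc n x)) y = cinner (trunc n x) (\<Sum>j<n. c y j *\<^sub>C f j)" for n
      unfolding trunc_def orthonormal_sum_cinner[OF ortho finite_lessThan]
      by (simp add: blinfun.sum_right clinear_opsD[OF A] cinner_sum_left cinner_scaleC_left c_def
          cinner_commute[symmetric])
    have "(\<lambda>n. cinner (A (trunc n x)) y) \<longlonglongrightarrow> cinner (A x) y"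
      by (intro cinner_tendsto blinfun.tendsto tendsto_const trunc_tendsto)
    moreover have "(\<lambda>n. cinner (A (trunc n x)) y) \<longlonglongrightarrow> cinner x (B y)"
      unfolding eq by (intro cinner_tendsto trunc_tendsto B(3))
    ultimately show ?thesis by (rule LIMSEQ_unique)
  qed
  then show ?thesis using that B(1,2) by blast
qed

lemma
  fixes A :: "'h endo"
  assumes A: "A \<in> clinear_ops"
  shows cadjoint_clinear: "cadjoint A \<in> clinear_ops"
    and cinner_cadjoint: "cinner (A x) y = cinner x (cadjoint A y)"
    and norm_cadjoint_le: "norm (cadjoint A) \<le> norm A"
proof -
  obtain B where B: "B \<in> clinear_ops" "\<And>x y. cinner (A x) y = cinner x (B y)"
    "norm B \<le> norm A"
    using adjoint_exists[OF A] by blast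
  have "cadjoint A = B" by (rule cadjoint_eqI) (rule B(2))
  with B show "cadjoint A \<in> clinear_ops"
    "cinner (A x) y = cinner x (cadjoint A y)"
    "norm (cadjoint A) \<le> norm A" by simp_all
qed

lemma cinner_cadjoint_left:
  fixes A :: "'h endo"
  assumes "A \<in> clinear_ops"
  shows "cinner (cadjoint A x) y = cinner x (A y)"
  by (metis assms cinner_cadjoint cinner_commute)

lemma cadjoint_cadjoint: "(A :: 'h endo) \<in> clinear_ops \<Longrightarrow> cadjoint (cadjoint A) = A"
  by (rule cadjoint_eqI) (rule cinner_cadjoint_left)

lemma cadjoint_compose:
  fixes A B :: "'h endo"
  assumes "A \<in> clinear_ops" "B \<in> clinear_ops"
  shows "cadjoint (A o\<^sub>L B) = cadjoint B o\<^sub>L cadjoint A"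
  by (rule cadjoint_eqI) (simp add: cinner_cadjoint assms)

lemma cadjoint_scaleC:
  fixes A :: "'h endo"
  assumes "A \<in> clinear_ops"
  shows "cadjoint (c *\<^sub>C A) = cnj c *\<^sub>C cadjoint A"
  by (rule cadjoint_eqI) (simp add: cinner_scaleC_left cinner_scaleC_right cinner_cadjoint assms)

lemma cadjoint_zero: "cadjoint 0 = (0 :: 'h endo)"
  by (rule cadjoint_eqI) simp

lemma op_eqI:
  assumes "\<And>x y. cinner (blinfun_apply A x) y = cinner (blinfun_apply B x) (y::'h)"
  shows "A = B"
  by (rule blinfun_eqI, rule cinner_ext_left) (rule assms)

section \<open>The one-sided shift and the truncation operators\<close>

definition shift :: "'h endo" where
  "shift = Blinfun (\<lambda>x. \<Sum>j. cinner x (f j) *\<^sub>C f (Suc j))"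

text \<open>Everything is read off the partial sums. The inner product formula is Parseval, since
  \<open>shift x\<close> has the same coefficients as \<open>x\<close> in another orthonormal
  family; the coefficient formulas are limits of eventually constant sequences.\<close>

lemma
  shows shift_clinear: "shift \<in> clinear_ops"
    and cinner_shift: "cinner (shift x) (shift y) = cinner x y"
    and cinner_shift_zero: "cinner (shift x) (f 0) = 0"
    and cinner_shift_Suc: "cinner (shift x) (f (Suc j)) = cinner x (f j)"
proof -
  have o: "orthonormal (\<lambda>j. f (Suc j))" using ortho by (simp add: orthonormal_def)
  have "\<exists>B\<in>clinear_ops. \<forall>x. (\<lambda>n. \<Sum>j<n. cinner x (f j) *\<^sub>C f (Suc j)) \<longlonglongrightarrow> blinfun_apply B x"
    using series_operator[OF o, of "\<lambda>x j. cinner x (f j)" 1] Bessel_le[OF ortho finite_lessThan]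
    by (simp add: cinner_add_left cinner_scaleC_left) metis
  then obtain B where B: "B \<in> clinear_ops"
    "\<And>x. (\<lambda>n. \<Sum>j<n. cinner x (f j) *\<^sub>C f (Suc j)) \<longlonglongrightarrow> B x"
    by blast
  have "blinfun_apply B = (\<lambda>x. \<Sum>j. cinner x (f j) *\<^sub>C f (Suc j))"
    using B(2) by (intro ext sums_unique) (simp add: sums_def)
  then have "shift = Blinfun (blinfun_apply B)" unfolding shift_def by simp
  then have sh: "shift = B" by (simp add: blinfun_apply_inverse)
  note lim = B(2)[folded sh]
  show "shift \<in> clinear_ops" using B(1) sh by simp
  have "(\<lambda>n. cinner (\<Sum>j<n. cinner x (f j) *\<^sub>C f (Suc j)) (\<Sum>j<n. cinner y (f j) *\<^sub>C f (Suc j)))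
      \<longlonglongrightarrow> cinner (shift x) (shift y)"
    by (intro cinner_tendsto lim)
  then have "(\<lambda>n. \<Sum>j<n. cinner x (f j) * cnj (cinner y (f j))) \<longlonglongrightarrow> cinner (shift x) (shift y)"
    by (simp add: orthonormal_sum_cinner[OF o])
  then show "cinner (shift x) (shift y) = cinner x y"
    by (rule LIMSEQ_unique[OF _ cinner_expansion])
  have fk: "(\<lambda>n. cinner (\<Sum>i<n. cinner x (f i) *\<^sub>C f (Suc i)) (f k)) \<longlonglongrightarrow> cinner (shift x) (f k)" for k
    by (intro cinner_tendsto lim tendsto_const)
  have "cinner (\<Sum>i<n. cinner x (f i) *\<^sub>C f (Suc i)) (f 0) = 0" for n
    using ortho by (simp add: cinner_sum_left cinner_scaleC_left orthonormal_def)
  then have "(\<lambda>n. cinner (\<Sum>i<n. cinner x (f i) *\<^sub>C f (Suc i)) (f 0)) \<longlonglongrightarrow> 0"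
    by simp
  then show "cinner (shift x) (f 0) = 0"
    by (rule LIMSEQ_unique[OF fk])
  have "\<forall>\<^sub>F n in sequentially.
      cinner (\<Sum>i<n. cinner x (f i) *\<^sub>C f (Suc i)) (f (Suc j)) = cinner x (f j)"
    unfolding eventually_sequentially
    using orthonormal_cinner_sum[OF o finite_lessThan, of _ _ j]
    by (intro exI[of _ "Suc j"]) auto
  then show "cinner (shift x) (f (Suc j)) = cinner x (f j)"
    by (rule LIMSEQ_unique[OF fk tendsto_eventually])
qed

lemma cinner_shift_power:
  "cinner ((blinfun_apply shift ^^ n) x) ((blinfun_apply shift ^^ n) y) = cinner x y"
  by (induction n) (simp_all add: cinner_shift)

lemma cinner_shift_power_basis:
  "j < n \<Longrightarrow> cinner ((blinfun_apply shift ^^ n) x) (f j) = 0"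
proof (induction n arbitrary: j)
  case (Suc n)
  then show ?case by (cases j) (simp_all add: cinner_shift_zero cinner_shift_Suc)
qed simp

lemma cinner_shift_power_trunc:
  "m \<le> n \<Longrightarrow> cinner ((blinfun_apply shift ^^ n) x) (trunc m y) = 0"
  by (simp add: trunc_def cinner_sum_right cinner_scaleC_right cinner_shift_power_basis)

lemma norm_shift: "norm (shift x) = norm x"
  using cinner_shift[of x x] by (simp add: norm_eq_sqrt_cinner)

lemma norm_shift_power: "norm ((blinfun_apply shift ^^ n) x) = norm x"
  by (induction n) (simp_all add: norm_shift)

definition trunc_op :: "nat \<Rightarrow> 'h \<Rightarrow>\<^sub>L 'h" where
  "trunc_op N = Blinfun (trunc N)"

lemma
  shows trunc_op_clinear: "trunc_op N \<in> clinear_ops"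
    and trunc_op_apply [simp]: "(trunc_op N) x = trunc N x"
proof -
  obtain B where B: "B \<in> clinear_ops" "blinfun_apply B = trunc N"
    using clinear_op_of_function[of "trunc N" 1, OF trunc_add trunc_scaleC] norm_trunc_le by auto
  then have "trunc_op N = B" unfolding trunc_op_def by (metis blinfun_apply_inverse)
  with B show "trunc_op N \<in> clinear_ops" "(trunc_op N) x = trunc N x" by simp_all
qed

lemma cinner_trunc: "cinner (trunc N x) y = cinner x (trunc N y)"
  by (simp add: trunc_def cinner_sum_left cinner_sum_right cinner_scaleC_left cinner_scaleC_right
      cinner_commute[symmetric] mult.commute)

lemma cadjoint_trunc_op: "cadjoint (trunc_op N) = trunc_op N"
  by (rule cadjoint_eqI) (simp add: cinner_trunc)

end

section \<open>Compact operators\<close>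

lemma compact_opsI:
  assumes "A \<in> clinear_ops" "compact K" "blinfun_apply A ` cball 0 1 \<subseteq> K"
  shows "A \<in> compact_ops"
proof -
  have "closure (blinfun_apply A ` cball 0 1) \<subseteq> K"
    using assms by (simp add: closure_minimal compact_imp_closed)
  then have "compact (closure (blinfun_apply A ` cball 0 1))"
    using closed_Int_compact[OF closed_closure assms(2), of "blinfun_apply A ` cball 0 1"]
    by (simp add: Int_absorb2)
  then show ?thesis using assms by (simp add: compact_ops_def)
qed

lemma compact_ops_clinear: "A \<in> compact_ops \<Longrightarrow> A \<in> clinear_ops"
  by (simp add: compact_ops_def)

lemma compact_ops_add:
  assumes "A \<in> compact_ops" "B \<in> compact_ops"
  shows "A + B \<in> compact_ops"
proof -
  define K L where "K = closure (blinfun_apply A ` cball 0 1)" and "L = closure (blinfun_apply B ` cball 0 1)"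
  have "compact {x + y |x y. x \<in> K \<and> y \<in> L}"
    using assms by (intro compact_sums) (auto simp: K_def L_def compact_ops_def)
  moreover have "blinfun_apply (A + B) ` cball 0 1 \<subseteq> {x + y |x y. x \<in> K \<and> y \<in> L}"
  proof
    fix z assume "z \<in> blinfun_apply (A + B) ` cball 0 1"
    then obtain x where "x \<in> cball 0 1" "z = A x + B x"
      by (auto simp: blinfun.add_left)
    moreover have "A x \<in> K" "B x \<in> L" if "x \<in> cball 0 1" for x
      using that unfolding K_def L_def by (auto intro!: subsetD[OF closure_subset] simp del: mem_cball)
    ultimately show "z \<in> {x + y |x y. x \<in> K \<and> y \<in> L}" by blast
  qed
  ultimately show ?thesis
    using assms by (intro compact_opsI clinear_ops_add) (auto simp: compact_ops_clinear)
qed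

lemma compact_ops_compose_left:
  assumes "A \<in> compact_ops" "B \<in> clinear_ops"
  shows "B o\<^sub>L A \<in> compact_ops"
proof (rule compact_opsI)
  show "compact (blinfun_apply B ` closure (blinfun_apply A ` cball 0 1))"
    using assms(1) by (intro compact_continuous_image)
      (auto simp: compact_ops_def intro: linear_continuous_on blinfun.bounded_linear_right)
  show "blinfun_apply (B o\<^sub>L A) ` cball 0 1 \<subseteq> blinfun_apply B ` closure (blinfun_apply A ` cball 0 1)"
    using closure_subset by fastforce
qed (use assms in \<open>auto intro: clinear_ops_compose compact_ops_clinear\<close>)

lemma compact_ops_scaleC: "A \<in> compact_ops \<Longrightarrow> c *\<^sub>C A \<in> compact_ops"
proof -
  assume A: "A \<in> compact_ops"
  have "(c *\<^sub>C id_blinfun) o\<^sub>L A = c *\<^sub>C A" by (rule blinfun_eqI) simp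
  then show ?thesis
    using compact_ops_compose_left[OF A clinear_ops_scaleC[OF clinear_ops_id], of c] by simp
qed

lemma compact_ops_zero: "0 \<in> compact_ops"
  by (rule compact_opsI[where K = "{0}"]) (auto simp: clinear_ops_zero)

context onb_sequence
begin

text \<open>Each step adds an operator of rank one, whose values on the unit ball lie in the image
  of the closed unit disc of scalars under \<open>\<lambda>c. c *\<^sub>C f N\<close>.\<close>

lemma trunc_op_compact: "trunc_op N \<in> compact_ops"
proof (induction N)
  case 0
  have "trunc_op 0 = 0" by (rule blinfun_eqI) (simp add: trunc_def)
  then show ?case by (simp add: compact_ops_zero)
next
  case (Suc N)
  define R where "R = trunc_op (Suc N) - trunc_op N"
  have ap: "R x = cinner x (f N) *\<^sub>C f N" for x
    by (simp add: R_def blinfun.diff_left trunc_def)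
  have "R \<in> compact_ops"
  proof (rule compact_opsI)
    show "R \<in> clinear_ops" unfolding R_def by (intro clinear_ops_diff trunc_op_clinear)
    have bl: "bounded_linear (\<lambda>c. c *\<^sub>C f N)"
      by (rule bounded_linear_intro[where K = "norm (f N)"])
        (simp_all add: scaleC_add_left scaleR_scaleC scaleC_scaleC norm_scaleC scaleR_conv_of_real)
    show "compact ((\<lambda>c. c *\<^sub>C f N) ` cball 0 1)"
      by (intro compact_continuous_image linear_continuous_on bl compact_cball)
    have "norm (f N) = 1" using ortho by (simp add: norm_eq_sqrt_cinner orthonormal_def)
    then have "cmod (cinner x (f N)) \<le> norm x" for x
      using cinner_Cauchy_Schwarz[of x "f N"] by simp
    then have "cinner x (f N) \<in> cball 0 1" if "x \<in> cball 0 1" for x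
      using that order_trans[of "cmod (cinner x (f N))" "norm x" 1] by simp
    then show "blinfun_apply R ` cball 0 1 \<subseteq> (\<lambda>c. c *\<^sub>C f N) ` cball 0 1"
      by (auto simp: ap)
  qed
  then have "R + trunc_op N \<in> compact_ops" using Suc.IH by (rule compact_ops_add)
  then show ?case by (simp add: R_def)
qed

text \<open>Pointwise convergence of the truncations is uniform on the compact closure of the image
  of the unit ball: it is controlled on a finite \<open>r/4\<close>-net and spreads to the rest by
  contractivity. Without compactness it fails, as the identity shows in infinite dimension.\<close>

lemma compact_trunc_approx:
  fixes A :: "'h endo"
  assumes A: "A \<in> compact_ops"
  shows "(\<lambda>N. norm (A - (trunc_op N o\<^sub>L A))) \<longlonglongrightarrow> 0"
proof (rule LIMSEQ_I)
  fix r :: real assume r: "r > 0"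
  define K where "K = closure (blinfun_apply A ` cball 0 1)"
  have "compact K" using A by (simp add: K_def compact_ops_def)
  then obtain S where S: "finite S" "S \<subseteq> K" "K \<subseteq> (\<Union>x\<in>S. ball x (r/4))"
  proof (rule compactE_image[of K K "\<lambda>x. ball x (r/4)"])
    show "K \<subseteq> (\<Union>x\<in>K. ball x (r/4))" using r by force
  qed auto
  have "\<forall>\<^sub>F N in sequentially. \<forall>s\<in>S. norm (s - trunc N s) < r/4"
  proof (rule eventually_ball_finite[OF S(1)], rule ballI)
    fix s
    have "(\<lambda>N. s - trunc N s) \<longlonglongrightarrow> s - s" by (intro tendsto_diff tendsto_const trunc_tendsto)
    then show "\<forall>\<^sub>F N in sequentially. norm (s - trunc N s) < r/4"
      using r by (auto dest!: tendstoD[of _ 0 _ "r/4"])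
  qed
  then obtain N0 where N0: "\<And>N s. N \<ge> N0 \<Longrightarrow> s \<in> S \<Longrightarrow> norm (s - trunc N s) < r/4"
    unfolding eventually_sequentially by blast
  have "norm (A - (trunc_op N o\<^sub>L A)) \<le> r / 2" if N: "N \<ge> N0" for N
  proof (rule norm_blinfun_bound)
    fix x :: 'h
    have unit: "norm (y - trunc N y) \<le> r / 2" if "y \<in> K" for y
    proof -
      have "y \<in> (\<Union>x\<in>S. ball x (r/4))" using S(3) that by (rule subsetD)
      then obtain s where s: "s \<in> S" "y \<in> ball s (r/4)" by (rule UN_E)
      have "y - trunc N y = ((y - s) - trunc N (y - s)) + (s - trunc N s)"
        by (simp add: trunc_diff)
      then have "norm (y - trunc N y) \<le> norm ((y - s) - trunc N (y - s)) + norm (s - trunc N s)"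
        by (metis norm_triangle_ineq)
      also have "\<dots> \<le> r/4 + r/4"
        using norm_diff_trunc_le[of "y - s" N] s(2) N0[OF N s(1)] by (simp add: dist_norm norm_minus_commute)
      finally show ?thesis by simp
    qed
    show "norm ((A - (trunc_op N o\<^sub>L A)) x) \<le> r / 2 * norm x"
    proof (cases "x = 0")
      case False
      define u where "u = inverse (norm x) *\<^sub>R x"
      have "u \<in> cball 0 1" using False by (simp add: u_def)
      then have "A u \<in> K" unfolding K_def by (intro subsetD[OF closure_subset] imageI)
      then have "norm ((A - (trunc_op N o\<^sub>L A)) u) \<le> r / 2"
        using unit by (simp add: blinfun.diff_left)
      moreover have "(A - (trunc_op N o\<^sub>L A)) u
          = inverse (norm x) *\<^sub>R (A - (trunc_op N o\<^sub>L A)) x"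
        by (simp only: u_def blinfun.scaleR_right)
      ultimately show ?thesis using False by (simp add: field_simps)
    qed simp
  qed (use r in simp)
  then show "\<exists>N0. \<forall>N\<ge>N0. norm (norm (A - (trunc_op N o\<^sub>L A)) - 0) < r"
    using r by (intro exI[of _ N0] allI impI) (smt (verit) norm_ge_zero real_norm_def field_sum_of_halves)
qed

end

section \<open>Positive operators, square roots and polar decomposition\<close>

lemma positive_op_clinear: "positive_op P \<Longrightarrow> P \<in> clinear_ops"
  by (simp add: positive_op_def)

lemma positive_op_Re: "positive_op P \<Longrightarrow> 0 \<le> Re (cinner (P x) x)"
  by (auto simp: positive_op_def complex_nonneg_Reals_iff)

text \<open>Polarisation: reality of the quadratic form at \<open>x + y\<close> matches the
  imaginary parts, and at \<open>x + \<i> *\<^sub>C y\<close> the real parts.\<close>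

lemma positive_op_hermitian:
  assumes "positive_op P"
  shows "cinner (P x) y = cinner x (P y)"
proof -
  have im: "Im (cinner (P z) z) = 0" for z
    using assms by (auto simp: positive_op_def complex_nonneg_Reals_iff)
  note P = positive_op_clinear[OF assms]
  from im[of "x + y"] im[of "x + \<i> *\<^sub>C y"] im[of x] im[of y]
  have "cinner (P y) x = cnj (cinner (P x) y)"
    by (simp add: blinfun.add_right cinner_add_left cinner_add_right clinear_opsD[OF P]
        cinner_scaleC_left cinner_scaleC_right complex_eq_iff)
  then show ?thesis by (metis cinner_commute)
qed

lemma positive_opI:
  assumes "P \<in> clinear_ops"
    and herm: "\<And>x. cinner (P x) x = cinner x (P x)"
    and "\<And>x. 0 \<le> Re (cinner (P x) x)"
  shows "positive_op P"
proof -
  have "Im (cinner (P x) x) = 0" for x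
    using arg_cong[OF cinner_commute[of "blinfun_apply P x" x], of Im] herm[of x] by simp
  then show ?thesis using assms by (simp add: positive_op_def complex_nonneg_Reals_iff)
qed

lemma positive_op_Cauchy_Schwarz:
  assumes "positive_op P"
  shows "(cmod (cinner (P x) y))\<^sup>2
    \<le> Re (cinner (P x) x) * Re (cinner (P y) y)"
proof (rule Cauchy_Schwarz_form[where g = "\<lambda>x y. cinner (blinfun_apply P x) y"])
  show "cinner (P x) y = cnj (cinner (P y) x)" for x y
    by (metis assms positive_op_hermitian cinner_commute)
qed (use assms positive_op_clinear[OF assms] in
    \<open>simp_all add: blinfun.add_right cinner_add_left clinear_opsD cinner_scaleC_left positive_op_Re\<close>)

text \<open>Cauchy-Schwarz for the form of \<open>P\<close> at the pair \<open>x\<close>,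
  \<open>P x\<close>, followed by cancelling the square of \<open>norm (P x)\<close>. It yields both
  the norm bound for positive operators and the fact that a vanishing form value puts
  \<open>x\<close> in the kernel.\<close>

lemma positive_op_norm_square_le:
  assumes P: "positive_op P" and K: "\<And>x. Re (cinner (P x) x) \<le> K * (norm x)\<^sup>2"
  shows "(norm (P x))\<^sup>2 \<le> K * Re (cinner (P x) x)"
proof -
  define n where "n = (norm (P x))\<^sup>2"
  have "n\<^sup>2 = (cmod (cinner (P x) (P x)))\<^sup>2"
    by (simp add: n_def cinner_self norm_power)
  also have "\<dots> \<le> Re (cinner (P x) x) * (K * n)"
    by (rule order_trans[OF positive_op_Cauchy_Schwarz[OF P]])
      (auto simp: n_def intro!: mult_left_mono K positive_op_Re[OF P])
  finally have "n * n \<le> (K * Re (cinner (P x) x)) * n"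
    by (simp add: power2_eq_square mult_ac)
  moreover have "0 \<le> n" by (simp add: n_def)
  \<comment> \<open>The hypothesis \<open>K\<close> forces the constant to be nonnegative as soon as
    a nonzero vector exists; at \<open>x = 0\<close> the product vanishes.\<close>
  moreover have "0 \<le> K * Re (cinner (P x) x)"
  proof (cases "x = 0")
    case False
    have "0 \<le> K * (norm x)\<^sup>2" using K[of x] positive_op_Re[OF P, of x] by linarith
    then have "0 \<le> K" using False by (simp add: zero_le_mult_iff)
    then show ?thesis using positive_op_Re[OF P, of x] by simp
  qed simp
  ultimately show ?thesis unfolding n_def[symmetric]
    by (cases "n = 0") auto
qed

lemma positive_op_norm_le:
  assumes P: "positive_op P" and K: "\<And>x. Re (cinner (P x) x) \<le> K * (norm x)\<^sup>2" "0 \<le> K"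
  shows "norm P \<le> K"
proof (rule norm_blinfun_bound[OF K(2)])
  fix x
  have "(norm (P x))\<^sup>2 \<le> K * Re (cinner (P x) x)"
    by (rule positive_op_norm_square_le[OF P K(1)])
  also have "\<dots> \<le> K * (K * (norm x)\<^sup>2)" by (intro mult_left_mono K)
  also have "\<dots> = (K * norm x)\<^sup>2" by (simp add: power2_eq_square mult_ac)
  finally show "norm (P x) \<le> K * norm x"
    by (rule power2_le_imp_le) (simp add: K)
qed

lemma cinner_op_le_norm: "Re (cinner (blinfun_apply P x) x) \<le> norm P * (norm (x::'h::chilbert_space))\<^sup>2"
proof -
  have "Re (cinner (P x) x) \<le> norm (P x) * norm x"
    using cinner_Cauchy_Schwarz complex_Re_le_cmod order_trans by blast
  also have "\<dots> \<le> (norm P * norm x) * norm x" by (intro mult_right_mono norm_blinfun norm_ge_zero)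
  finally show ?thesis by (simp add: power2_eq_square mult_ac)
qed

lemma positive_op_zeroD:
  assumes "positive_op P" "Re (cinner (P x) x) = 0"
  shows "P x = 0"
  using positive_op_norm_square_le[OF assms(1) cinner_op_le_norm, of x] assms(2) by simp

text \<open>The scalar majorant of the operator iteration below; its increments are
  \<open>(1 - y n)\<close> squared over 2.\<close>

lemma sqrt_iteration_bounds:
  fixes y :: "nat \<Rightarrow> real"
  assumes y: "y 0 = 0" "\<And>n. y (Suc n) = (1 + (y n)\<^sup>2) / 2"
  shows "0 \<le> y n" "y n \<le> 1" "y n \<le> y (Suc n)"
proof -
  show y0: "0 \<le> y n" for n by (cases n) (auto simp: y)
  show y1: "y n \<le> 1" for n
    by (induction n) (auto simp: y power_le_one y0)
  have "0 \<le> (1 - y n)\<^sup>2" by simp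
  then show "y n \<le> y (Suc n)" by (simp add: y(2) power2_eq_square algebra_simps)
qed

text \<open>Newton-like iteration for the square root of \<open>1 - X\<close>: it is dominated by the same
  iteration for the scalar \<open>X = 1\<close>, hence converges in norm.\<close>

lemma positive_sqrt_contraction:
  fixes A :: "'h::chilbert_space endo"
  assumes A: "positive_op A" and A1: "norm A \<le> 1"
  obtains Q where "positive_op Q" "Q o\<^sub>L Q = A" "\<And>B. B o\<^sub>L A = A o\<^sub>L B \<Longrightarrow> B o\<^sub>L Q = Q o\<^sub>L B"
proof -
  define X where "X = id_blinfun - A"
  have Xap: "X x = x - A x" for x by (simp add: X_def blinfun.diff_left)
  have Xcl: "X \<in> clinear_ops"
    unfolding X_def by (intro clinear_ops_diff clinear_ops_id positive_op_clinear A)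
  have Aub: "Re (cinner (A x) x) \<le> (norm x)\<^sup>2" for x
    using cinner_op_le_norm[of A x] mult_right_mono[OF A1, of "(norm x)\<^sup>2"] by simp
  have X: "positive_op X"
    by (rule positive_opI[OF Xcl])
      (simp_all add: Xap cinner_diff_left cinner_diff_right positive_op_hermitian[OF A] cinner_self
        Aub[unfolded positive_op_hermitian[OF A]])
  have X1: "norm X \<le> 1"
    by (rule positive_op_norm_le[OF X])
      (simp_all add: Xap cinner_diff_left cinner_self positive_op_Re[OF A])
  \<comment> \<open>With \<open>Q = 1 - Y\<close> the equation \<open>Q^2 = 1 - X\<close> reads
    \<open>Y = (X + Y^2) / 2\<close>; this is its fixed point iteration started at 0.\<close>
  define Y where "Y = rec_nat (0 :: 'h endo) (\<lambda>_ Z. (1/2) *\<^sub>R (X + (Z o\<^sub>L Z)))"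
  have Y: "Y 0 = 0" "\<And>n. Y (Suc n) = (1/2) *\<^sub>R (X + (Y n o\<^sub>L Y n))" by (simp_all add: Y_def)
  define y where "y = rec_nat (0::real) (\<lambda>_ z. (1 + z\<^sup>2) / 2)"
  have y: "y 0 = 0" "\<And>n. y (Suc n) = (1 + (y n)\<^sup>2) / 2" by (simp_all add: y_def)
  note yb = sqrt_iteration_bounds[OF y]
  have Yn: "norm (Y n) \<le> y n" for n
  proof (induction n)
    case (Suc n)
    have "norm (X + (Y n o\<^sub>L Y n)) \<le> 1 + y n * y n"
      by (intro norm_triangle_mono X1 order_trans[OF norm_blinfun_compose] mult_mono Suc yb norm_ge_zero)
    then show ?case by (simp add: Y y power2_eq_square)
  qed (simp add: Y y)
  have Yd: "norm (Y (Suc n) - Y n) \<le> y (Suc n) - y n" for n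
  proof (induction n)
    case 0
    show ?case using X1 by (simp add: Y y)
  next
    case (Suc n)
    \<comment> \<open>A difference of squares is split as \<open>B (B - C) + (B - C) C\<close>,
      which holds in any ring, commutative or not. The scalar increments factor in the same way, so
      the majorant is reproduced exactly.\<close>
    have "Y (Suc (Suc n)) - Y (Suc n)
        = (1/2) *\<^sub>R ((Y (Suc n) o\<^sub>L (Y (Suc n) - Y n)) + ((Y (Suc n) - Y n) o\<^sub>L Y n))"
      by (rule blinfun_eqI)
        (simp add: Y(2)[of "Suc n"] Y(2)[of n, symmetric] blinfun.add_left blinfun.diff_left blinfun.scaleR_left
          blinfun.diff_right scaleR_diff_right scaleR_add_right, simp add: Y(2)[of n] blinfun.add_left
          blinfun.scaleR_left blinfun.add_right blinfun.scaleR_right scaleR_add_right)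
    moreover have "norm ((Y (Suc n) o\<^sub>L (Y (Suc n) - Y n)) + ((Y (Suc n) - Y n) o\<^sub>L Y n))
        \<le> y (Suc n) * (y (Suc n) - y n) + (y (Suc n) - y n) * y n"
      using yb(3)[of n]
      by (intro norm_triangle_mono order_trans[OF norm_blinfun_compose] mult_mono Suc yb Yn norm_ge_zero) simp
    ultimately have "norm (Y (Suc (Suc n)) - Y (Suc n))
        \<le> (1/2) * (y (Suc n) * (y (Suc n) - y n) + (y (Suc n) - y n) * y n)"
      by simp
    also have "\<dots> = y (Suc (Suc n)) - y (Suc n)"
      by (simp add: y(2)[of "Suc n"] power2_eq_square algebra_simps)
        (simp add: y(2)[of n] power2_eq_square algebra_simps)
    finally show ?case .
  qed
  have tele: "norm (Y (n + k) - Y n) \<le> y (n + k) - y n" for n k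
  proof (induction k)
    case (Suc k)
    have "norm (Y (n + Suc k) - Y n) \<le> norm (Y (Suc (n + k)) - Y (n + k)) + norm (Y (n + k) - Y n)"
      by (metis add_Suc_right diff_add_cancel add_diff_eq norm_triangle_ineq)
    then show ?case using Suc Yd[of "n + k"] by simp
  qed simp
  have "incseq y" by (rule incseq_SucI) (rule yb)
  then have "convergent y"
    using yb by (intro Bseq_mono_convergent[OF BseqI'[of y 1]]) (auto simp: incseq_def)
  then have "Cauchy y" by (rule convergent_Cauchy)
  have "Cauchy Y"
  proof (rule CauchyI')
    fix \<epsilon> :: real assume "\<epsilon> > 0"
    then obtain M where M: "\<And>m n. m \<ge> M \<Longrightarrow> n \<ge> M \<Longrightarrow> norm (y m - y n) < \<epsilon>"
      using \<open>Cauchy y\<close> CauchyD by blast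
    have "norm (Y m - Y n) < \<epsilon>" if "m \<ge> M" "n > m" for m n
    proof -
      have "norm (Y n - Y m) \<le> y n - y m" using tele[of m "n - m"] that by simp
      then show ?thesis using M[of n m] that by (simp add: norm_minus_commute)
    qed
    then show "\<exists>M. \<forall>m\<ge>M. \<forall>n>m. dist (Y m) (Y n) < \<epsilon>" unfolding dist_norm by blast
  qed
  then obtain L where L: "Y \<longlonglongrightarrow> L" using Cauchy_convergent_iff convergent_def by blast
  have YY: "(\<lambda>n. Y n o\<^sub>L Y n) \<longlonglongrightarrow> (L o\<^sub>L L)"
    by (intro bounded_bilinear.tendsto[OF bounded_bilinear_blinfun_compose] L)
  have "(\<lambda>n. Y (Suc n)) \<longlonglongrightarrow> (1/2) *\<^sub>R (X + (L o\<^sub>L L))"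
    unfolding Y(2) by (intro tendsto_intros YY)
  with LIMSEQ_Suc[OF L] have Leq: "L = (1/2) *\<^sub>R (X + (L o\<^sub>L L))" using LIMSEQ_unique by blast
  have Lap: "L (L x) = 2 *\<^sub>R L x - x + A x" for x
  proof -
    have "L x = ((1/2) *\<^sub>R (X + (L o\<^sub>L L))) x" using Leq by simp
    from arg_cong[OF this, of "\<lambda>u. 2 *\<^sub>R u"]
    have "2 *\<^sub>R L x = x - A x + L (L x)"
      unfolding blinfun.scaleR_left by (simp add: blinfun.add_left Xap)
    then show ?thesis by (simp add: algebra_simps)
  qed
  have Ycl: "Y n \<in> clinear_ops" for n
    by (induction n) (auto simp: Y intro: clinear_ops_zero clinear_ops_scaleR clinear_ops_add clinear_ops_compose Xcl)
  have Lcl: "L \<in> clinear_ops" by (rule clinear_ops_closed[OF Ycl L])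
  have Yh: "cinner (Y n x) z = cinner x (Y n z)" for n x z
    by (induction n arbitrary: x z)
      (simp_all add: Y blinfun.add_left blinfun.scaleR_left scaleR_scaleC cinner_scaleC_left
        cinner_scaleC_right cinner_add_left cinner_add_right positive_op_hermitian[OF X])
  have Lh: "cinner (L x) z = cinner x (L z)" for x z
  proof (rule LIMSEQ_unique)
    show "(\<lambda>n. cinner (Y n x) z) \<longlonglongrightarrow> cinner (L x) z"
      by (intro cinner_tendsto blinfun.tendsto L tendsto_const)
    show "(\<lambda>n. cinner (Y n x) z) \<longlonglongrightarrow> cinner x (L z)"
      unfolding Yh by (intro cinner_tendsto blinfun.tendsto L tendsto_const)
  qed
  have L1: "norm L \<le> 1"
    by (rule LIMSEQ_le_const2[OF tendsto_norm[OF L]]) (use Yn yb(2) order_trans in blast)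
  define Q where "Q = id_blinfun - L"
  have Qap: "Q x = x - L x" for x by (simp add: Q_def blinfun.diff_left)
  have "Re (cinner (L x) x) \<le> (norm x)\<^sup>2" for x
    using cinner_op_le_norm[of L x] mult_right_mono[OF L1, of "(norm x)\<^sup>2"] by simp
  then have "positive_op Q"
    by (intro positive_opI) (auto simp: Q_def blinfun.diff_left cinner_diff_left cinner_diff_right Lh cinner_self
        intro: clinear_ops_diff clinear_ops_id Lcl)
  moreover have "Q o\<^sub>L Q = A"
    by (rule blinfun_eqI) (simp add: Qap blinfun.diff_right Lap scaleR_2)
  \<comment> \<open>Whatever commutes with \<open>A\<close> commutes with \<open>X\<close>, hence
    with every iterate and with their limit. Uniqueness of the square root will rest on
    this.\<close>
  moreover have "B o\<^sub>L Q = Q o\<^sub>L B" if B: "B o\<^sub>L A = A o\<^sub>L B" for B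
  proof -
    have BA: "B (A x) = A (B x)" for x
      using arg_cong[OF B, of "\<lambda>T. blinfun_apply T x"] by simp
    have BY: "B (Y n x) = (Y n) (B x)" for n x
      by (induction n arbitrary: x)
        (simp_all add: Y blinfun.add_left blinfun.scaleR_left blinfun.add_right blinfun.scaleR_right Xap
          blinfun.diff_right BA)
    have "B (L x) = L (B x)" for x
    proof (rule LIMSEQ_unique)
      show "(\<lambda>n. B (Y n x)) \<longlonglongrightarrow> B (L x)"
        by (intro blinfun.tendsto L tendsto_const)
      show "(\<lambda>n. B (Y n x)) \<longlonglongrightarrow> L (B x)"
        unfolding BY by (intro blinfun.tendsto L tendsto_const)
    qed
    then show ?thesis by (intro blinfun_eqI) (simp add: Qap blinfun.diff_right)
  qed
  ultimately show ?thesis by (rule that)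
qed

lemma positive_op_scaleR:
  assumes P: "positive_op P" and r: "0 \<le> r"
  shows "positive_op (r *\<^sub>R P)"
proof (rule positive_opI)
  show "r *\<^sub>R P \<in> clinear_ops" by (rule clinear_ops_scaleR[OF positive_op_clinear[OF P]])
  show "cinner ((r *\<^sub>R P) x) x = cinner x ((r *\<^sub>R P) x)" for x
    by (simp add: blinfun.scaleR_left scaleR_scaleC cinner_scaleC_left cinner_scaleC_right
        positive_op_hermitian[OF P])
  show "0 \<le> Re (cinner ((r *\<^sub>R P) x) x)" for x
    using r positive_op_Re[OF P, of x]
    by (simp add: blinfun.scaleR_left scaleR_scaleC cinner_scaleC_left)
qed

lemma positive_sqrt_exists:
  fixes A :: "'h::chilbert_space endo"
  assumes A: "positive_op A"
  obtains Q where "positive_op Q" "Q o\<^sub>L Q = A" "\<And>B. B o\<^sub>L A = A o\<^sub>L B \<Longrightarrow> B o\<^sub>L Q = Q o\<^sub>L B"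
proof -
  \<comment> \<open>The summand 1 keeps the scaling factor positive when
    \<open>A = 0\<close>.\<close>
  define r where "r = norm A + 1"
  have r: "r > 0" by (simp add: r_def add_nonneg_pos)
  have "positive_op (inverse r *\<^sub>R A)" using A r by (intro positive_op_scaleR) auto
  moreover have "norm (inverse r *\<^sub>R A) \<le> 1" using r by (simp add: r_def field_simps)
  ultimately obtain Q where Q: "positive_op Q" "Q o\<^sub>L Q = inverse r *\<^sub>R A"
    "\<And>B. B o\<^sub>L (inverse r *\<^sub>R A) = (inverse r *\<^sub>R A) o\<^sub>L B \<Longrightarrow> B o\<^sub>L Q = Q o\<^sub>L B"
    using positive_sqrt_contraction by blast
  have QQ: "Q (Q x) = inverse r *\<^sub>R A x" for x
    using arg_cong[OF Q(2), of "\<lambda>T. blinfun_apply T x"] by (simp add: blinfun.scaleR_left)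
  show ?thesis
  proof
    show "positive_op (sqrt r *\<^sub>R Q)" using Q(1) r by (intro positive_op_scaleR) auto
    show "(sqrt r *\<^sub>R Q) o\<^sub>L (sqrt r *\<^sub>R Q) = A"
      using r by (intro blinfun_eqI)
        (simp add: blinfun.scaleR_left blinfun.scaleR_right QQ mult.assoc[symmetric])
    fix B assume "B o\<^sub>L A = A o\<^sub>L B"
    then have "B o\<^sub>L (inverse r *\<^sub>R A) = (inverse r *\<^sub>R A) o\<^sub>L B"
      by (simp add: bounded_bilinear.scaleR_left[OF bounded_bilinear_blinfun_compose]
          bounded_bilinear.scaleR_right[OF bounded_bilinear_blinfun_compose])
    from Q(3)[OF this] show "B o\<^sub>L (sqrt r *\<^sub>R Q) = (sqrt r *\<^sub>R Q) o\<^sub>L B"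
      by (simp add: bounded_bilinear.scaleR_left[OF bounded_bilinear_blinfun_compose]
          bounded_bilinear.scaleR_right[OF bounded_bilinear_blinfun_compose])
  qed
qed

text \<open>For \<open>y = P x - Q x\<close> commutation gives \<open>P y + Q y = 0\<close>. The two
  form values at \<open>y\<close> are nonnegative with sum 0, so \<open>P y = Q y = 0\<close>, and
  moving \<open>P - Q\<close> across the inner product shows \<open>cinner y y = 0\<close>.\<close>

lemma positive_sqrt_unique:
  fixes P Q :: "'h::chilbert_space endo"
  assumes P: "positive_op P" and Q: "positive_op Q" and eq: "P o\<^sub>L P = Q o\<^sub>L Q"
    and comm: "P o\<^sub>L Q = Q o\<^sub>L P"
  shows "P = Q"
proof (rule blinfun_eqI)
  fix x
  have ap: "P (P x) = Q (Q x)"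
    "P (Q x) = Q (P x)" for x
    using arg_cong[OF eq, of "\<lambda>T. blinfun_apply T x"] arg_cong[OF comm, of "\<lambda>T. blinfun_apply T x"] by simp_all
  define y where "y = P x - Q x"
  have "P y + Q y = 0"
    by (simp add: y_def blinfun.diff_right ap)
  then have "cinner (P y) y + cinner (Q y) y = 0"
    by (metis cinner_add_left cinner_zero_left)
  then have "Re (cinner (P y) y) + Re (cinner (Q y) y) = 0"
    by (metis plus_complex.sel(1) zero_complex.sel(1))
  then have "P y = 0" "Q y = 0"
    using positive_op_Re[OF P, of y] positive_op_Re[OF Q, of y]
    by (auto intro!: positive_op_zeroD P Q)
  then have "cinner y y = 0"
    by (subst (1) y_def) (simp add: cinner_diff_left positive_op_hermitian[OF P] positive_op_hermitian[OF Q])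
  then show "P x = Q x"
    by (simp add: cinner_self y_def)
qed

section \<open>Absolute value and polar decomposition\<close>

context onb_sequence
begin

lemma adjoint_product_positive:
  fixes A :: "'h endo"
  assumes "A \<in> clinear_ops"
  shows "positive_op (cadjoint A o\<^sub>L A)"
  using assms
  by (intro positive_opI clinear_ops_compose cadjoint_clinear)
    (auto simp: cinner_cadjoint_left cinner_cadjoint[symmetric] cinner_self)

text \<open>Any positive root \<open>P'\<close> commutes with its square, which is
  \<open>cadjoint A o\<^sub>L A\<close>, and therefore with the constructed root \<open>Q\<close>.
  Thus uniqueness among commuting roots gives uniqueness outright.\<close>

lemma abs_op_eqI:
  fixes A :: "'h endo"
  assumes A: "A \<in> clinear_ops" and P: "positive_op P" "P o\<^sub>L P = cadjoint A o\<^sub>L A"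
  shows "abs_op A = P"
proof -
  obtain Q where Q: "positive_op Q" "Q o\<^sub>L Q = cadjoint A o\<^sub>L A"
    "\<And>B. B o\<^sub>L (cadjoint A o\<^sub>L A) = (cadjoint A o\<^sub>L A) o\<^sub>L B \<Longrightarrow> B o\<^sub>L Q = Q o\<^sub>L B"
    using positive_sqrt_exists[OF adjoint_product_positive[OF A]] by blast
  have "P' = Q" if P': "positive_op P'" "P' o\<^sub>L P' = cadjoint A o\<^sub>L A" for P'
  proof (rule positive_sqrt_unique[OF P'(1) Q(1)])
    have "P' o\<^sub>L (P' o\<^sub>L P') = (P' o\<^sub>L P') o\<^sub>L P'" by (intro blinfun_eqI) simp
    then show "P' o\<^sub>L Q = Q o\<^sub>L P'" by (intro Q(3)) (simp only: P'(2))
  qed (simp only: P'(2) Q(2))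
  then show ?thesis
    unfolding abs_op_def using P by (intro the_equality) auto
qed

lemma
  fixes A :: "'h endo"
  assumes A: "A \<in> clinear_ops"
  shows abs_op_positive: "positive_op (abs_op A)"
    and abs_op_square: "abs_op A o\<^sub>L abs_op A = cadjoint A o\<^sub>L A"
proof -
  obtain Q where Q: "positive_op Q" "Q o\<^sub>L Q = cadjoint A o\<^sub>L A"
    using positive_sqrt_exists[OF adjoint_product_positive[OF A]] by blast
  with abs_op_eqI[OF A Q] show "positive_op (abs_op A)" "abs_op A o\<^sub>L abs_op A = cadjoint A o\<^sub>L A"
    by simp_all
qed

text \<open>This is why sending \<open>abs_op A x\<close> to \<open>A x\<close> is well defined and
  isometric, the germ of the polar decomposition.\<close>

lemma cinner_abs_op:
  fixes A :: "'h endo"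
  assumes A: "A \<in> clinear_ops"
  shows "cinner (abs_op A x) (abs_op A y)
    = cinner (A x) (A y)"
proof -
  have "cinner (abs_op A x) (abs_op A y)
      = cinner ((abs_op A o\<^sub>L abs_op A) x) y"
    by (simp add: positive_op_hermitian[OF abs_op_positive[OF A]])
  then show ?thesis by (simp add: abs_op_square[OF A] cinner_cadjoint_left[OF A])
qed

lemma norm_abs_op:
  fixes A :: "'h endo"
  assumes A: "A \<in> clinear_ops"
  shows "norm (abs_op A x) = norm (A x)"
  using cinner_abs_op[OF A, of x x] by (simp add: norm_eq_sqrt_cinner)

text \<open>With \<open>D = 1 - k\<bar>A\<bar>\<close> for small \<open>k > 0\<close>, the powers \<open>D ^ (2 m)\<close> converge strongly to
  a projection annihilated by \<open>\<bar>A\<bar>\<close>, since \<open>\<parallel>D ^ m x\<parallel>\<close> decreases; the partial isometry is the strong limit of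
  \<open>k A (1 + D + \<dots> + D ^ (2 m - 1))\<close>.\<close>

lemma polar_decomposition:
  fixes A :: "'h endo"
  assumes A: "A \<in> clinear_ops"
  obtains W where "W \<in> clinear_ops" "norm W \<le> 1" "W o\<^sub>L abs_op A = A" "cadjoint W o\<^sub>L A = abs_op A"
proof -
  define R where "R = abs_op A"
  have R: "positive_op R" unfolding R_def by (rule abs_op_positive[OF A])
  have Rcl: "R \<in> clinear_ops" by (rule positive_op_clinear[OF R])
  \<comment> \<open>Scales \<open>R\<close> to a positive contraction; the summand 1 again covers
    \<open>R = 0\<close>.\<close>
  define k where "k = inverse (norm R + 1)"
  have "norm R + 1 > 0" by (simp add: add_nonneg_pos)
  then have k: "k > 0" "k * norm R \<le> 1" by (simp_all add: k_def field_simps)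
  define S where "S = k *\<^sub>R R"
  have S: "positive_op S" unfolding S_def using R k by (intro positive_op_scaleR) auto
  have "norm S \<le> 1" using k by (simp add: S_def)
  have Scl: "S \<in> clinear_ops" by (rule positive_op_clinear[OF S])
  have Sle: "(norm (S x))\<^sup>2 \<le> Re (cinner (S x) x)" for x
  proof -
    have "Re (cinner (S x) x) \<le> 1 * (norm x)\<^sup>2" for x
      using cinner_op_le_norm[of S x] mult_right_mono[OF \<open>norm S \<le> 1\<close>, of "(norm x)\<^sup>2"] by simp
    from positive_op_norm_square_le[OF S this] show ?thesis by simp
  qed
  define D where "D = id_blinfun - S"
  have Dap: "D x = x - S x" for x by (simp add: D_def blinfun.diff_left)
  have Dcl: "D \<in> clinear_ops" unfolding D_def by (intro clinear_ops_diff clinear_ops_id Scl)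
  have Dh: "cinner (D x) y = cinner x (D y)" for x y
    by (simp add: Dap cinner_diff_left cinner_diff_right positive_op_hermitian[OF S])
  define d where "d n = blinfun_apply D ^^ n" for n
  have dadd: "d (m + n) x = d m (d n x)" for m n x by (simp add: d_def funpow_add)
  have dh: "cinner (d n x) y = cinner x (d n y)" for n x y
    by (induction n arbitrary: x y) (simp_all add: d_def Dh funpow_swap1)
  have Dnorm: "(norm (D x))\<^sup>2 \<le> (norm x)\<^sup>2 - Re (cinner (S x) x)" for x
  proof -
    have "(norm (D x))\<^sup>2 = (norm x)\<^sup>2 - 2 * Re (cinner (S x) x) + (norm (S x))\<^sup>2"
      using norm_add_square[of x "- blinfun_apply S x"]
      by (simp add: Dap cinner_minus_right positive_op_hermitian[OF S])
    then show ?thesis using Sle[of x] by simp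
  qed
  have dmono: "(norm (d (Suc n) x))\<^sup>2 \<le> (norm (d n x))\<^sup>2" for n x
  proof -
    have eq: "d (Suc n) x = D (d n x)" by (simp add: d_def)
    show ?thesis
      unfolding eq using Dnorm[of "d n x"] positive_op_Re[OF S, of "d n x"] by linarith
  qed
  have dconv: "convergent (\<lambda>m. d (2 * m) x)" for x
  proof -
    define b where "b n = (norm (d n x))\<^sup>2" for n
    have "b (Suc n) \<le> b n" for n
      unfolding b_def by (rule dmono)
    then have "decseq b" by (simp add: decseq_Suc_iff)
    then have "convergent b"
      by (intro Bseq_monoseq_convergent decseq_imp_monoseq BseqI'[of b "b 0"])
        (auto simp: b_def decseq_def)
    then have "Cauchy b" by (rule convergent_Cauchy)
    \<comment> \<open>Since \<open>D\<close> is hermitian, an even total exponent makes each inner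
      product a squared norm. The squared distance of two terms then becomes a combination of values
      of the convergent sequence \<open>b\<close> with coefficients 1, -2 and 1, which is small far
      out.\<close>
    have mixed: "Re (cinner (d (2 * m) x) (d (2 * n) x)) = b (m + n)" for m n
    proof -
      have "cinner (d (2 * m) x) (d (2 * n) x) = cinner (d m (d m x)) (d n (d n x))"
        by (simp add: mult_2 dadd)
      also have "\<dots> = cinner (d n (d m x)) (d m (d n x))"
        by (simp add: dh) (metis dadd dh add.commute)
      also have "\<dots> = cinner (d (m + n) x) (d (m + n) x)" by (metis dadd add.commute)
      finally show ?thesis by (simp add: cinner_self b_def)
    qed
    have sq: "(norm (d (2 * m) x - d (2 * n) x))\<^sup>2 = b (2 * m) - 2 * b (m + n) + b (2 * n)" for m n
      using norm_add_square[of "d (2 * m) x" "- d (2 * n) x"]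
      by (simp add: cinner_minus_right mixed) (simp add: b_def)
    have "Cauchy (\<lambda>m. d (2 * m) x)"
    proof (rule CauchyI)
      fix \<epsilon> :: real assume "\<epsilon> > 0"
      then have "\<epsilon>\<^sup>2 / 2 > 0" by simp
      then obtain M where M: "\<And>m n. m \<ge> M \<Longrightarrow> n \<ge> M \<Longrightarrow> norm (b m - b n) < \<epsilon>\<^sup>2 / 2"
        using \<open>Cauchy b\<close> CauchyD by blast
      have "norm (d (2 * m) x - d (2 * n) x) < \<epsilon>" if "m \<ge> M" "n \<ge> M" for m n
      proof (rule power2_less_imp_less)
        show "(norm (d (2 * m) x - d (2 * n) x))\<^sup>2 < \<epsilon>\<^sup>2"
          using M[of "2 * m" "m + n"] M[of "2 * n" "m + n"] that unfolding sq real_norm_def by linarith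
      qed (use \<open>\<epsilon> > 0\<close> in simp)
      then show "\<exists>M. \<forall>m\<ge>M. \<forall>n\<ge>M. norm (d (2 * m) x - d (2 * n) x) < \<epsilon>" by blast
    qed
    then show ?thesis by (simp add: Cauchy_convergent_iff)
  qed
  define z where "z x = lim (\<lambda>m. d (2 * m) x)" for x
  have zlim: "(\<lambda>m. d (2 * m) x) \<longlonglongrightarrow> z x" for x
    unfolding z_def using dconv convergent_LIMSEQ_iff by blast
  \<comment> \<open>The limit is fixed by \<open>D\<close> applied twice. As \<open>D\<close>
    shortens a vector by at least its form value under \<open>S\<close>, that value must vanish at
    \<open>z x\<close>.\<close>
  have Sz: "S (z x) = 0" for x
  proof -
    have "(\<lambda>m. d (2 * Suc m) x) \<longlonglongrightarrow> z x" by (rule LIMSEQ_Suc[OF zlim])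
    moreover have "(\<lambda>m. D (D (d (2 * m) x))) \<longlonglongrightarrow> D (D (z x))"
      by (intro blinfun.tendsto tendsto_const zlim)
    then have "(\<lambda>m. d (2 * Suc m) x) \<longlonglongrightarrow> D (D (z x))"
      by (simp add: d_def)
    ultimately have zeq: "z x = D (D (z x))" using LIMSEQ_unique by blast
    then have "(norm (z x))\<^sup>2 \<le> (norm (D (z x)))\<^sup>2"
      using Dnorm[of "blinfun_apply D (z x)"] positive_op_Re[OF S, of "blinfun_apply D (z x)"]
        arg_cong[OF zeq, of "\<lambda>u. (norm u)\<^sup>2"] by linarith
    then have "Re (cinner (S (z x)) (z x)) = 0"
      using Dnorm[of "z x"] positive_op_Re[OF S, of "z x"] by linarith
    then show ?thesis by (rule positive_op_zeroD[OF S])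
  qed
  have Scomm: "S (d n x) = d n (S x)" for n x
    by (induction n) (simp_all add: d_def Dap blinfun.diff_right)
  have dS: "(\<lambda>m. d (2 * m) (S x)) \<longlonglongrightarrow> 0" for x
  proof -
    have "(\<lambda>m. S (d (2 * m) x)) \<longlonglongrightarrow> S (z x)"
      by (intro blinfun.tendsto tendsto_const zlim)
    then show ?thesis by (simp add: Sz Scomm)
  qed
  define q where "q m x = (\<Sum>i<2 * m. d i x)" for m x
  \<comment> \<open>A finite geometric series: \<open>S = 1 - D\<close> telescopes it.\<close>
  have Sq: "S (q m x) = x - d (2 * m) x" for m x
  proof -
    have "S (d i x) = d i x - d (Suc i) x" for i by (simp add: d_def Dap)
    then have "S (q m x) = (\<Sum>i<2 * m. d i x - d (Suc i) x)"
      by (simp add: q_def blinfun.sum_right)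
    also have "\<dots> = d 0 x - d (2 * m) x" by (rule sum_lessThan_telescope')
    finally show ?thesis by (simp add: d_def)
  qed
  have dlin: "d n (x + y) = d n x + d n y" "d n (c *\<^sub>C x) = c *\<^sub>C d n x" for n c x y
    by (induction n) (simp_all add: d_def blinfun.add_right clinear_opsD[OF Dcl])
  have qlin: "q m (x + y) = q m x + q m y" "q m (c *\<^sub>C x) = c *\<^sub>C q m x" for m c x y
    by (simp_all add: q_def dlin sum.distrib complex_vector.scale_sum_right)
  define w where "w m x = k *\<^sub>R A (q m x)" for m x
  have wlin: "w m (x + y) = w m x + w m y" "w m (c *\<^sub>C x) = c *\<^sub>C w m x" for m c x y
    by (simp_all add: w_def qlin blinfun.add_right clinear_opsD[OF A] scaleR_scaleC
        scaleC_add_right scaleC_scaleC mult.commute)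
  \<comment> \<open>\<open>k *\<^sub>R A\<close> and \<open>S\<close> have equal norms on every
    vector, so the convergence and size of \<open>w m x\<close> can be read off
    \<open>S (q m x) = x - d (2 * m) x\<close>.\<close>
  have Anorm: "norm (k *\<^sub>R A y) = norm (S y)" for y
    using k norm_abs_op[OF A, of y] by (simp add: S_def R_def blinfun.scaleR_left)
  have wdiff: "norm (w m x - w n x) = norm (d (2 * m) x - d (2 * n) x)" for m n x
  proof -
    have "w m x - w n x = k *\<^sub>R A (q m x - q n x)"
      by (simp add: w_def blinfun.diff_right scaleR_diff_right)
    then have "norm (w m x - w n x) = norm (S (q m x - q n x))" by (simp only: Anorm)
    also have "\<dots> = norm (d (2 * n) x - d (2 * m) x)" by (simp add: blinfun.diff_right Sq)
    finally show ?thesis by (simp add: norm_minus_commute)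
  qed
  have "Cauchy (\<lambda>m. w m x)" for x
    using convergent_Cauchy[OF dconv[of x]] by (simp add: Cauchy_iff wdiff)
  then have wconv: "convergent (\<lambda>m. w m x)" for x by (simp add: Cauchy_convergent_iff)
  define g where "g x = lim (\<lambda>m. w m x)" for x
  have glim: "(\<lambda>m. w m x) \<longlonglongrightarrow> g x" for x
    unfolding g_def using wconv convergent_LIMSEQ_iff by blast
  have gadd: "g (x + y) = g x + g y" for x y
  proof (rule LIMSEQ_unique[OF glim])
    show "(\<lambda>m. w m (x + y)) \<longlonglongrightarrow> g x + g y" unfolding wlin by (intro tendsto_add glim)
  qed
  have gscale: "g (c *\<^sub>C x) = c *\<^sub>C g x" for c x
  proof (rule LIMSEQ_unique[OF glim])
    show "(\<lambda>m. w m (c *\<^sub>C x)) \<longlonglongrightarrow> c *\<^sub>C g x"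
      unfolding wlin by (intro bounded_linear.tendsto[OF bounded_linear_scaleC] glim)
  qed
  \<comment> \<open>In the expansion of the square of \<open>norm (x - d (2 * m) x)\<close> the
    cross term contributes minus twice the square of \<open>norm (d m x)\<close>, which outweighs
    the square of \<open>norm (d (2 * m) x)\<close>.\<close>
  have gnorm: "norm (g x) \<le> norm x * 1" for x
  proof -
    have wn: "norm (w m x) = norm (x - d (2 * m) x)" for m
      unfolding w_def Anorm Sq by simp
    have "norm (x - d (2 * m) x) \<le> norm x" for m
    proof (rule power2_le_imp_le)
      have "Re (cinner x (d (2 * m) x)) = (norm (d m x))\<^sup>2"
        by (simp add: mult_2 dadd dh[symmetric] cinner_self)
      then have "(norm (x - d (2 * m) x))\<^sup>2 = (norm x)\<^sup>2 - 2 * (norm (d m x))\<^sup>2 + (norm (d (2 * m) x))\<^sup>2"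
        using norm_add_square[of x "- d (2 * m) x"] by (simp add: cinner_minus_right)
      moreover have dn: "(norm (d n y))\<^sup>2 \<le> (norm y)\<^sup>2" for n y
      proof (induction n)
        case (Suc n)
        then show ?case using dmono order_trans by blast
      qed (simp add: d_def)
      then have "(norm (d (2 * m) x))\<^sup>2 \<le> (norm (d m x))\<^sup>2" by (simp add: mult_2 dadd)
      ultimately show "(norm (x - d (2 * m) x))\<^sup>2 \<le> (norm x)\<^sup>2"
        using zero_le_power2[of "norm (d m x)"] by linarith
    qed simp
    then show ?thesis
      using LIMSEQ_le_const2[OF tendsto_norm[OF glim[of x]]] by (simp add: wn)
  qed
  obtain W where W: "W \<in> clinear_ops" "blinfun_apply W = g"
    using clinear_op_of_function[of g, OF gadd gscale gnorm] by blast
  have gS: "g (S x) = k *\<^sub>R A x" for x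
  proof (rule LIMSEQ_unique[OF glim])
    have qS: "q m (S x) = x - d (2 * m) x" for m
      using Sq[of m x] by (simp add: q_def blinfun.sum_right Scomm)
    have "(\<lambda>m. k *\<^sub>R A (x - d (2 * m) x)) \<longlonglongrightarrow> k *\<^sub>R A (x - z x)"
      by (intro tendsto_intros blinfun.tendsto zlim)
    moreover have "k *\<^sub>R A (x - z x) = k *\<^sub>R A x"
      using Anorm[of "z x"] by (simp add: Sz blinfun.diff_right scaleR_diff_right)
    ultimately show "(\<lambda>m. w m (S x)) \<longlonglongrightarrow> k *\<^sub>R A x"
      by (simp add: w_def qS)
  qed
  have WR: "W o\<^sub>L R = A"
  proof (rule blinfun_eqI)
    fix x
    have "k *\<^sub>R W (R x) = k *\<^sub>R A x"
      using gS[of x] by (simp add: W(2)[symmetric] S_def blinfun.scaleR_left blinfun.scaleR_right)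
    then show "(W o\<^sub>L R) x = A x" using k by simp
  qed
  have "cadjoint W o\<^sub>L A = R"
  proof (rule op_eqI)
    fix x y
    have "(\<lambda>m. cinner (A x) (w m y)) \<longlonglongrightarrow> cinner (A x) (g y)"
      by (intro cinner_tendsto glim tendsto_const)
    \<comment> \<open>\<open>cinner_abs_op\<close> replaces \<open>A\<close> by \<open>R\<close> on
      both sides and the factor \<open>k\<close> turns the second \<open>R\<close> into
      \<open>S\<close>, so the geometric series telescopes. The remainder tends to 0 because
      \<open>R x\<close> lies in the range of \<open>S\<close>.\<close>
    moreover have "cinner (A x) (w m y) = cinner (R x) y - cinner (d (2 * m) (R x)) y" for m
    proof -
      have "cinner (blinfun_apply A x) (w m y) = k * cinner (blinfun_apply R x) (blinfun_apply R (q m y))"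
        by (simp add: w_def scaleR_scaleC cinner_scaleC_right R_def cinner_abs_op[OF A])
      also have "\<dots> = cinner (R x) (S (q m y))"
        by (simp add: S_def blinfun.scaleR_left scaleR_scaleC cinner_scaleC_right)
      also have "\<dots> = cinner (R x) y - cinner (d (2 * m) (R x)) y"
        by (simp add: Sq cinner_diff_right dh)
      finally show ?thesis .
    qed
    moreover have "(\<lambda>m. d (2 * m) (R x)) \<longlonglongrightarrow> 0"
    proof -
      have "(\<lambda>m. d (2 * m) (S (inverse k *\<^sub>R x))) \<longlonglongrightarrow> 0" by (rule dS)
      moreover have "S (inverse k *\<^sub>R x) = R x"
        using k by (simp add: S_def blinfun.scaleR_left blinfun.scaleR_right)
      ultimately show ?thesis by simp
    qed
    then have "(\<lambda>m. cinner (R x) y - cinner (d (2 * m) (R x)) y)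
        \<longlonglongrightarrow> cinner (R x) y - cinner 0 y"
      by (intro tendsto_diff cinner_tendsto tendsto_const)
    ultimately have "cinner (A x) (g y) = cinner (R x) y"
      using LIMSEQ_unique by fastforce
    then show "cinner ((cadjoint W o\<^sub>L A) x) y = cinner (R x) y"
      by (simp add: cinner_cadjoint_left[OF W(1)] W(2))
  qed
  moreover have "norm W \<le> 1"
    by (rule norm_blinfun_bound) (use gnorm in \<open>auto simp: W(2)\<close>)
  ultimately show ?thesis using that W(1) WR unfolding R_def by blast
qed

end

section \<open>Normed spaces on carriers\<close>

lemma Metric_space_openinD:
  assumes "Metric_space M d" "openin (Metric_space.mtopology M d) U" "x \<in> U"
  obtains r where "r > 0" "\<And>y. y \<in> M \<Longrightarrow> d x y < r \<Longrightarrow> y \<in> U" "x \<in> M"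
proof -
  interpret Metric_space M d by fact
  have "U \<subseteq> M" using assms(2) openin_subset topspace_mtopology by blast
  moreover obtain r where "r > 0" "mball x r \<subseteq> U"
    using assms(2,3) by (auto simp: openin_mtopology)
  ultimately show ?thesis using assms(3) by (intro that[of r]) (auto simp: mball_def)
qed

text \<open>The axioms speak of the carrier alone, since \<open>nrm\<close> has no meaning off it.
  Nonnegativity, symmetry and closure under 0 follow for an inhabited carrier by scaling with -1 and
  0.\<close>

locale normed_carrier =
  fixes X :: "'x::complex_vector set" and nrm :: "'x \<Rightarrow> real"
  assumes add_closed: "x \<in> X \<Longrightarrow> y \<in> X \<Longrightarrow> x + y \<in> X"
    and scaleC_closed: "x \<in> X \<Longrightarrow> c *\<^sub>C x \<in> X"
    and nrm_triangle: "x \<in> X \<Longrightarrow> y \<in> X \<Longrightarrow> nrm (x + y) \<le> nrm x + nrm y"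
    and nrm_scaleC: "x \<in> X \<Longrightarrow> nrm (c *\<^sub>C x) = cmod c * nrm x"
    and nrm_eq_0: "x \<in> X \<Longrightarrow> nrm x = 0 \<Longrightarrow> x = 0"
begin

lemma minus_closed: "x \<in> X \<Longrightarrow> - x \<in> X"
  using scaleC_closed[of x "-1"] by (simp add: scaleC_minus_one)

lemma diff_closed: "x \<in> X \<Longrightarrow> y \<in> X \<Longrightarrow> x - y \<in> X"
  using add_closed[of x "- y"] minus_closed by simp

lemma nrm_minus: "x \<in> X \<Longrightarrow> nrm (- x) = nrm x"
  using nrm_scaleC[of x "-1"] by (simp add: scaleC_minus_one)

lemma nrm_diff_commute: "x \<in> X \<Longrightarrow> y \<in> X \<Longrightarrow> nrm (x - y) = nrm (y - x)"
  using nrm_minus[OF diff_closed, of x y] by simp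

lemma nrm_zero: "x \<in> X \<Longrightarrow> nrm 0 = 0"
  using nrm_scaleC[of x 0] by simp

lemma nrm_nonneg:
  assumes "x \<in> X"
  shows "0 \<le> nrm x"
  using nrm_triangle[OF assms minus_closed[OF assms]] by (simp add: nrm_minus[OF assms] nrm_zero[OF assms])

lemma Metric_space_carrier:
  assumes S: "S \<subseteq> X"
  shows "Metric_space S (\<lambda>x y. if x \<in> S \<and> y \<in> S then nrm (x - y) else 0)"
proof
  show "0 \<le> (if x \<in> S \<and> y \<in> S then nrm (x - y) else 0)" for x y
    using S by (auto intro!: nrm_nonneg diff_closed)
  show "(if x \<in> S \<and> y \<in> S then nrm (x - y) else 0) = (if y \<in> S \<and> x \<in> S then nrm (y - x) else 0)" for x y
    using S nrm_diff_commute by auto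
  show "(if x \<in> S \<and> y \<in> S then nrm (x - y) else 0) = 0 \<longleftrightarrow> x = y" if "x \<in> S" "y \<in> S" for x y
    using that S nrm_eq_0[OF diff_closed, of x y] nrm_zero[of x] by auto
  show "(if x \<in> S \<and> z \<in> S then nrm (x - z) else 0)
      \<le> (if x \<in> S \<and> y \<in> S then nrm (x - y) else 0) + (if y \<in> S \<and> z \<in> S then nrm (y - z) else 0)"
    if "x \<in> S" "y \<in> S" "z \<in> S" for x y z
    using that S nrm_triangle[OF diff_closed diff_closed, of x y y z] by auto
qed

lemma openin_norm_topologyD:
  assumes "S \<subseteq> X" "openin (norm_topology S nrm) U" "x \<in> U"
  obtains r where "r > 0" "\<And>y. y \<in> S \<Longrightarrow> nrm (y - x) < r \<Longrightarrow> y \<in> U" "x \<in> S"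
proof -
  obtain r where r: "r > 0"
    "\<And>y. y \<in> S \<Longrightarrow> (if x \<in> S \<and> y \<in> S then nrm (x - y) else 0) < r \<Longrightarrow> y \<in> U" "x \<in> S"
    using Metric_space_openinD[OF Metric_space_carrier[OF assms(1)] assms(2)[unfolded norm_topology_def] assms(3)]
    by blast
  show ?thesis
  proof (rule that[OF r(1) _ r(3)])
    fix y assume "y \<in> S" "nrm (y - x) < r"
    moreover have "x \<in> X" "y \<in> X" using \<open>y \<in> S\<close> r(3) assms(1) by auto
    ultimately show "y \<in> U" using r(2)[of y] r(3) nrm_diff_commute[of x y] by simp
  qed
qed

lemma abs_nrm_diff_le:
  assumes "x \<in> X" "y \<in> X"
  shows "\<bar>nrm x - nrm y\<bar> \<le> nrm (x - y)"
  using nrm_triangle[OF diff_closed[OF assms] assms(2)]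
    nrm_triangle[OF diff_closed[OF assms(2,1)] assms(1)] nrm_diff_commute[OF assms]
  by simp

text \<open>Rescaling moves \<open>z\<close> by exactly the distance of \<open>nrm z\<close> from 1,
  which is again below \<open>\<eta>\<close>; hence the factor 2.\<close>

lemma normalise_close:
  assumes x: "x \<in> X" "nrm x = 1" and z: "z \<in> X" "nrm (z - x) < \<eta>" and "\<eta> < 1"
  shows "of_real (inverse (nrm z)) *\<^sub>C z \<in> unit_sphere X nrm"
    and "nrm (of_real (inverse (nrm z)) *\<^sub>C z - x) < 2 * \<eta>"
    and "1 - \<eta> < nrm z" "nrm z < 1 + \<eta>"
proof -
  define c where "c = inverse (nrm z)"
  show n: "1 - \<eta> < nrm z" "nrm z < 1 + \<eta>"
    using abs_nrm_diff_le[OF z(1) x(1)] z(2) x(2) by auto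
  then have pos: "nrm z > 0" using \<open>\<eta> < 1\<close> by linarith
  show "of_real (inverse (nrm z)) *\<^sub>C z \<in> unit_sphere X nrm"
    using pos by (simp add: unit_sphere_def scaleC_closed z nrm_scaleC norm_inverse)
  have eq: "of_real c *\<^sub>C z - x = of_real (c - 1) *\<^sub>C z + (z - x)"
    by (simp add: scaleC_diff_left scaleC_one)
  have "nrm (of_real c *\<^sub>C z - x) \<le> nrm (of_real (c - 1) *\<^sub>C z) + nrm (z - x)"
    unfolding eq by (intro nrm_triangle scaleC_closed diff_closed z(1) x(1))
  also have "nrm (of_real (c - 1) *\<^sub>C z) = \<bar>c - 1\<bar> * nrm z"
    using nrm_scaleC[OF z(1), of "complex_of_real (c - 1)"] by (simp only: norm_of_real)
  also have "\<bar>c - 1\<bar> * nrm z = \<bar>1 - nrm z\<bar>"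
  proof -
    have "\<bar>c - 1\<bar> * nrm z = \<bar>(c - 1) * nrm z\<bar>" using pos by (simp add: abs_mult)
    also have "(c - 1) * nrm z = 1 - nrm z" using pos by (simp add: c_def field_simps)
    finally show ?thesis .
  qed
  also have "\<bar>1 - nrm z\<bar> + nrm (z - x) < \<eta> + \<eta>"
    using n z(2) by (intro add_strict_mono) (auto simp: abs_less_iff)
  finally show "nrm (of_real (inverse (nrm z)) *\<^sub>C z - x) < 2 * \<eta>" by (simp add: c_def)
qed

end

section \<open>Absence of chaos\<close>

context normed_carrier
begin

lemma funpow_closed: "(\<And>x. x \<in> X \<Longrightarrow> T x \<in> X) \<Longrightarrow> x \<in> X \<Longrightarrow> (T ^^ n) x \<in> X"
  by (induction n) auto

lemma nrm_funpow_expanding: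
  assumes "\<And>x. x \<in> X \<Longrightarrow> T x \<in> X" "\<And>x. x \<in> X \<Longrightarrow> nrm (T x) = 4 * nrm x" "x \<in> X"
  shows "nrm ((T ^^ n) x) = 4 ^ n * nrm x"
proof (induction n)
  case (Suc n)
  have "(T ^^ n) x \<in> X" by (rule funpow_closed[OF assms(1,3)])
  then show ?case using Suc by (simp add: assms(2))
qed simp

lemma expanding_not_Li_Yorke:
  assumes T: "\<And>x. x \<in> X \<Longrightarrow> T x \<in> X" "\<And>x. x \<in> X \<Longrightarrow> nrm (T x) = 4 * nrm x"
  shows "\<not> Li_Yorke_chaotic X nrm T"
proof
  assume "Li_Yorke_chaotic X nrm T"
  then obtain x where x0: "x \<in> X" "\<exists>r::nat \<Rightarrow> nat. strict_mono r \<and> (\<lambda>k. nrm ((T ^^ r k) x)) \<longlonglongrightarrow> 0"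
    and unb: "\<not> bdd_above (range (\<lambda>n. nrm ((T ^^ n) x)))"
    unfolding Li_Yorke_chaotic_def by metis
  obtain r :: "nat \<Rightarrow> nat" where r: "(\<lambda>k. nrm ((T ^^ r k) x)) \<longlonglongrightarrow> 0" using x0(2) by metis
  note x = x0(1) r
  note N = nrm_funpow_expanding[of T, OF T x(1)]
  \<comment> \<open>Norms along the orbit never fall below \<open>nrm x\<close>, so a subsequence
    tending to 0 leaves only norm 0, and such an orbit is bounded.\<close>
  have "nrm x \<le> 0"
  proof (rule LIMSEQ_le_const[OF x(2)], intro exI allI impI)
    fix k
    have "1 * nrm x \<le> 4 ^ r k * nrm x"
      by (intro mult_right_mono nrm_nonneg x(1)) simp
    then show "nrm x \<le> nrm ((T ^^ r k) x)" by (simp add: N)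
  qed
  then have "nrm ((T ^^ n) x) = 0" for n using nrm_nonneg[OF x(1)] by (simp add: N)
  then show False using unb by simp
qed

text \<open>By linearity the difference of two orbits is the orbit of \<open>x - y\<close>. It stays
  below \<open>\<tau>\<close> at no more than \<open>K\<close> times, where \<open>4 ^ K\<close>
  exceeds \<open>\<tau> / d\<close>, so both densities are 0.\<close>

lemma expanding_not_distributionally_chaotic_3:
  assumes T: "\<And>x. x \<in> X \<Longrightarrow> T x \<in> X" "\<And>x. x \<in> X \<Longrightarrow> nrm (T x) = 4 * nrm x"
    and add: "\<And>x y. x \<in> X \<Longrightarrow> y \<in> X \<Longrightarrow> T (x + y) = T x + T y"
    and scale: "\<And>c x. x \<in> X \<Longrightarrow> T (c *\<^sub>C x) = c *\<^sub>C T x"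
  shows "\<not> distributionally_chaotic_3 X nrm T"
proof
  assume "distributionally_chaotic_3 X nrm T"
  then obtain \<Gamma> where \<Gamma>: "\<Gamma> \<subseteq> X" "uncountable \<Gamma>" and ch: "\<forall>x\<in>\<Gamma>. \<forall>y\<in>\<Gamma>. x \<noteq> y \<longrightarrow>
      (\<exists>J::real set. is_interval J \<and> J \<subseteq> {0<..} \<and> (\<exists>a\<in>J. \<exists>b\<in>J. a < b) \<and>
           (\<forall>\<tau>\<in>J. liminf (orbit_closeness nrm T x y \<tau>) < limsup (orbit_closeness nrm T x y \<tau>)))"
    unfolding distributionally_chaotic_3_def by (elim exE conjE) (rule that)
  have two: "\<not> \<Gamma> \<subseteq> {x}" for x
    using \<Gamma>(2) countable_subset[of \<Gamma> "{x}"] by auto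
  then obtain x where x: "x \<in> \<Gamma>" by blast
  then obtain y where xy: "x \<in> \<Gamma>" "y \<in> \<Gamma>" "x \<noteq> y" using two[of x] by blast
  from ch[rule_format, OF this] obtain J :: "real set" and a where J: "a \<in> J"
    "\<forall>\<tau>\<in>J. liminf (orbit_closeness nrm T x y \<tau>) < limsup (orbit_closeness nrm T x y \<tau>)"
    by (elim exE conjE bexE) (rule that)
  from J(2)[rule_format, OF J(1)] obtain \<tau>
    where \<tau>: "liminf (orbit_closeness nrm T x y \<tau>) < limsup (orbit_closeness nrm T x y \<tau>)" by (rule that)
  have X: "x \<in> X" "y \<in> X" using xy \<Gamma> by auto
  have diff: "(T ^^ n) x - (T ^^ n) y = (T ^^ n) (x - y)" for n
  proof (induction n)
    case (Suc n)
    have F: "(T ^^ n) x \<in> X" "(T ^^ n) y \<in> X"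
      by (rule funpow_closed[OF T(1)], assumption, rule X)+
    have "T ((T ^^ n) x + (-1) *\<^sub>C (T ^^ n) y) = T ((T ^^ n) x) + (-1) *\<^sub>C T ((T ^^ n) y)"
      by (simp only: add scale F scaleC_closed)
    then show ?case using Suc by (simp add: scaleC_minus_one)
  qed simp
  define d where "d = nrm (x - y)"
  have "d > 0"
    unfolding d_def using nrm_nonneg[OF diff_closed[OF X]] nrm_eq_0[OF diff_closed[OF X]] xy(3)
    by (metis eq_iff_diff_eq_0 order_le_less)
  have N: "nrm ((T ^^ n) x - (T ^^ n) y) = 4 ^ n * d" for n
    unfolding diff d_def by (rule nrm_funpow_expanding[of T, OF T diff_closed[OF X]])
  obtain K where K: "\<tau> / d < 4 ^ K" using real_arch_pow[of 4 "\<tau> / d"] by auto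
  have sub: "{i. i < n \<and> nrm ((T ^^ i) x - (T ^^ i) y) < \<tau>} \<subseteq> {..<K}" for n
  proof
    fix i assume "i \<in> {i. i < n \<and> nrm ((T ^^ i) x - (T ^^ i) y) < \<tau>}"
    then have "4 ^ i * d < \<tau>" by (simp add: N)
    moreover have "\<tau> < 4 ^ K * d" using K \<open>d > 0\<close> by (simp add: pos_divide_less_eq)
    ultimately have "4 ^ i * d < 4 ^ K * d" by linarith
    then show "i \<in> {..<K}" using \<open>d > 0\<close> by simp
  qed
  have card: "card {i. i < n \<and> nrm ((T ^^ i) x - (T ^^ i) y) < \<tau>} \<le> K" for n
    using card_mono[OF _ sub] by simp
  have "(\<lambda>n. real (card {i. i < n \<and> nrm ((T ^^ i) x - (T ^^ i) y) < \<tau>}) / real n) \<longlonglongrightarrow> 0"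
  proof (rule tendsto_sandwich[OF _ _ tendsto_const])
    show "(\<lambda>n. real K / real n) \<longlonglongrightarrow> 0" by (rule lim_const_over_n)
    show "\<forall>\<^sub>F n in sequentially. real (card {i. i < n \<and> nrm ((T ^^ i) x - (T ^^ i) y) < \<tau>}) / real n \<le> real K / real n"
      using card by (intro always_eventually allI divide_right_mono) auto
  qed simp
  then have "(\<lambda>n. orbit_closeness nrm T x y \<tau> n) \<longlonglongrightarrow> ereal 0"
    unfolding orbit_closeness_def by (intro tendsto_ereal)
  then have "liminf (orbit_closeness nrm T x y \<tau>) = ereal 0" "limsup (orbit_closeness nrm T x y \<tau>) = ereal 0"
    by (intro lim_imp_Liminf lim_imp_Limsup; simp)+
  with \<tau> show False by simp
qed

lemma expanding_operator:
  assumes "\<And>x. x \<in> X \<Longrightarrow> T x \<in> X" "\<And>x. x \<in> X \<Longrightarrow> nrm (T x) = 4 * nrm x"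
    and "\<And>x y. x \<in> X \<Longrightarrow> y \<in> X \<Longrightarrow> T (x + y) = T x + T y"
    and "\<And>c x. x \<in> X \<Longrightarrow> T (c *\<^sub>C x) = c *\<^sub>C T x"
  shows "bounded_op X nrm T" "\<not> Li_Yorke_chaotic X nrm T" "\<not> distributionally_chaotic_3 X nrm T"
proof -
  show "bounded_op X nrm T"
    unfolding bounded_clinear_on_def using assms(1,3,4) by (simp add: assms(2)) (rule exI[of _ 4], simp)
qed (intro expanding_not_Li_Yorke expanding_not_distributionally_chaotic_3 assms; assumption)+

end

section \<open>A criterion for C*-transitivity\<close>

text \<open>The common shape of the three C*-cases: \<open>P N\<close> truncates, \<open>J N\<close>
  places a block from \<open>Y\<close> behind the first \<open>N\<close> coordinates, and
  \<open>key\<close> says that after \<open>n\<close> steps only the two blocks meet. Blocks have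
  their own type because for the module they are single operators, not sequences. The free scalars
  in \<open>key\<close> let it apply directly to normalised vectors.\<close>

lemma cstar_transitive_criterion:
  fixes X :: "'x::complex_vector set" and M :: "'m::complex_vector set"
    and \<psi> :: "'e \<Rightarrow> 'e \<Rightarrow> 'm"
    and P :: "nat \<Rightarrow> 'x \<Rightarrow> 'x" and J :: "nat \<Rightarrow> 'e \<Rightarrow> 'x"
  assumes X: "normed_carrier X nrmX" and M: "normed_carrier M nrmM"
    and P: "\<And>x N. x \<in> X \<Longrightarrow> P N x \<in> X"
    and approx: "\<And>x. x \<in> X \<Longrightarrow> (\<lambda>N. nrmX (P N x - x)) \<longlonglongrightarrow> 0"
    and J: "\<And>E N. E \<in> Y \<Longrightarrow> J N E \<in> X"
    and Jbound: "\<And>E. E \<in> Y \<Longrightarrow> \<exists>K. \<forall>N. nrmX (J N E) \<le> K"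
    and prod: "\<And>C r. C \<in> M \<Longrightarrow> 0 < r \<Longrightarrow> \<exists>E\<in>Y. \<exists>F\<in>Y. \<psi> E F \<in> M \<and> nrmM (\<psi> E F - C) < r"
    and key: "\<And>x y E F N n a b c d. x \<in> X \<Longrightarrow> y \<in> X \<Longrightarrow> E \<in> Y \<Longrightarrow> F \<in> Y \<Longrightarrow> N \<le> n \<Longrightarrow>
      \<phi> ((T ^^ n) (of_real c *\<^sub>C P N x + of_real a *\<^sub>C J N E))
        (of_real d *\<^sub>C P N y + of_real b *\<^sub>C J (n + N) F)
      = of_real (4 ^ n * a * b) *\<^sub>C \<psi> E F"
  shows "cstar_transitive X nrmX M nrmM \<phi> T"
  unfolding cstar_transitive_def
proof (intro allI impI, elim conjE)
  fix W V
  assume W: "openin (prod_topology (norm_topology (unit_sphere X nrmX) nrmX)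
                                  (norm_topology (unit_sphere X nrmX) nrmX)) W" "W \<noteq> {}"
    and V: "openin (norm_topology M nrmM) V" "V \<noteq> {}"
  interpret X: normed_carrier X nrmX by fact
  interpret M: normed_carrier M nrmM by fact
  obtain x0 y0 where "(x0, y0) \<in> W" using W(2) by auto
  then obtain U1 U2 where U: "openin (norm_topology (unit_sphere X nrmX) nrmX) U1"
    "openin (norm_topology (unit_sphere X nrmX) nrmX) U2" "x0 \<in> U1" "y0 \<in> U2" "U1 \<times> U2 \<subseteq> W"
    using W(1) unfolding openin_prod_topology_alt by metis
  have sph: "unit_sphere X nrmX \<subseteq> X" by (auto simp: unit_sphere_def)
  obtain r1 where r1: "r1 > 0" "\<And>x. x \<in> unit_sphere X nrmX \<Longrightarrow> nrmX (x - x0) < r1 \<Longrightarrow> x \<in> U1"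
    and x0: "x0 \<in> unit_sphere X nrmX"
    using X.openin_norm_topologyD[OF sph U(1,3)] by blast
  obtain r2 where r2: "r2 > 0" "\<And>x. x \<in> unit_sphere X nrmX \<Longrightarrow> nrmX (x - y0) < r2 \<Longrightarrow> x \<in> U2"
    and y0: "y0 \<in> unit_sphere X nrmX"
    using X.openin_norm_topologyD[OF sph U(2,4)] by blast
  obtain C0 where "C0 \<in> V" using V(2) by blast
  then obtain r where r: "r > 0" "\<And>C. C \<in> M \<Longrightarrow> nrmM (C - C0) < r \<Longrightarrow> C \<in> V" and C0: "C0 \<in> M"
    using M.openin_norm_topologyD[OF order_refl V(1)] by blast
  obtain E F where EF: "E \<in> Y" "F \<in> Y" and C: "\<psi> E F \<in> M" "nrmM (\<psi> E F - C0) < r / 2"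
    using prod[OF C0, of "r / 2"] r(1) by auto
  obtain K1 K2 where K: "\<And>N. nrmX (J N E) \<le> K1" "\<And>N. nrmX (J N F) \<le> K2"
    using Jbound EF by meson
  define K where "K = max 1 (max K1 K2)"
  have K': "nrmX (J N E) \<le> K" "nrmX (J N F) \<le> K" "K > 0" for N
    using K[of N] unfolding K_def by linarith+
  have xy: "x0 \<in> X" "y0 \<in> X" "nrmX x0 = 1" "nrmX y0 = 1" using x0 y0 by (auto simp: unit_sphere_def)
  define L where "L = nrmM (\<psi> E F)"
  have L: "0 \<le> L" unfolding L_def by (rule M.nrm_nonneg[OF C(1)])
  \<comment> \<open>The halves of \<open>r1\<close> and \<open>r2\<close> pay for the factor 2 of
    normalisation. The last entry makes \<open>4 * \<eta> * L\<close> at most \<open>r / 2\<close>,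
    where \<open>4 * \<eta>\<close> will bound the error of the scalar \<open>t\<close>;
    \<open>L + 1\<close> avoids division by 0.\<close>
  define \<eta> where "\<eta> = min (1/2) (min (r1 / 2) (min (r2 / 2) (r / (2 * (4 * (L + 1))))))"
  have \<eta>: "\<eta> > 0" "\<eta> < 1" "2 * \<eta> \<le> r1" "2 * \<eta> \<le> r2" "4 * (L + 1) * \<eta> \<le> r / 2"
  proof -
    show "\<eta> > 0" using r1(1) r2(1) r(1) L by (simp add: \<eta>_def)
    have "\<eta> \<le> 1/2" "\<eta> \<le> r1 / 2" "\<eta> \<le> r2 / 2"
      unfolding \<eta>_def by (rule min.cobounded1, rule min.coboundedI2, rule min.cobounded1,
          rule min.coboundedI2, rule min.coboundedI2, rule min.cobounded1)
    then show "\<eta> < 1" "2 * \<eta> \<le> r1" "2 * \<eta> \<le> r2" by linarith+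
    have "\<eta> \<le> r / (2 * (4 * (L + 1)))" by (simp add: \<eta>_def)
    then show "4 * (L + 1) * \<eta> \<le> r / 2" using L by (simp add: field_simps)
  qed
  have \<eta>2: "0 < \<eta> / 2" using \<eta>(1) by simp
  have "\<forall>\<^sub>F N in sequentially. nrmX (P N x0 - x0) < \<eta> / 2" "\<forall>\<^sub>F N in sequentially. nrmX (P N y0 - y0) < \<eta> / 2"
    by (rule order_tendstoD(2)[OF approx[OF xy(1)] \<eta>2], rule order_tendstoD(2)[OF approx[OF xy(2)] \<eta>2])
  then have "\<forall>\<^sub>F N in sequentially. nrmX (P N x0 - x0) < \<eta> / 2 \<and> nrmX (P N y0 - y0) < \<eta> / 2"
    by (rule eventually_conj)
  from eventually_happens[OF this] obtain N where N: "nrmX (P N x0 - x0) < \<eta> / 2" "nrmX (P N y0 - y0) < \<eta> / 2"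
    by auto
  have "(1::real) < 2" by simp
  from real_arch_pow[OF this] obtain n0 where n0: "2 * K / \<eta> < 2 ^ n0" by blast
  define n where "n = max n0 N"
  have "(2::real) ^ n0 \<le> 2 ^ n" by (intro power_increasing) (auto simp: n_def)
  then have n: "K / 2 ^ n < \<eta> / 2" "N \<le> n"
  proof -
    have "2 * K / \<eta> < 2 ^ n" using n0 \<open>2 ^ n0 \<le> 2 ^ n\<close> by (rule less_le_trans)
    then show "K / 2 ^ n < \<eta> / 2" using \<eta>(1) by (simp add: field_simps)
    show "N \<le> n" by (simp add: n_def)
  qed
  \<comment> \<open>The factor \<open>1 - \<eta>\<close> stays below both norms of the perturbed
    vectors, so the final scalar \<open>t\<close> is at most 1 and only a lower bound for it remains
    to be found.\<close>
  define a where "a = (1 - \<eta>) / 2 ^ n"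
  have a: "0 \<le> a" "a \<le> 1 / 2 ^ n" using \<eta>(1,2) unfolding a_def by (simp_all add: divide_right_mono)
  have close: "nrmX (P N x + of_real a *\<^sub>C G - x) < \<eta>" "P N x + of_real a *\<^sub>C G \<in> X"
    if "x \<in> X" "nrmX (P N x - x) < \<eta> / 2" "G \<in> X" "nrmX G \<le> K" for x G
  proof -
    have "nrmX ((P N x - x) + of_real a *\<^sub>C G) \<le> nrmX (P N x - x) + nrmX (of_real a *\<^sub>C G)"
      by (intro X.nrm_triangle X.diff_closed X.scaleC_closed P that)
    also have "nrmX (of_real a *\<^sub>C G) = a * nrmX G"
      using a by (simp add: X.nrm_scaleC that)
    also have "\<dots> \<le> 1 / 2 ^ n * K"
      using a K'(3) by (intro mult_mono that X.nrm_nonneg) auto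
    also have "nrmX (P N x - x) + 1 / 2 ^ n * K < \<eta> / 2 + \<eta> / 2"
      using n(1) that(2) by (intro add_strict_mono) simp_all
    finally show "nrmX (P N x + of_real a *\<^sub>C G - x) < \<eta>" by (simp add: algebra_simps)
    show "P N x + of_real a *\<^sub>C G \<in> X"
      by (intro X.add_closed X.scaleC_closed P that)
  qed
  define x y where "x = P N x0 + of_real a *\<^sub>C J N E"
    and "y = P N y0 + of_real a *\<^sub>C J (n + N) F"
  have x: "x \<in> X" "nrmX (x - x0) < \<eta>" and y: "y \<in> X" "nrmX (y - y0) < \<eta>"
    unfolding x_def y_def
    using close[OF xy(1) N(1) J[OF EF(1)] K'(1)] close[OF xy(2) N(2) J[OF EF(2)] K'(2)] by simp_all
  note nx = X.normalise_close[OF xy(1,3) x \<eta>(2)] and ny = X.normalise_close[OF xy(2,4) y \<eta>(2)]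
  define u v where "u = of_real (inverse (nrmX x)) *\<^sub>C x" and "v = of_real (inverse (nrmX y)) *\<^sub>C y"
  have "u \<in> U1" using r1(2)[of u] nx(1,2) \<eta>(3) by (simp add: u_def)
  moreover have "v \<in> U2" using r2(2)[of v] ny(1,2) \<eta>(4) by (simp add: v_def)
  ultimately have uv: "(u, v) \<in> W" using U(5) by blast
  define t where "t = (1 - \<eta>)\<^sup>2 / (nrmX x * nrmX y)"
  have pos: "nrmX x > 0" "nrmX y > 0" using nx(3) ny(3) \<eta>(2) by linarith+
  have "\<phi> ((T ^^ n) u) v = complex_of_real (4 ^ n * (inverse (nrmX x) * a) * (inverse (nrmX y) * a)) *\<^sub>C \<psi> E F"
    using key[OF xy(1,2) EF n(2), of "inverse (nrmX x)" "inverse (nrmX x) * a" "inverse (nrmX y)" "inverse (nrmX y) * a"]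
    by (simp add: u_def v_def x_def y_def scaleC_add_right scaleC_scaleC)
  also have "4 ^ n * (inverse (nrmX x) * a) * (inverse (nrmX y) * a) = t"
  proof -
    have "(4::real) ^ n = 2 ^ n * 2 ^ n" by (simp flip: power_mult_distrib)
    then show ?thesis using pos by (simp add: t_def a_def field_simps power2_eq_square)
  qed
  finally have val: "\<phi> ((T ^^ n) u) v = of_real t *\<^sub>C \<psi> E F" .
  have "t \<le> 1"
  proof -
    have "(1 - \<eta>) * (1 - \<eta>) \<le> nrmX x * nrmX y"
      using nx(3) ny(3) \<eta>(2) by (intro mult_mono) auto
    then show ?thesis using pos by (simp add: t_def power2_eq_square)
  qed
  moreover have "1 - 4 * \<eta> \<le> t"
  proof -
    have "nrmX x * nrmX y \<le> (1 + \<eta>) * (1 + \<eta>)"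
      using nx(4) ny(4) pos \<eta>(1) by (intro mult_mono) auto
    then have "(1 - \<eta>)\<^sup>2 / ((1 + \<eta>) * (1 + \<eta>)) \<le> t"
      unfolding t_def using pos \<eta>(1) by (intro divide_left_mono) auto
    moreover have "(1 - 4 * \<eta>) * ((1 + \<eta>) * (1 + \<eta>)) \<le> (1 - \<eta>)\<^sup>2"
    proof -
      have "(1 - \<eta>)\<^sup>2 - (1 - 4 * \<eta>) * ((1 + \<eta>) * (1 + \<eta>)) = 8 * \<eta>\<^sup>2 + 4 * \<eta> ^ 3"
        by (simp add: power2_eq_square power3_eq_cube algebra_simps)
      moreover have "0 \<le> 8 * \<eta>\<^sup>2 + 4 * \<eta> ^ 3" using \<eta>(1) by simp
      ultimately show ?thesis by linarith
    qed
    then have "1 - 4 * \<eta> \<le> (1 - \<eta>)\<^sup>2 / ((1 + \<eta>) * (1 + \<eta>))"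
      using \<eta>(1) by (simp add: pos_le_divide_eq)
    ultimately show ?thesis by linarith
  qed
  ultimately have t: "\<bar>t - 1\<bar> \<le> 4 * \<eta>" using \<eta>(1) by linarith
  have "nrmM (of_real t *\<^sub>C \<psi> E F - C0) < r"
  proof -
    have eq: "of_real t *\<^sub>C \<psi> E F - C0 = of_real (t - 1) *\<^sub>C \<psi> E F + (\<psi> E F - C0)"
      by (simp add: scaleC_diff_left scaleC_one)
    have "nrmM (of_real t *\<^sub>C \<psi> E F - C0) \<le> nrmM (of_real (t - 1) *\<^sub>C \<psi> E F) + nrmM (\<psi> E F - C0)"
      unfolding eq by (intro M.nrm_triangle M.scaleC_closed M.diff_closed C(1) C0)
    also have "nrmM (of_real (t - 1) *\<^sub>C \<psi> E F) = \<bar>t - 1\<bar> * L"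
      using M.nrm_scaleC[OF C(1), of "complex_of_real (t - 1)"] by (simp only: norm_of_real L_def)
    also have "\<dots> \<le> 4 * \<eta> * (L + 1)" using t L \<eta>(1) by (intro mult_mono) auto
    also have "4 * \<eta> * (L + 1) \<le> r / 2" using \<eta>(5) by (simp add: mult_ac)
    finally show ?thesis using C(2) by simp
  qed
  then have "\<phi> ((T ^^ n) u) v \<in> V" unfolding val by (intro r(2) M.scaleC_closed C(1))
  with uv show "\<exists>n. \<exists>(x, y)\<in>W. \<phi> ((T ^^ n) x) y \<in> V" by blast
qed

section \<open>Left multiplication by the shift\<close>

lemma blinfun_power_one: "blinfun_power A 1 = A"
  by (rule blinfun_eqI) simp

definition scaled_left_mult :: "'h::chilbert_space endo \<Rightarrow> 'h endo \<Rightarrow> 'h endo" where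
  "scaled_left_mult U A = 4 *\<^sub>C (U o\<^sub>L A)"

lemma scaled_left_mult_power:
  assumes U: "U \<in> clinear_ops"
  shows "(scaled_left_mult U ^^ n) A = 4 ^ n *\<^sub>C (blinfun_power U n o\<^sub>L A)"
proof (induction n)
  case (Suc n)
  show ?case
    unfolding funpow.simps o_apply Suc
    unfolding scaled_left_mult_def
    by (rule blinfun_eqI) (simp add: clinear_opsD[OF U] scaleC_scaleC)
qed (rule blinfun_eqI, simp add: scaleC_one)

lemma scaled_left_mult_expanding:
  assumes X: "normed_carrier X nrm" and U: "U \<in> clinear_ops"
    and "\<And>A. A \<in> X \<Longrightarrow> U o\<^sub>L A \<in> X" "\<And>A. A \<in> X \<Longrightarrow> nrm (U o\<^sub>L A) = nrm A"
  shows "bounded_op X nrm (scaled_left_mult U)" "\<not> Li_Yorke_chaotic X nrm (scaled_left_mult U)"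
    "\<not> distributionally_chaotic_3 X nrm (scaled_left_mult U)"
proof -
  interpret normed_carrier X nrm by fact
  have "scaled_left_mult U (c *\<^sub>C A) = c *\<^sub>C scaled_left_mult U A" for c A
    by (rule blinfun_eqI) (simp add: scaled_left_mult_def clinear_opsD[OF U] scaleC_scaleC mult.commute)
  moreover have "scaled_left_mult U (A + B) = scaled_left_mult U A + scaled_left_mult U B" for A B
    by (simp add: scaled_left_mult_def blinfun_compose_add_right scaleC_add_right)
  moreover have "nrm (scaled_left_mult U A) = 4 * nrm A" if "A \<in> X" for A
    using assms that by (simp add: scaled_left_mult_def nrm_scaleC)
  moreover have "scaled_left_mult U A \<in> X" if "A \<in> X" for A
    using assms that by (simp add: scaled_left_mult_def scaleC_closed)
  ultimately show "bounded_op X nrm (scaled_left_mult U)" "\<not> Li_Yorke_chaotic X nrm (scaled_left_mult U)"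
    "\<not> distributionally_chaotic_3 X nrm (scaled_left_mult U)"
    by (intro expanding_operator; simp)+
qed

lemma normed_carrier_compact_ops: "normed_carrier (compact_ops :: 'h::chilbert_space endo set) norm"
  by standard (auto simp: norm_blinfun_scaleC intro: compact_ops_add compact_ops_scaleC norm_triangle_ineq)

context onb_sequence
begin

text \<open>The exponents are dictated by supports. After \<open>n\<close> steps the truncated part
  sits on coordinates from \<open>n\<close> to below \<open>n + N\<close> and the block from
  \<open>n + N\<close> on; the second vector occupies the coordinates below \<open>N\<close> and
  those from \<open>n + N\<close> on. As \<open>N \<le> n\<close>, only the blocks overlap, and
  there the isometry gives \<open>cinner u v\<close>.\<close>

lemma cinner_shift_power_add:
  assumes "N \<le> n"
  shows "cinner (blinfun_power shift n (of_real c *\<^sub>C trunc N x +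
        of_real a *\<^sub>C blinfun_power shift N u))
      (of_real d *\<^sub>C trunc N y + of_real b *\<^sub>C (blinfun_power shift (n + N)) v)
    = complex_of_real (a * b) * cinner u v"
proof -
  define S where "S n = blinfun_apply shift ^^ n" for n
  have Sadd: "S (n + m) x = S n (S m x)" for n m x by (simp add: S_def funpow_add)
  have 1: "cinner (S n (trunc N x)) (trunc N y) = 0"
    unfolding S_def by (rule cinner_shift_power_trunc[OF assms])
  have 2: "cinner (S (n + N) u) (trunc N y) = 0"
    unfolding S_def by (rule cinner_shift_power_trunc) simp
  have "cinner (S N v) (trunc N x) = 0"
    unfolding S_def by (rule cinner_shift_power_trunc) simp
  then have "cinner (trunc N x) (S N v) = 0" by (metis cinner_commute complex_cnj_zero)
  then have 3: "cinner (S n (trunc N x)) (S (n + N) v) = 0"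
    by (simp add: Sadd) (simp add: S_def cinner_shift_power)
  have 4: "cinner (S (n + N) u) (S (n + N) v) = cinner u v"
    by (simp add: S_def cinner_shift_power)
  have lin: "(blinfun_power shift n) (of_real c *\<^sub>C trunc N x +
        of_real a *\<^sub>C blinfun_power shift N u)
      = of_real c *\<^sub>C S n (trunc N x) + of_real a *\<^sub>C S (n + N) u"
    by (simp add: blinfun.add_right clinear_opsD[OF clinear_ops_power[OF shift_clinear]])
      (simp add: blinfun_apply_power S_def funpow_add)
  have pow: "(blinfun_power shift (n + N)) v = S (n + N) v"
    by (simp only: S_def blinfun_apply_power)
  show ?thesis
    unfolding lin pow
    by (simp add: cinner_add_left cinner_add_right cinner_scaleC_left cinner_scaleC_right 1 2 3 4)
qed

text \<open>Tested on vectors \<open>h\<close> and \<open>k\<close>, the product of \<open>A\<close>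
  and \<open>B\<close> is \<open>cinner (A h) (B k)\<close>, so the vector identity applies to the
  values at \<open>h\<close> and \<open>k\<close>.\<close>

lemma op_product_shift_power:
  assumes X: "x \<in> clinear_ops" "y \<in> clinear_ops" and Y: "E \<in> clinear_ops" "F \<in> clinear_ops" and "N \<le> n"
  shows "op_product ((scaled_left_mult shift ^^ n) (of_real c *\<^sub>C (trunc_op N o\<^sub>L x) +
        of_real a *\<^sub>C (blinfun_power shift N o\<^sub>L E)))
      (of_real d *\<^sub>C (trunc_op N o\<^sub>L y) + of_real b *\<^sub>C (blinfun_power shift (n + N) o\<^sub>L F))
    = of_real (4 ^ n * a * b) *\<^sub>C op_product E F"
proof -
  define B where "B = of_real d *\<^sub>C (trunc_op N o\<^sub>L y) + of_real b *\<^sub>C (blinfun_power shift (n + N) o\<^sub>L F)"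
  have B: "B \<in> clinear_ops"
    unfolding B_def by (intro clinear_ops_add clinear_ops_scaleC clinear_ops_compose trunc_op_clinear
        clinear_ops_power shift_clinear X Y)
  show ?thesis
    unfolding B_def[symmetric] scaled_left_mult_power[OF shift_clinear]
  proof (rule op_eqI)
    fix h k
    show "cinner (blinfun_apply (op_product (4 ^ n *\<^sub>C (blinfun_power shift n o\<^sub>L
         (of_real c *\<^sub>C (trunc_op N o\<^sub>L x) + of_real a *\<^sub>C (blinfun_power shift N o\<^sub>L E)))) B) h) k
       = cinner ((of_real (4 ^ n * a * b) *\<^sub>C op_product E F) h) k"
      using cinner_shift_power_add[OF \<open>N \<le> n\<close>, of c "blinfun_apply x h" a "blinfun_apply E h" d "blinfun_apply y k" b "blinfun_apply F k"]
      by (simp add: op_product_def cinner_cadjoint_left B Y cinner_scaleC_left)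
        (simp add: B_def blinfun.add_left)
  qed
qed

text \<open>The truncation is a compact substitute for the identity: \<open>E = C\<close> and
  \<open>F = trunc_op N\<close> have product \<open>trunc_op N o\<^sub>L C\<close>, which is close
  to \<open>C\<close>.\<close>

lemma op_product_scaled_compact:
  fixes C :: "'h endo"
  assumes "C \<in> compact_ops" "0 < r"
  shows "\<exists>E\<in>compact_ops. \<exists>F\<in>compact_ops. op_product E F \<in> compact_ops \<and> norm (op_product E F - C) < r"
proof -
  obtain N where "norm (C - (trunc_op N o\<^sub>L C)) < r"
    using order_tendstoD(2)[OF compact_trunc_approx[OF assms(1)] assms(2)]
    by (auto simp: eventually_sequentially)
  then show ?thesis
    using assms(1) compact_ops_compose_left[OF assms(1) trunc_op_clinear, of N]
    by (intro bexI[of _ C] bexI[of _ "trunc_op N"])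
      (simp_all add: op_product_def cadjoint_trunc_op trunc_op_compact norm_minus_commute)
qed

lemma norm_shift_compose: "norm (blinfun_power shift n o\<^sub>L (A :: 'h endo)) = norm A"
  by (simp add: norm_blinfun.rep_eq onorm_def blinfun_apply_power norm_shift_power)

lemma left_mult_shift_cstar_transitive:
  fixes X :: "'h endo set"
  assumes "normed_carrier X nrm" "normed_carrier M nrmM" and X: "\<And>A. A \<in> X \<Longrightarrow> A \<in> clinear_ops"
    and "\<And>A N. A \<in> X \<Longrightarrow> trunc_op N o\<^sub>L A \<in> X"
    and "\<And>A. A \<in> X \<Longrightarrow> (\<lambda>N. nrm ((trunc_op N o\<^sub>L A) - A)) \<longlonglongrightarrow> 0"
    and "\<And>A N. A \<in> X \<Longrightarrow> blinfun_power shift N o\<^sub>L A \<in> X"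
    and nrm: "\<And>A N. A \<in> X \<Longrightarrow> nrm (blinfun_power shift N o\<^sub>L A) = nrm A"
    and "\<And>C r. C \<in> M \<Longrightarrow> 0 < r \<Longrightarrow> \<exists>E\<in>X. \<exists>F\<in>X. op_product E F \<in> M \<and> nrmM (op_product E F - C) < r"
  shows "cstar_transitive X nrm M nrmM op_product (scaled_left_mult shift)"
proof (rule cstar_transitive_criterion[where P = "\<lambda>N x. trunc_op N o\<^sub>L x" and Y = X and \<psi> = op_product
      and J = "\<lambda>N E. blinfun_power shift N o\<^sub>L E"])
  show "\<exists>K. \<forall>N. nrm (blinfun_power shift N o\<^sub>L E) \<le> K" if "E \<in> X" for E
    by (rule exI[of _ "nrm E"]) (simp add: nrm[OF that])
qed (use assms in \<open>simp_all only: op_product_shift_power\<close>)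

lemma compact_ops_cstar_transitive:
  "cstar_transitive compact_ops norm compact_ops norm op_product (scaled_left_mult shift)"
proof (rule left_mult_shift_cstar_transitive)
  show "(\<lambda>N. norm ((trunc_op N o\<^sub>L A) - A)) \<longlonglongrightarrow> 0" if "A \<in> compact_ops" for A :: "'h endo"
    using compact_trunc_approx[OF that] by (simp add: norm_minus_commute)
qed (simp_all add: normed_carrier_compact_ops compact_ops_compose_left trunc_op_clinear compact_ops_clinear
    clinear_ops_power shift_clinear op_product_scaled_compact norm_shift_compose)

lemma compact_ops_example:
  "\<exists>T :: 'h endo \<Rightarrow> 'h endo.
     bounded_op compact_ops norm T \<and> cstar_transitive compact_ops norm compact_ops norm op_product T \<and>
     \<not> Li_Yorke_chaotic compact_ops norm T \<and> \<not> distributionally_chaotic_3 compact_ops norm T"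
  by (intro exI[of _ "scaled_left_mult shift"] conjI compact_ops_cstar_transitive
      scaled_left_mult_expanding[OF normed_carrier_compact_ops shift_clinear])
    (simp_all only: norm_shift_compose[of 1, unfolded blinfun_power_one] compact_ops_compose_left shift_clinear)

section \<open>Hilbert--Schmidt operators\<close>

definition HS :: "'h endo set" where "HS = hilbert_schmidt_ops f"
definition hsn :: "'h endo \<Rightarrow> real" where "hsn = hilbert_schmidt_norm f"

lemma HS_clinear: "A \<in> HS \<Longrightarrow> A \<in> clinear_ops"
  by (simp add: HS_def hilbert_schmidt_ops_def)

lemma hsn_nonneg: "0 \<le> hsn A"
  by (simp add: hsn_def hilbert_schmidt_norm_def infsum_nonneg)

lemma hsn_square: "(hsn A)\<^sup>2 = (\<Sum>\<^sub>\<infinity>j. (norm (A (f j)))\<^sup>2)"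
  by (simp add: hsn_def hilbert_schmidt_norm_def infsum_nonneg)

lemma HS_summable: "A \<in> HS \<Longrightarrow> (\<lambda>j. (norm (A (f j)))\<^sup>2) summable_on UNIV"
  by (simp add: HS_def hilbert_schmidt_ops_def)

lemma sum_le_hsn:
  assumes "A \<in> HS" "finite I"
  shows "(\<Sum>j\<in>I. (norm (A (f j)))\<^sup>2) \<le> (hsn A)\<^sup>2"
  unfolding hsn_square by (rule finite_sum_le_infsum[OF HS_summable[OF assms(1)] assms(2)]) auto

lemma L2_set_le_hsn:
  assumes "A \<in> HS" "finite I"
  shows "L2_set (\<lambda>j. norm (A (f j))) I \<le> hsn A"
  unfolding L2_set_def using sum_le_hsn[OF assms] by (intro real_le_lsqrt) (auto simp: hsn_nonneg sum_nonneg)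

lemma HS_intro:
  assumes "A \<in> clinear_ops" and le: "\<And>I. finite I \<Longrightarrow> (\<Sum>j\<in>I. (norm (A (f j)))\<^sup>2) \<le> K\<^sup>2"
  shows "A \<in> HS" "0 \<le> K \<Longrightarrow> hsn A \<le> K"
proof -
  have s: "(\<lambda>j. (norm (A (f j)))\<^sup>2) summable_on UNIV"
  proof (rule nonneg_bdd_above_summable_on)
    show "bdd_above (sum (\<lambda>j. (norm (A (f j)))\<^sup>2) ` {F. F \<subseteq> UNIV \<and> finite F})"
      by (rule bdd_aboveI2[of _ _ "K\<^sup>2"]) (simp add: le)
  qed simp
  then show "A \<in> HS" using assms(1) by (simp add: HS_def hilbert_schmidt_ops_def)
  have "(hsn A)\<^sup>2 \<le> K\<^sup>2" unfolding hsn_square by (rule infsum_le_finite_sums[OF s]) (rule le)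
  then show "0 \<le> K \<Longrightarrow> hsn A \<le> K" by (rule power2_le_imp_le)
qed

lemma HS_introL2:
  assumes "A \<in> clinear_ops" "0 \<le> K"
    and le: "\<And>I. finite I \<Longrightarrow> L2_set (\<lambda>j. norm (A (f j))) I \<le> K"
  shows "A \<in> HS" "hsn A \<le> K"
proof -
  have "(\<Sum>j\<in>I. (norm (A (f j)))\<^sup>2) \<le> K\<^sup>2" if "finite I" for I
    using le[OF that] unfolding L2_set_def by (rule sqrt_le_D)
  from HS_intro[OF assms(1) this] assms(2) show "A \<in> HS" "hsn A \<le> K" by simp_all
qed

lemma op_zeroI:
  fixes A :: "'h endo"
  assumes A: "A \<in> clinear_ops" "\<And>j. A (f j) = 0"
  shows "A = 0"
proof (rule blinfun_eqI)
  fix x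
  have "A (trunc N x) = 0" for N
    by (simp add: trunc_def blinfun.sum_right clinear_opsD[OF A(1)] A(2))
  moreover have "(\<lambda>N. A (trunc N x)) \<longlonglongrightarrow> A x"
    by (intro blinfun.tendsto tendsto_const trunc_tendsto)
  ultimately show "blinfun_apply A x = blinfun_apply 0 x" by (simp add: LIMSEQ_const_iff)
qed

lemma normed_carrier_HS: "normed_carrier HS hsn"
proof
  fix A B :: "'h endo" assume AB: "A \<in> HS" "B \<in> HS"
  have cl: "A + B \<in> clinear_ops" using AB by (intro clinear_ops_add HS_clinear)
  have "L2_set (\<lambda>j. norm ((A + B) (f j))) I \<le> hsn A + hsn B" if I: "finite I" for I
  proof -
    have "L2_set (\<lambda>j. norm ((A + B) (f j))) I
        \<le> L2_set (\<lambda>j. norm (A (f j)) + norm (B (f j))) I"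
      by (rule L2_set_mono) (simp_all add: blinfun.add_left norm_triangle_ineq)
    also have "\<dots> \<le> L2_set (\<lambda>j. norm (A (f j))) I + L2_set (\<lambda>j. norm (B (f j))) I"
      by (rule L2_set_triangle_ineq)
    also have "\<dots> \<le> hsn A + hsn B" using AB I by (intro add_mono L2_set_le_hsn)
    finally show ?thesis .
  qed
  from HS_introL2[OF cl _ this] show "A + B \<in> HS" "hsn (A + B) \<le> hsn A + hsn B"
    by (simp_all add: hsn_nonneg)
next
  fix A :: "'h endo" and c assume A: "A \<in> HS"
  show "c *\<^sub>C A \<in> HS"
    using HS_summable[OF A] HS_clinear[OF A]
    by (auto simp: HS_def hilbert_schmidt_ops_def norm_scaleC power_mult_distrib
        intro: clinear_ops_scaleC summable_on_cmult_right)
  show "hsn (c *\<^sub>C A) = cmod c * hsn A"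
    by (simp add: hsn_def hilbert_schmidt_norm_def norm_scaleC power_mult_distrib infsum_cmult_right'
        real_sqrt_mult)
next
  fix A :: "'h endo" assume A: "A \<in> HS" "hsn A = 0"
  show "A = 0"
  proof (rule op_zeroI[OF HS_clinear[OF A(1)]])
    fix j
    show "A (f j) = 0" using sum_le_hsn[OF A(1), of "{j}"] A(2) by simp
  qed
qed

lemma HS_compose_left:
  assumes A: "A \<in> HS" and B: "B \<in> clinear_ops" "norm B \<le> 1"
  shows "B o\<^sub>L A \<in> HS" "hsn (B o\<^sub>L A) \<le> hsn A"
proof -
  have le: "norm (B x) \<le> norm x" for x
    using norm_blinfun[of B x] mult_right_mono[OF B(2), of "norm x"] by simp
  have "(\<Sum>j\<in>I. (norm ((B o\<^sub>L A) (f j)))\<^sup>2) \<le> (hsn A)\<^sup>2" if "finite I" for I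
    by (rule order_trans[OF sum_mono sum_le_hsn[OF A that]]) (simp add: power_mono le)
  from HS_intro[OF clinear_ops_compose[OF B(1) HS_clinear[OF A]] this] show "B o\<^sub>L A \<in> HS" "hsn (B o\<^sub>L A) \<le> hsn A"
    by (simp_all add: hsn_nonneg)
qed

text \<open>The double sum of squared matrix entries is symmetric in rows and columns. Truncating
  one index keeps both sums finite for the swap; Bessel then bounds each column.\<close>

lemma HS_cadjoint:
  assumes A: "A \<in> HS"
  shows "cadjoint A \<in> HS" "hsn (cadjoint A) \<le> hsn A"
proof -
  note Acl = HS_clinear[OF A]
  have "(\<Sum>i\<in>I. (norm (cadjoint A (f i)))\<^sup>2) \<le> (hsn A)\<^sup>2" if I: "finite I" for I
  proof (rule LIMSEQ_le_const2)
    show "(\<lambda>N. \<Sum>i\<in>I. (norm (trunc N (cadjoint A (f i))))\<^sup>2)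
        \<longlonglongrightarrow> (\<Sum>i\<in>I. (norm (cadjoint A (f i)))\<^sup>2)"
      by (intro tendsto_sum tendsto_power tendsto_norm trunc_tendsto)
    have "(\<Sum>i\<in>I. (norm (trunc N (cadjoint A (f i))))\<^sup>2) \<le> (hsn A)\<^sup>2" for N
    proof -
      have "(\<Sum>i\<in>I. (norm (trunc N (cadjoint A (f i))))\<^sup>2)
          = (\<Sum>i\<in>I. \<Sum>j<N. (cmod (cinner (cadjoint A (f i)) (f j)))\<^sup>2)"
        unfolding trunc_def by (subst orthonormal_sum_norm[OF ortho]) simp_all
      also have "\<dots> = (\<Sum>j<N. \<Sum>i\<in>I. (cmod (cinner (A (f j)) (f i)))\<^sup>2)"
        by (subst sum.swap) (simp add: cinner_cadjoint_left[OF Acl] cinner_commute[of "f _"])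
      also have "\<dots> \<le> (\<Sum>j<N. (norm (A (f j)))\<^sup>2)"
        by (intro sum_mono Bessel_le ortho I)
      also have "\<dots> \<le> (hsn A)\<^sup>2" by (rule sum_le_hsn[OF A]) simp
      finally show ?thesis .
    qed
    then show "\<exists>N. \<forall>n\<ge>N. (\<Sum>i\<in>I. (norm (trunc n (cadjoint A (f i))))\<^sup>2) \<le> (hsn A)\<^sup>2"
      by blast
  qed
  from HS_intro[OF cadjoint_clinear[OF Acl] this] show "cadjoint A \<in> HS" "hsn (cadjoint A) \<le> hsn A"
    by (simp_all add: hsn_nonneg)
qed

end

text \<open>Dominated convergence: a finite set carries all but \<open>r / 2\<close> of the sum of
  \<open>b\<close>, the tail of \<open>a n\<close> is below that of \<open>b\<close>, and the head
  is a finite sum of null sequences.\<close>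

lemma infsum_dominated_tendsto_0:
  fixes a :: "nat \<Rightarrow> 'i \<Rightarrow> real" and b :: "'i \<Rightarrow> real"
  assumes b: "b summable_on UNIV" and a: "\<And>n j. 0 \<le> a n j" "\<And>n j. a n j \<le> b j"
    and lim: "\<And>j. (\<lambda>n. a n j) \<longlonglongrightarrow> 0"
  shows "(\<lambda>n. infsum (a n) UNIV) \<longlonglongrightarrow> 0"
proof (rule LIMSEQ_I)
  fix r :: real assume "r > 0"
  have b0: "0 \<le> b j" for j using a order_trans by blast
  have as: "a n summable_on A" for n A
    by (rule summable_on_comparison_test[OF summable_on_subset_banach[OF b]]) (auto simp: a)
  obtain F where F: "finite F" "\<bar>sum b F - infsum b UNIV\<bar> < r / 2"
  proof -
    have "(sum b \<longlongrightarrow> infsum b UNIV) (finite_subsets_at_top UNIV)"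
      using has_sum_infsum[OF b] by (simp add: has_sum_def)
    then have "\<forall>\<^sub>F F in finite_subsets_at_top UNIV. dist (sum b F) (infsum b UNIV) < r / 2"
      using \<open>r > 0\<close> by (intro tendstoD) auto
    then show ?thesis using that unfolding eventually_finite_subsets_at_top dist_real_def by blast
  qed
  have "(\<lambda>n. sum (a n) F) \<longlonglongrightarrow> (\<Sum>j\<in>F. 0)" by (intro tendsto_sum lim)
  then obtain N where N: "\<And>n. n \<ge> N \<Longrightarrow> \<bar>sum (a n) F\<bar> < r / 2"
    using LIMSEQ_D[of "\<lambda>n. sum (a n) F" 0 "r/2"] \<open>r > 0\<close> by auto
  have "norm (infsum (a n) UNIV - 0) < r" if "n \<ge> N" for n
  proof -
    have "infsum (a n) UNIV = infsum (a n) F + infsum (a n) (- F)"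
      using infsum_Un_disjoint[OF as as, of F "- F" n] by (simp add: Un_commute)
    also have "infsum (a n) F = sum (a n) F" using F(1) by simp
    also have "infsum (a n) (- F) \<le> infsum b (- F)"
      by (rule infsum_mono[OF as summable_on_subset_banach[OF b]]) (auto simp: a)
    also have "infsum b (- F) = infsum b UNIV - sum b F"
      using infsum_Diff[OF b summable_on_subset_banach[OF b], of F] F(1) by (simp add: Compl_eq_Diff_UNIV)
    finally have "infsum (a n) UNIV < r" using N[OF that] F(2) by linarith
    moreover have "0 \<le> infsum (a n) UNIV" by (rule infsum_nonneg) (simp add: a)
    ultimately show ?thesis by simp
  qed
  then show "\<exists>N. \<forall>n\<ge>N. norm (infsum (a n) UNIV - 0) < r" by blast
qed

context onb_sequence
begin

lemma HS_trunc_approx: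
  assumes A: "A \<in> HS"
  shows "(\<lambda>N. hsn ((trunc_op N o\<^sub>L A) - A)) \<longlonglongrightarrow> 0"
proof -
  have "(\<lambda>N. \<Sum>\<^sub>\<infinity>j. (norm (((trunc_op N o\<^sub>L A) - A) (f j)))\<^sup>2) \<longlonglongrightarrow> 0"
  proof (rule infsum_dominated_tendsto_0[OF HS_summable[OF A]])
    show "(norm (((trunc_op N o\<^sub>L A) - A) (f j)))\<^sup>2 \<le> (norm (A (f j)))\<^sup>2" for N j
      using norm_diff_trunc_le[of "blinfun_apply A (f j)" N]
      by (simp add: blinfun.diff_left norm_minus_commute power_mono)
    fix j
    have "(\<lambda>N. (norm (trunc N (A (f j)) - A (f j)))\<^sup>2)
        \<longlonglongrightarrow> (norm (A (f j) - A (f j)))\<^sup>2"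
      by (intro tendsto_power tendsto_norm tendsto_diff trunc_tendsto tendsto_const)
    then show "(\<lambda>N. (norm (((trunc_op N o\<^sub>L A) - A) (f j)))\<^sup>2) \<longlonglongrightarrow> 0"
      by (simp add: blinfun.diff_left)
  qed simp
  from tendsto_real_sqrt[OF this] show ?thesis
    by (simp add: hsn_def hilbert_schmidt_norm_def)
qed

section \<open>Trace class operators\<close>

definition TC :: "'h endo set" where "TC = trace_class_ops f"
definition trn :: "'h endo \<Rightarrow> real" where "trn = trace_norm f"

lemma TC_clinear: "A \<in> TC \<Longrightarrow> A \<in> clinear_ops"
  by (simp add: TC_def trace_class_ops_def)

lemma TC_intro:
  assumes A: "A \<in> clinear_ops"
    and le: "\<And>I. finite I \<Longrightarrow> (\<Sum>j\<in>I. Re (cinner (abs_op A (f j)) (f j))) \<le> K"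
  shows "A \<in> TC" "trn A \<le> K"
proof -
  have s: "(\<lambda>j. Re (cinner (abs_op A (f j)) (f j))) summable_on UNIV"
  proof (rule nonneg_bdd_above_summable_on)
    show "bdd_above (sum (\<lambda>j. Re (cinner (abs_op A (f j)) (f j))) ` {F. F \<subseteq> UNIV \<and> finite F})"
      by (rule bdd_aboveI2[of _ _ K]) (simp add: le)
  qed (rule positive_op_Re[OF abs_op_positive[OF A]])
  then show "A \<in> TC" using A by (simp add: TC_def trace_class_ops_def)
  show "trn A \<le> K" unfolding trn_def trace_norm_def by (rule infsum_le_finite_sums[OF s]) (rule le)
qed

text \<open>For the root \<open>Q\<close> of \<open>abs_op A\<close> the form value of
  \<open>abs_op A\<close> at \<open>x\<close> is the square of \<open>norm (Q x)\<close>, so the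
  trace norm is a squared Hilbert-Schmidt norm. Questions about trace class operators thereby become
  Hilbert-Schmidt questions.\<close>

lemma trace_class_factor:
  assumes A: "A \<in> TC"
  obtains W Q where "W \<in> clinear_ops" "norm W \<le> 1" "Q \<in> HS" "(hsn Q)\<^sup>2 = trn A"
    "positive_op Q" "A = W o\<^sub>L (Q o\<^sub>L Q)"
proof -
  note Acl = TC_clinear[OF A]
  obtain W where W: "W \<in> clinear_ops" "norm W \<le> 1" "W o\<^sub>L abs_op A = A"
    using polar_decomposition[OF Acl] by metis
  obtain Q where Q: "positive_op Q" "Q o\<^sub>L Q = abs_op A"
    using positive_sqrt_exists[OF abs_op_positive[OF Acl]] by metis
  have eq: "Re (cinner (abs_op A x) x) = (norm (Q x))\<^sup>2" for x
    using positive_op_hermitian[OF Q(1), of "blinfun_apply Q x" x]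
    by (simp add: Q(2)[symmetric] cinner_self)
  have "Q \<in> HS"
    using A by (simp add: HS_def hilbert_schmidt_ops_def TC_def trace_class_ops_def eq positive_op_clinear[OF Q(1)])
  moreover have "(hsn Q)\<^sup>2 = trn A"
    by (simp add: hsn_square trn_def trace_norm_def eq)
  ultimately show ?thesis using that W Q by metis
qed

text \<open>The upper bound in the duality between the trace norm and contractions. It is what makes
  the triangle inequality accessible: the absolute value of a sum is not dominated by the sum of the
  absolute values, but the pairing with a fixed \<open>V\<close> is additive.\<close>

lemma trace_pairing_le:
  assumes A: "A \<in> TC" and V: "V \<in> clinear_ops" "norm V \<le> 1" and I: "finite I"
  shows "(\<Sum>j\<in>I. Re (cinner (V (A (f j))) (f j))) \<le> trn A"
proof -
  obtain W Q where WQ: "W \<in> clinear_ops" "norm W \<le> 1" "Q \<in> HS" "(hsn Q)\<^sup>2 = trn A"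
    "positive_op Q" "A = W o\<^sub>L (Q o\<^sub>L Q)"
    using trace_class_factor[OF A] by metis
  define G where "G = V o\<^sub>L W"
  have "norm V * norm W \<le> 1 * 1" using V WQ by (intro mult_mono) auto
  then have G: "G \<in> clinear_ops" "norm G \<le> 1"
    unfolding G_def using V WQ norm_blinfun_compose[of V W] by (auto intro: clinear_ops_compose)
  have Qa: "cadjoint Q = Q" by (rule cadjoint_eqI) (rule positive_op_hermitian[OF WQ(5)])
  \<comment> \<open>\<open>V A\<close> is rewritten as \<open>(G Q) Q\<close>, so each diagonal
    entry is an inner product of \<open>Q (f j)\<close> and \<open>H (f j)\<close>, ready for
    Cauchy-Schwarz over \<open>j\<close> with two Hilbert-Schmidt factors of norm at most
    \<open>hsn Q\<close>.\<close>
  define H where "H = cadjoint (G o\<^sub>L Q)"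
  have H: "H \<in> HS" "hsn H \<le> hsn Q"
    unfolding H_def
    by (rule HS_cadjoint(1)[OF HS_compose_left(1)[OF WQ(3) G]],
        rule order_trans[OF HS_cadjoint(2)[OF HS_compose_left(1)[OF WQ(3) G]] HS_compose_left(2)[OF WQ(3) G]])
  have Hap: "H x = Q (cadjoint G x)" for x
    unfolding H_def by (simp add: cadjoint_compose[OF G(1) HS_clinear[OF WQ(3)]] Qa)
  have each: "Re (cinner (V (A (f j))) (f j))
      \<le> \<bar>norm (Q (f j))\<bar> * \<bar>norm (H (f j))\<bar>" for j
  proof -
    have "cinner (V (A (f j))) (f j)
        = cinner (G (Q (Q (f j)))) (f j)"
      by (simp add: WQ(6) G_def)
    also have "\<dots> = cinner (Q (f j)) (H (f j))"
      by (simp add: cinner_cadjoint[OF G(1)] Hap positive_op_hermitian[OF WQ(5)])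
    finally show ?thesis
      using complex_Re_le_cmod[of "cinner (blinfun_apply Q (f j)) (blinfun_apply H (f j))"]
        cinner_Cauchy_Schwarz[of "blinfun_apply Q (f j)" "blinfun_apply H (f j)"] by simp
  qed
  have "(\<Sum>j\<in>I. Re (cinner (V (A (f j))) (f j)))
      \<le> (\<Sum>j\<in>I. \<bar>norm (Q (f j))\<bar> * \<bar>norm (H (f j))\<bar>)"
    by (intro sum_mono each)
  also have "\<dots> \<le> L2_set (\<lambda>j. norm (Q (f j))) I * L2_set (\<lambda>j. norm (H (f j))) I"
    by (rule L2_set_mult_ineq)
  also have "\<dots> \<le> hsn Q * hsn Q"
    by (rule mult_mono[OF L2_set_le_hsn[OF WQ(3) I] order_trans[OF L2_set_le_hsn[OF H(1) I] H(2)]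
          hsn_nonneg L2_set_nonneg])
  finally show ?thesis using WQ(4) by (simp add: power2_eq_square)
qed

lemma adjoint_product_scaleC:
  fixes A :: "'h endo"
  assumes "A \<in> clinear_ops"
  shows "cadjoint (c *\<^sub>C A) o\<^sub>L (c *\<^sub>C A) = (cmod c)\<^sup>2 *\<^sub>R (cadjoint A o\<^sub>L A)"
proof -
  have "cadjoint (c *\<^sub>C A) o\<^sub>L (c *\<^sub>C A) = of_real ((cmod c)\<^sup>2) *\<^sub>C (cadjoint A o\<^sub>L A)"
    by (rule blinfun_eqI)
      (simp add: cadjoint_scaleC[OF assms] complex_norm_square clinear_opsD[OF cadjoint_clinear[OF assms]]
        scaleC_scaleC mult.commute del: of_real_power)
  then show ?thesis by (simp only: scaleC_of_real_blinfun)
qed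

lemma abs_op_scaleC:
  fixes A :: "'h endo"
  assumes A: "A \<in> clinear_ops"
  shows "abs_op (c *\<^sub>C A) = cmod c *\<^sub>R abs_op A"
proof (rule abs_op_eqI[OF clinear_ops_scaleC[OF A]])
  show "positive_op (cmod c *\<^sub>R abs_op A)" by (intro positive_op_scaleR abs_op_positive A) simp
  show "(cmod c *\<^sub>R abs_op A) o\<^sub>L (cmod c *\<^sub>R abs_op A) = cadjoint (c *\<^sub>C A) o\<^sub>L (c *\<^sub>C A)"
    unfolding adjoint_product_scaleC[OF A] abs_op_square[OF A, symmetric]
    by (rule blinfun_eqI) (simp add: blinfun.scaleR_left blinfun.scaleR_right power2_eq_square)
qed

lemma normed_carrier_TC: "normed_carrier TC trn"
proof
  fix A B :: "'h endo" assume AB: "A \<in> TC" "B \<in> TC"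
  have cl: "A + B \<in> clinear_ops" using AB by (intro clinear_ops_add TC_clinear)
  \<comment> \<open>Expressing \<open>abs_op (A + B)\<close> through a fixed contraction applied to
    \<open>A + B\<close> makes its trace split into pairings with \<open>A\<close> and with
    \<open>B\<close>.\<close>
  obtain W where W: "W \<in> clinear_ops" "norm W \<le> 1" "cadjoint W o\<^sub>L (A + B) = abs_op (A + B)"
    using polar_decomposition[OF cl] by metis
  have W': "cadjoint W \<in> clinear_ops" "norm (cadjoint W) \<le> 1"
    using cadjoint_clinear[OF W(1)] norm_cadjoint_le[OF W(1)] W(2) by auto
  have "(\<Sum>j\<in>I. Re (cinner (abs_op (A + B) (f j)) (f j))) \<le> trn A + trn B" if I: "finite I" for I
  proof -
    have "(\<Sum>j\<in>I. Re (cinner (abs_op (A + B) (f j)) (f j)))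
        = (\<Sum>j\<in>I. Re (cinner (cadjoint W (A (f j))) (f j)))
          + (\<Sum>j\<in>I. Re (cinner (cadjoint W (B (f j))) (f j)))"
      by (simp add: W(3)[symmetric] blinfun.add_left blinfun.add_right cinner_add_left sum.distrib)
    also have "\<dots> \<le> trn A + trn B" by (intro add_mono trace_pairing_le AB W' I)
    finally show ?thesis .
  qed
  from TC_intro[OF cl this] show "A + B \<in> TC" "trn (A + B) \<le> trn A + trn B" by simp_all
next
  fix A :: "'h endo" and c assume A: "A \<in> TC"
  have eq: "Re (cinner ((abs_op (c *\<^sub>C A)) x) x) = cmod c * Re (cinner (abs_op A x) x)" for x
    by (simp add: abs_op_scaleC[OF TC_clinear[OF A]] blinfun.scaleR_left scaleR_scaleC cinner_scaleC_left)
  show "c *\<^sub>C A \<in> TC"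
    using A by (auto simp: TC_def trace_class_ops_def eq intro: clinear_ops_scaleC summable_on_cmult_right)
  show "trn (c *\<^sub>C A) = cmod c * trn A"
    by (simp add: trn_def trace_norm_def eq infsum_cmult_right')
next
  fix A :: "'h endo" assume A: "A \<in> TC" "trn A = 0"
  obtain W Q where WQ: "Q \<in> HS" "(hsn Q)\<^sup>2 = trn A" "A = W o\<^sub>L (Q o\<^sub>L Q)"
    using trace_class_factor[OF A(1)] by metis
  interpret HS: normed_carrier HS hsn by (rule normed_carrier_HS)
  have "Q = 0" using WQ A(2) by (intro HS.nrm_eq_0) auto
  then show "A = 0" unfolding WQ(3) by (intro blinfun_eqI) simp
qed

lemma trace_class_product:
  assumes C: "C \<in> TC"
  obtains E F where "E \<in> HS" "F \<in> HS" "op_product E F = C"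
proof -
  obtain W Q where WQ: "W \<in> clinear_ops" "norm W \<le> 1" "Q \<in> HS" "C = W o\<^sub>L (Q o\<^sub>L Q)"
    using trace_class_factor[OF C] by metis
  have WQ': "W o\<^sub>L Q \<in> HS" by (rule HS_compose_left[OF WQ(3,1,2)])
  show ?thesis
  proof (rule that[of Q "cadjoint (W o\<^sub>L Q)"])
    show "cadjoint (W o\<^sub>L Q) \<in> HS" by (rule HS_cadjoint[OF WQ'])
    show "op_product Q (cadjoint (W o\<^sub>L Q)) = C"
      unfolding op_product_def cadjoint_cadjoint[OF HS_clinear[OF WQ']] WQ(4)
      by (rule blinfun_eqI) simp
  qed (rule WQ(3))
qed

lemma HS_shift_compose:
  assumes "A \<in> HS"
  shows "blinfun_power shift n o\<^sub>L A \<in> HS" "hsn (blinfun_power shift n o\<^sub>L A) = hsn A"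
  using assms clinear_ops_power[OF shift_clinear]
  by (auto simp: HS_def hsn_def hilbert_schmidt_ops_def hilbert_schmidt_norm_def blinfun_apply_power
      norm_shift_power intro: clinear_ops_compose)

lemma HS_cstar_transitive:
  "cstar_transitive HS hsn TC trn op_product (scaled_left_mult shift)"
proof (rule left_mult_shift_cstar_transitive)
  have "norm (trunc_op N) \<le> 1" for N
    by (rule norm_blinfun_bound) (simp_all add: norm_trunc_le)
  then show "trunc_op N o\<^sub>L A \<in> HS" if "A \<in> HS" for N A
    by (intro HS_compose_left that trunc_op_clinear)
  show "\<exists>E\<in>HS. \<exists>F\<in>HS. op_product E F \<in> TC \<and> trn (op_product E F - C) < r" if C: "C \<in> TC" "0 < r" for C r
  proof -
    interpret TC: normed_carrier TC trn by (rule normed_carrier_TC)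
    obtain E F where "E \<in> HS" "F \<in> HS" "op_product E F = C" using trace_class_product[OF C(1)] by metis
    then show ?thesis using C TC.nrm_zero[OF C(1)] by (intro bexI[of _ E] bexI[of _ F]) auto
  qed
qed (simp_all add: normed_carrier_HS normed_carrier_TC HS_trunc_approx HS_shift_compose HS_clinear)

lemma HS_example:
  "\<exists>T. bounded_op HS hsn T \<and> cstar_transitive HS hsn TC trn op_product T \<and>
     \<not> Li_Yorke_chaotic HS hsn T \<and> \<not> distributionally_chaotic_3 HS hsn T"
  by (intro exI[of _ "scaled_left_mult shift"] conjI HS_cstar_transitive
      scaled_left_mult_expanding[OF normed_carrier_HS shift_clinear])
    (simp_all only: HS_shift_compose[where n = 1, unfolded blinfun_power_one])

end

section \<open>The standard Hilbert module\<close>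

text \<open>With the converse estimate below, this identifies the root of the norm of a Gram
  operator as the least \<open>K\<close> bounding the Euclidean norms of the vectors
  \<open>z j h\<close> by \<open>K * norm h\<close>. Module inequalities thus reduce to scalar ones
  for each fixed \<open>h\<close>.\<close>

lemma sqrt_norm_positive_op_le:
  assumes "positive_op G" "0 \<le> K" "\<And>h. Re (cinner (G h) h) \<le> (K * norm h)\<^sup>2"
  shows "sqrt (norm G) \<le> K"
proof (rule real_le_lsqrt)
  show "norm G \<le> K\<^sup>2"
    by (rule positive_op_norm_le[OF assms(1)]) (use assms in \<open>simp_all add: power_mult_distrib\<close>)
qed (use assms in simp_all)

lemma cinner_op_le_sqrt_norm:
  "Re (cinner (blinfun_apply G h) h) \<le> (sqrt (norm G) * norm (h::'h::chilbert_space))\<^sup>2"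
  using cinner_op_le_norm[of G h] by (simp add: power_mult_distrib)

context onb_sequence
begin

lemma cinner_adjoint_product:
  fixes A :: "'h endo"
  assumes "A \<in> clinear_ops"
  shows "cinner ((cadjoint A o\<^sub>L A) h) h = complex_of_real ((norm (A h))\<^sup>2)"
  using assms by (simp add: cinner_cadjoint_left cinner_self)

abbreviation gram :: "('i \<Rightarrow> 'h endo) \<Rightarrow> 'i set \<Rightarrow> 'h endo" where
  "gram z I \<equiv> \<Sum>j\<in>I. cadjoint (z j) o\<^sub>L z j"

lemma sum_adjoint_product:
  fixes z :: "nat \<Rightarrow> 'h endo"
  assumes "\<And>j. z j \<in> clinear_ops"
  shows "positive_op (gram z I)"
    and "cinner (gram z I h) h
      = complex_of_real (\<Sum>j\<in>I. (norm (z j h))\<^sup>2)"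
proof -
  show eq: "cinner (gram z I h) h
      = complex_of_real (\<Sum>j\<in>I. (norm (z j h))\<^sup>2)" for h
    by (simp only: blinfun.sum_left cinner_sum_left cinner_adjoint_product[OF assms] of_real_sum)
  show "positive_op (gram z I)"
  proof (rule positive_opI)
    show "gram z I \<in> clinear_ops"
      by (intro clinear_ops_sum clinear_ops_compose cadjoint_clinear assms)
    show "cinner (gram z I h) h
        = cinner h (gram z I h)" for h
      by (subst (2) cinner_commute) (simp only: eq complex_cnj_complex_of_real)
    show "0 \<le> Re (cinner (gram z I h) h)" for h
      unfolding eq by (simp add: sum_nonneg)
  qed
qed

lemma std_moduleD:
  assumes "x \<in> std_module"
  shows "x j \<in> compact_ops" "x j \<in> clinear_ops" "summable (\<lambda>j. cadjoint (x j) o\<^sub>L x j)"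
  using assms by (auto simp: std_module_def compact_ops_clinear)

text \<open>Positivity and diagonal values survive the norm limit of finite Gram sums, so the
  operator series can be read as a scalar series for each \<open>h\<close>.\<close>

lemma module_gram:
  fixes x :: "nat \<Rightarrow> 'h endo"
  assumes x: "x \<in> std_module"
  shows "positive_op (\<Sum>j. cadjoint (x j) o\<^sub>L x j)"
    and "(\<lambda>j. (norm (x j h))\<^sup>2) sums Re (cinner ((\<Sum>j. cadjoint (x j) o\<^sub>L x j) h) h)"
proof -
  define G where "G = (\<Sum>j. cadjoint (x j) o\<^sub>L x j)"
  define g where "g n = (\<Sum>j<n. cadjoint (x j) o\<^sub>L x j)" for n
  have lim: "g \<longlonglongrightarrow> G"
    unfolding G_def g_def by (rule summable_LIMSEQ[OF std_moduleD(3)[OF x]])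
  note g = sum_adjoint_product[where z = x, OF std_moduleD(2)[OF x]]
  have lim': "(\<lambda>n. cinner (g n h) h) \<longlonglongrightarrow> cinner (G h) h" for h
    by (intro cinner_tendsto blinfun.tendsto lim tendsto_const)
  have limRe: "(\<lambda>n. \<Sum>j<n. (norm (x j h))\<^sup>2) \<longlonglongrightarrow> Re (cinner (G h) h)" for h
    using tendsto_Re[OF lim'[of h]] unfolding g_def g(2) Re_complex_of_real .
  show "positive_op (\<Sum>j. cadjoint (x j) o\<^sub>L x j)"
    unfolding G_def[symmetric]
  proof (rule positive_opI)
    show "G \<in> clinear_ops"
      by (rule clinear_ops_closed[OF _ lim]) (unfold g_def, rule positive_op_clinear[OF g(1)])
    show "cinner (G h) h = cinner h (G h)" for h
    proof (rule LIMSEQ_unique[OF lim'])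
      have "(\<lambda>n. cinner h (g n h)) \<longlonglongrightarrow> cinner h (G h)"
        by (intro cinner_tendsto blinfun.tendsto lim tendsto_const)
      then show "(\<lambda>n. cinner (g n h) h) \<longlonglongrightarrow> cinner h (G h)"
        unfolding g_def by (simp only: positive_op_hermitian[OF g(1)])
    qed
    show "0 \<le> Re (cinner (G h) h)" for h
      by (rule LIMSEQ_le_const[OF limRe]) (intro exI allI impI sum_nonneg zero_le_power2)
  qed
  show "(\<lambda>j. (norm (x j h))\<^sup>2) sums Re (cinner ((\<Sum>j. cadjoint (x j) o\<^sub>L x j) h) h)"
    unfolding sums_def using limRe[of h] by (simp only: G_def)
qed

lemma L2_set_le_module_norm:
  fixes x :: "nat \<Rightarrow> 'h endo"
  assumes x: "x \<in> std_module"
  shows "L2_set (\<lambda>j. norm (x j h)) {..<n} \<le> module_norm x * norm h"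
  unfolding L2_set_def
proof (rule real_le_lsqrt)
  have "(\<Sum>j<n. (norm (x j h))\<^sup>2) \<le> (\<Sum>j. (norm (x j h))\<^sup>2)"
    by (rule sum_le_suminf[OF sums_summable[OF module_gram(2)[OF x]]]) auto
  also have "\<dots> = Re (cinner ((\<Sum>j. cadjoint (x j) o\<^sub>L x j) h) h)"
    by (rule sums_unique[OF module_gram(2)[OF x], symmetric])
  also have "\<dots> \<le> (module_norm x * norm h)\<^sup>2"
    unfolding module_norm_def by (rule cinner_op_le_sqrt_norm)
  finally show "(\<Sum>j<n. (norm (x j h))\<^sup>2) \<le> (module_norm x * norm h)\<^sup>2" .
qed (simp_all add: module_norm_def)

lemma module_norm_le:
  fixes x :: "nat \<Rightarrow> 'h endo"
  assumes x: "x \<in> std_module" and "0 \<le> K"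
    and le: "\<And>h n. L2_set (\<lambda>j. norm (x j h)) {..<n} \<le> K * norm h"
  shows "module_norm x \<le> K"
  unfolding module_norm_def
proof (rule sqrt_norm_positive_op_le[OF module_gram(1)[OF x] \<open>0 \<le> K\<close>])
  fix h
  show "Re (cinner ((\<Sum>j. cadjoint (x j) o\<^sub>L x j) h) h) \<le> (K * norm h)\<^sup>2"
  proof (rule LIMSEQ_le_const2[OF module_gram(2)[OF x, unfolded sums_def]], intro exI allI impI)
    show "(\<Sum>j<n. (norm (x j h))\<^sup>2) \<le> (K * norm h)\<^sup>2" for n
      using le[of h n] unfolding L2_set_def by (rule sqrt_le_D)
  qed
qed

text \<open>Minkowski's inequality for each \<open>h\<close>. It is stated for blocks
  \<open>I\<close> because it must feed the Cauchy criterion before \<open>x + y\<close> is known to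
  lie in the module.\<close>

lemma sqrt_norm_sum_adjoint_add:
  fixes x y :: "nat \<Rightarrow> 'h endo"
  assumes x: "\<And>j. x j \<in> clinear_ops" and y: "\<And>j. y j \<in> clinear_ops"
  shows "sqrt (norm (\<Sum>j\<in>I. cadjoint (x j + y j) o\<^sub>L (x j + y j)))
    \<le> sqrt (norm (gram x I)) + sqrt (norm (gram y I))"
proof -
  have xy: "x j + y j \<in> clinear_ops" for j by (intro clinear_ops_add x y)
  define a where "a z = sqrt (norm (gram z I))" for z :: "nat \<Rightarrow> 'h endo"
  have le: "L2_set (\<lambda>j. norm (z j h)) I \<le> a z * norm h" if "\<And>j. z j \<in> clinear_ops" for z h
    unfolding L2_set_def
  proof (rule real_le_lsqrt)
    show "(\<Sum>j\<in>I. (norm (z j h))\<^sup>2) \<le> (a z * norm h)\<^sup>2"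
      using cinner_op_le_sqrt_norm[of "gram z I" h]
      unfolding sum_adjoint_product(2)[where z = z, OF that] Re_complex_of_real a_def .
  qed (simp_all add: a_def sum_nonneg)
  have "a (\<lambda>j. x j + y j) \<le> a x + a y"
    unfolding a_def[of "\<lambda>j. x j + y j"]
  proof (rule sqrt_norm_positive_op_le[OF sum_adjoint_product(1)[where z = "\<lambda>j. x j + y j", OF xy]])
    fix h
    have "L2_set (\<lambda>j. norm ((x j + y j) h)) I
        \<le> L2_set (\<lambda>j. norm (x j h) + norm (y j h)) I"
      by (rule L2_set_mono) (simp_all add: blinfun.add_left norm_triangle_ineq)
    also have "\<dots> \<le> L2_set (\<lambda>j. norm (x j h)) I + L2_set (\<lambda>j. norm (y j h)) I"
      by (rule L2_set_triangle_ineq)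
    also have "\<dots> \<le> a x * norm h + a y * norm h" by (intro add_mono le x y)
    finally have "L2_set (\<lambda>j. norm ((x j + y j) h)) I \<le> (a x + a y) * norm h"
      by (simp add: distrib_right)
    then have "(\<Sum>j\<in>I. (norm ((x j + y j) h))\<^sup>2) \<le> ((a x + a y) * norm h)\<^sup>2"
      unfolding L2_set_def by (rule sqrt_le_D)
    then show "Re (cinner ((\<Sum>j\<in>I. cadjoint (x j + y j) o\<^sub>L (x j + y j)) h) h) \<le> ((a x + a y) * norm h)\<^sup>2"
      unfolding sum_adjoint_product(2)[where z = "\<lambda>j. x j + y j", OF xy] Re_complex_of_real .
  qed (simp add: a_def)
  then show ?thesis by (simp add: a_def)
qed

lemma std_module_add:
  fixes x y :: "nat \<Rightarrow> 'h endo"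
  assumes x: "x \<in> std_module" and y: "y \<in> std_module"
  shows "x + y \<in> std_module"
proof -
  have "summable (\<lambda>j. cadjoint (x j + y j) o\<^sub>L (x j + y j))"
  proof (subst summable_Cauchy, intro allI impI)
    fix \<epsilon> :: real assume "\<epsilon> > 0"
    \<comment> \<open>The triangle inequality concerns square roots, and two copies of
      \<open>sqrt (\<epsilon> / 4)\<close> add up to \<open>sqrt \<epsilon>\<close>.\<close>
    then have e4: "\<epsilon> / 4 > 0" by simp
    obtain N1 where N1: "\<And>m n. m \<ge> N1 \<Longrightarrow> norm (gram x {m..<n}) < \<epsilon> / 4"
      using std_moduleD(3)[OF x] e4 unfolding summable_Cauchy by metis
    obtain N2 where N2: "\<And>m n. m \<ge> N2 \<Longrightarrow> norm (gram y {m..<n}) < \<epsilon> / 4"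
      using std_moduleD(3)[OF y] e4 unfolding summable_Cauchy by metis
    have "norm (\<Sum>j=m..<n. cadjoint (x j + y j) o\<^sub>L (x j + y j)) < \<epsilon>" if m: "m \<ge> max N1 N2" for m n
    proof -
      have "sqrt (norm (\<Sum>j=m..<n. cadjoint (x j + y j) o\<^sub>L (x j + y j)))
          \<le> sqrt (norm (gram x {m..<n})) + sqrt (norm (gram y {m..<n}))"
        by (rule sqrt_norm_sum_adjoint_add[OF std_moduleD(2)[OF x] std_moduleD(2)[OF y]])
      also have "\<dots> < sqrt (\<epsilon> / 4) + sqrt (\<epsilon> / 4)"
        using m by (intro add_strict_mono real_sqrt_less_mono N1 N2) simp_all
      also have "\<dots> = sqrt \<epsilon>" by (simp add: real_sqrt_divide)
      finally show ?thesis by simp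
    qed
    then show "\<exists>N. \<forall>m\<ge>N. \<forall>n. norm (\<Sum>j=m..<n. cadjoint (x j + y j) o\<^sub>L (x j + y j)) < \<epsilon>" by blast
  qed
  then show ?thesis
    using std_moduleD(1)[OF x] std_moduleD(1)[OF y] by (simp add: std_module_def compact_ops_add)
qed

lemma module_scaleC:
  fixes x :: "nat \<Rightarrow> 'h endo"
  assumes x: "x \<in> std_module"
  shows "c *\<^sub>C x \<in> std_module" "module_norm (c *\<^sub>C x) = cmod c * module_norm x"
proof -
  have "(\<lambda>j. (cmod c)\<^sup>2 *\<^sub>R (cadjoint (x j) o\<^sub>L x j)) sums ((cmod c)\<^sup>2 *\<^sub>R (\<Sum>j. cadjoint (x j) o\<^sub>L x j))"
    by (intro sums_scaleR_right summable_sums std_moduleD(3)[OF x])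
  then have s: "(\<lambda>j. cadjoint ((c *\<^sub>C x) j) o\<^sub>L (c *\<^sub>C x) j) sums ((cmod c)\<^sup>2 *\<^sub>R (\<Sum>j. cadjoint (x j) o\<^sub>L x j))"
    by (simp only: scaleC_fun_def adjoint_product_scaleC[OF std_moduleD(2)[OF x]])
  show "c *\<^sub>C x \<in> std_module"
    using sums_summable[OF s] std_moduleD(1)[OF x] by (simp add: std_module_def) (simp add: scaleC_fun_def compact_ops_scaleC)
  show "module_norm (c *\<^sub>C x) = cmod c * module_norm x"
    unfolding module_norm_def sums_unique[OF s, symmetric] by (simp add: real_sqrt_mult)
qed

lemma normed_carrier_module: "normed_carrier (std_module :: (nat \<Rightarrow> 'h endo) set) module_norm"
proof
  fix x y :: "nat \<Rightarrow> 'h endo" assume xy: "x \<in> std_module" "y \<in> std_module"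
  show "x + y \<in> std_module" by (rule std_module_add[OF xy])
  show "module_norm (x + y) \<le> module_norm x + module_norm y"
  proof (rule module_norm_le[OF std_module_add[OF xy]])
    fix h n
    have "L2_set (\<lambda>j. norm (((x + y) j) h)) {..<n}
        \<le> L2_set (\<lambda>j. norm (x j h) + norm (y j h)) {..<n}"
      by (rule L2_set_mono) (simp_all add: blinfun.add_left norm_triangle_ineq)
    also have "\<dots> \<le> L2_set (\<lambda>j. norm (x j h)) {..<n} + L2_set (\<lambda>j. norm (y j h)) {..<n}"
      by (rule L2_set_triangle_ineq)
    also have "\<dots> \<le> module_norm x * norm h + module_norm y * norm h"
      by (intro add_mono L2_set_le_module_norm xy)
    finally show "L2_set (\<lambda>j. norm (((x + y) j) h)) {..<n} \<le> (module_norm x + module_norm y) * norm h"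
      by (simp add: distrib_right)
  qed (simp add: module_norm_def)
next
  fix x :: "nat \<Rightarrow> 'h endo" and c assume x: "x \<in> std_module"
  show "c *\<^sub>C x \<in> std_module" "module_norm (c *\<^sub>C x) = cmod c * module_norm x"
    by (rule module_scaleC[OF x])+
next
  fix x :: "nat \<Rightarrow> 'h endo" assume x: "x \<in> std_module" "module_norm x = 0"
  have "(x j) h = 0" for j h
  proof -
    have "norm (x j h) \<le> L2_set (\<lambda>j. norm (x j h)) {..<Suc j}"
      by (rule member_le_L2_set) simp_all
    also have "\<dots> \<le> module_norm x * norm h" by (rule L2_set_le_module_norm[OF x(1)])
    finally show ?thesis using x(2) by simp
  qed
  then show "x = 0" by (intro ext blinfun_eqI) simp
qed

section \<open>The expanding shift of the module and its finite blocks\<close>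

definition fshift :: "(nat \<Rightarrow> 'h endo) \<Rightarrow> (nat \<Rightarrow> 'h endo)" where
  "fshift x j = (case j of 0 \<Rightarrow> 0 | Suc i \<Rightarrow> 4 *\<^sub>C x i)"

lemma fshift_power: "(fshift ^^ n) x j = (if j < n then 0 else 4 ^ n *\<^sub>C x (j - n))"
proof (induction n arbitrary: j)
  case (Suc n)
  then show ?case by (cases j) (auto simp: fshift_def scaleC_scaleC)
qed (simp add: scaleC_one)

lemma fshift_module:
  assumes x: "x \<in> std_module"
  shows "fshift x \<in> std_module" "module_norm (fshift x) = 4 * module_norm x"
proof -
  have "(\<lambda>j. 16 *\<^sub>R (cadjoint (x j) o\<^sub>L x j)) sums (16 *\<^sub>R (\<Sum>j. cadjoint (x j) o\<^sub>L x j))"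
    by (intro sums_scaleR_right summable_sums std_moduleD(3)[OF x])
  moreover have "cadjoint (fshift x (Suc j)) o\<^sub>L fshift x (Suc j) = 16 *\<^sub>R (cadjoint (x j) o\<^sub>L x j)" for j
    using adjoint_product_scaleC[OF std_moduleD(2)[OF x], of 4 j] by (simp add: fshift_def)
  moreover have "cadjoint (fshift x 0) o\<^sub>L fshift x 0 = 0"
    by (rule blinfun_eqI) (simp add: fshift_def cadjoint_zero)
  ultimately have s: "(\<lambda>j. cadjoint (fshift x j) o\<^sub>L fshift x j) sums (16 *\<^sub>R (\<Sum>j. cadjoint (x j) o\<^sub>L x j))"
    using sums_Suc_iff[of "\<lambda>j. cadjoint (fshift x j) o\<^sub>L fshift x j" "16 *\<^sub>R (\<Sum>j. cadjoint (x j) o\<^sub>L x j)"] by simp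
  have "fshift x j \<in> compact_ops" for j
    using std_moduleD(1)[OF x] by (cases j) (simp_all add: fshift_def compact_ops_zero compact_ops_scaleC)
  then show "fshift x \<in> std_module"
    using sums_summable[OF s] by (simp add: std_module_def)
  show "module_norm (fshift x) = 4 * module_norm x"
    unfolding module_norm_def sums_unique[OF s, symmetric] by (simp add: real_sqrt_mult)
qed

lemma std_module_finite:
  assumes "\<And>j. x j \<in> compact_ops" "\<And>j. j \<ge> N \<Longrightarrow> x j = (0 :: 'h endo)"
  shows "x \<in> std_module"
proof -
  have "cadjoint (x j) o\<^sub>L x j = 0" if "j \<notin> {..<N}" for j
    using assms(2)[of j] that by (intro blinfun_eqI) simp
  then have "summable (\<lambda>j. cadjoint (x j) o\<^sub>L x j)"
    by (rule summable_finite[OF finite_lessThan])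
  then show ?thesis using assms(1) by (simp add: std_module_def)
qed

definition mtrunc :: "nat \<Rightarrow> (nat \<Rightarrow> 'h endo) \<Rightarrow> (nat \<Rightarrow> 'h endo)" where
  "mtrunc N x j = (if j < N then x j else 0)"

definition munit :: "nat \<Rightarrow> 'h endo \<Rightarrow> (nat \<Rightarrow> 'h endo)" where
  "munit N A j = (if j = N then A else 0)"

lemma mtrunc_module: "x \<in> std_module \<Longrightarrow> mtrunc N x \<in> std_module"
  by (rule std_module_finite[of _ N]) (simp_all add: mtrunc_def std_moduleD compact_ops_zero)

lemma munit_module: "A \<in> compact_ops \<Longrightarrow> munit N A \<in> std_module"
  by (rule std_module_finite[of _ "Suc N"]) (simp_all add: munit_def compact_ops_zero)

text \<open>The Gram operator of the remainder is exactly a tail of the norm convergent Gram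
  series.\<close>

lemma mtrunc_approx:
  assumes x: "x \<in> std_module"
  shows "(\<lambda>N. module_norm (mtrunc N x - x)) \<longlonglongrightarrow> 0"
proof -
  define g where "g j = cadjoint (x j) o\<^sub>L x j" for j
  have sg: "summable g" unfolding g_def by (rule std_moduleD(3)[OF x])
  have "module_norm (mtrunc N x - x) = sqrt (norm (suminf g - sum g {..<N}))" for N
  proof -
    have "(\<lambda>j. g j - (if j \<in> {..<N} then g j else 0)) sums (suminf g - sum g {..<N})"
      by (intro sums_diff summable_sums[OF sg] sums_If_finite_set) simp
    moreover have "g j - (if j \<in> {..<N} then g j else 0) = cadjoint ((mtrunc N x - x) j) o\<^sub>L (mtrunc N x - x) j" for j
    proof (cases "j < N")
      case False
      then have "(mtrunc N x - x) j = (-1) *\<^sub>C x j" by (simp add: mtrunc_def scaleC_minus_one)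
      then show ?thesis
        using False adjoint_product_scaleC[OF std_moduleD(2)[OF x], of "-1" j] by (simp only: g_def) simp
    next
      case True
      then have "(mtrunc N x - x) j = 0" by (simp add: mtrunc_def)
      then show ?thesis using True by (intro blinfun_eqI) simp
    qed
    ultimately have "(\<lambda>j. cadjoint ((mtrunc N x - x) j) o\<^sub>L (mtrunc N x - x) j) sums (suminf g - sum g {..<N})"
      by simp
    then show ?thesis unfolding module_norm_def by (simp only: sums_unique[symmetric])
  qed
  moreover have "(\<lambda>N. sqrt (norm (suminf g - sum g {..<N}))) \<longlonglongrightarrow> sqrt (norm (suminf g - suminf g))"
    by (intro tendsto_real_sqrt tendsto_norm tendsto_diff tendsto_const summable_LIMSEQ[OF sg])
  ultimately show ?thesis by simp
qed

lemma module_norm_munit: "module_norm (munit N A) = sqrt (norm (cadjoint A o\<^sub>L A))"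
proof -
  have "(\<lambda>j. cadjoint (munit N A j) o\<^sub>L munit N A j) = (\<lambda>j. if j = N then cadjoint A o\<^sub>L A else 0)"
    by (intro ext blinfun_eqI) (simp add: munit_def)
  then have "(\<lambda>j. cadjoint (munit N A j) o\<^sub>L munit N A j) sums (cadjoint A o\<^sub>L A)"
    using sums_single[of N "\<lambda>_. cadjoint A o\<^sub>L A"] by simp
  then show ?thesis unfolding module_norm_def by (simp only: sums_unique[symmetric])
qed

text \<open>Here orthogonality is disjointness of supports: \<open>n + N\<close> is the only index
  at which both sequences can be nonzero.\<close>

lemma module_product_shift_power:
  assumes F: "F \<in> clinear_ops" and N: "N \<le> n"
  shows "module_product ((fshift ^^ n) (of_real c *\<^sub>C mtrunc N x + of_real a *\<^sub>C munit N E))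
      (of_real d *\<^sub>C mtrunc N y + of_real b *\<^sub>C munit (n + N) F)
    = of_real (4 ^ n * a * b) *\<^sub>C op_product E F"
proof -
  define u where "u = (fshift ^^ n) (of_real c *\<^sub>C mtrunc N x + of_real a *\<^sub>C munit N E)"
  define v where "v = of_real d *\<^sub>C mtrunc N y + of_real b *\<^sub>C munit (n + N) F"
  have "cadjoint (v j) o\<^sub>L u j = (if j = n + N then of_real (4 ^ n * a * b) *\<^sub>C op_product E F else 0)" for j
  proof (cases "j = n + N")
    case True
    have "u j = (4 ^ n * complex_of_real a) *\<^sub>C E" "v j = of_real b *\<^sub>C F"
      using True N by (simp_all add: u_def v_def fshift_power scaleC_fun_def mtrunc_def munit_def scaleC_scaleC)
    then show ?thesis using True
      by (intro blinfun_eqI) (simp add: op_product_def cadjoint_scaleC[OF F] scaleC_scaleC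
          clinear_opsD[OF cadjoint_clinear[OF F]] mult_ac)
  next
    case False
    have "u j = 0 \<or> v j = 0"
      using False N by (auto simp: u_def v_def fshift_power scaleC_fun_def mtrunc_def munit_def)
    then show ?thesis using False by (auto intro!: blinfun_eqI simp: cadjoint_zero)
  qed
  then have "(\<lambda>j. cadjoint (v j) o\<^sub>L u j) sums (of_real (4 ^ n * a * b) *\<^sub>C op_product E F)"
    using sums_single[of "n + N" "\<lambda>_. of_real (4 ^ n * a * b) *\<^sub>C op_product E F"] by simp
  then show ?thesis
    unfolding module_product_def u_def v_def by (rule sums_unique[symmetric])
qed

lemma module_cstar_transitive:
  "cstar_transitive std_module module_norm compact_ops norm module_product fshift"
proof (rule cstar_transitive_criterion[where P = mtrunc and Y = compact_ops and \<psi> = op_product and J = munit])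
  show "module_product ((fshift ^^ n) (of_real c *\<^sub>C mtrunc N x + of_real a *\<^sub>C munit N E))
      (of_real d *\<^sub>C mtrunc N y + of_real b *\<^sub>C munit (n + N) F)
    = of_real (4 ^ n * a * b) *\<^sub>C op_product E F"
    if "x \<in> std_module" "y \<in> std_module" "E \<in> compact_ops" "F \<in> compact_ops" "N \<le> n"
    for x y :: "nat \<Rightarrow> 'h endo" and E F N n a b c d
    using that by (intro module_product_shift_power compact_ops_clinear)
  show "\<exists>K. \<forall>N. module_norm (munit N E) \<le> K" for E
    by (rule exI[of _ "sqrt (norm (cadjoint E o\<^sub>L E))"]) (simp add: module_norm_munit)
qed (simp_all add: normed_carrier_module normed_carrier_compact_ops mtrunc_module munit_module mtrunc_approx
    op_product_scaled_compact)

lemma module_example: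
  "\<exists>T :: (nat \<Rightarrow> 'h endo) \<Rightarrow> (nat \<Rightarrow> 'h endo).
     bounded_op std_module module_norm T \<and>
     cstar_transitive std_module module_norm compact_ops norm module_product T \<and>
     \<not> Li_Yorke_chaotic std_module module_norm T \<and>
     \<not> distributionally_chaotic_3 std_module module_norm T"
proof -
  interpret M: normed_carrier "std_module :: (nat \<Rightarrow> 'h endo) set" module_norm
    by (rule normed_carrier_module)
  have "fshift (x + y) = fshift x + fshift y" for x y
    by (rule ext) (simp add: fshift_def scaleC_add_right split: nat.split)
  moreover have "fshift (c *\<^sub>C x) = c *\<^sub>C fshift x" for c x
    by (rule ext) (simp add: fshift_def scaleC_fun_def scaleC_scaleC mult.commute split: nat.split)
  ultimately show ?thesis
    using M.expanding_operator[of fshift] fshift_module module_cstar_transitive by (intro exI[of _ fshift] conjI; simp)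
qed

end

section \<open>Dual spaces and states\<close>

context normed_carrier
begin

lemma zero_in_carrier: "x \<in> X \<Longrightarrow> 0 \<in> X"
  using scaleC_closed[of x 0] by simp

lemma dual_spaceD:
  assumes "f \<in> dual_space X nrm"
  shows "x \<in> X \<Longrightarrow> y \<in> X \<Longrightarrow> f (x + y) = f x + f y" "x \<in> X \<Longrightarrow> f (c *\<^sub>C x) = c * f x"
    "x \<notin> X \<Longrightarrow> f x = 0"
  using assms by (simp_all add: dual_space_def bounded_clinear_on_def scaleC_complex_def)

lemma dual_norm_bdd:
  assumes "f \<in> dual_space X nrm"
  shows "bdd_above ((\<lambda>x. norm (f x)) ` {x \<in> X. nrm x \<le> 1})"
proof -
  obtain K where K: "\<And>x. x \<in> X \<Longrightarrow> norm (f x) \<le> K * nrm x"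
    using assms unfolding dual_space_def bounded_clinear_on_def by blast
  show ?thesis
  proof (rule bdd_aboveI2[of _ _ "max K 0"])
    fix x assume x: "x \<in> {x \<in> X. nrm x \<le> 1}"
    then have "norm (f x) \<le> K * nrm x" using K by simp
    also have "\<dots> \<le> max K 0 * 1"
      using x nrm_nonneg by (intro mult_mono) auto
    finally show "norm (f x) \<le> max K 0" by simp
  qed
qed

lemma dual_norm_bound:
  assumes f: "f \<in> dual_space X nrm" and x: "x \<in> X"
  shows "cmod (f x) \<le> dual_norm X nrm f * nrm x"
proof (cases "x = 0")
  case True
  have "f 0 = 0" using dual_spaceD(2)[OF f x, of 0] by simp
  then show ?thesis using True nrm_zero[OF x] by simp
next
  case False
  then have p: "nrm x > 0" using nrm_nonneg[OF x] nrm_eq_0[OF x] by (metis order_le_less)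
  define u where "u = of_real (inverse (nrm x)) *\<^sub>C x"
  have u: "u \<in> X" "nrm u = 1"
    using p by (simp_all add: u_def x scaleC_closed nrm_scaleC norm_inverse)
  have "cmod (f u) \<le> dual_norm X nrm f"
    unfolding dual_norm_def using u by (intro cSUP_upper2[OF dual_norm_bdd[OF f], of u]) auto
  then show ?thesis using p
    by (simp add: u_def dual_spaceD(2)[OF f x] norm_mult norm_divide field_simps)
qed

lemma dual_norm_le:
  assumes "x0 \<in> X" "0 \<le> K" "\<And>x. x \<in> X \<Longrightarrow> cmod (f x) \<le> K * nrm x"
  shows "dual_norm X nrm f \<le> K"
  unfolding dual_norm_def
proof (rule cSUP_least)
  show "{x \<in> X. nrm x \<le> 1} \<noteq> {}"
    using zero_in_carrier[OF assms(1)] nrm_zero[OF assms(1)] by force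
  fix x assume x: "x \<in> {x \<in> X. nrm x \<le> 1}"
  then have "cmod (f x) \<le> K * nrm x" using assms(3) by simp
  also have "\<dots> \<le> K * 1" using x assms(2) by (intro mult_left_mono) auto
  finally show "norm (f x) \<le> K" by simp
qed

lemma dual_norm_nonneg:
  assumes "f \<in> dual_space X nrm" "x0 \<in> X"
  shows "0 \<le> dual_norm X nrm f"
proof -
  have "0 \<in> {x \<in> X. nrm x \<le> 1}" using zero_in_carrier[OF assms(2)] nrm_zero[OF assms(2)] by simp
  then show ?thesis unfolding dual_norm_def
    by (rule cSUP_upper2[OF dual_norm_bdd[OF assms(1)]]) simp
qed

lemma dual_space_diff:
  assumes f: "f \<in> dual_space X nrm" and g: "g \<in> dual_space X nrm"
  shows "f - g \<in> dual_space X nrm"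
proof -
  have "cmod ((f - g) x) \<le> (dual_norm X nrm f + dual_norm X nrm g) * nrm x" if "x \<in> X" for x
    using norm_triangle_ineq4[of "f x" "g x"] dual_norm_bound[OF f that] dual_norm_bound[OF g that]
    by (simp add: distrib_right)
  then have "\<exists>K. \<forall>x\<in>X. cmod ((f - g) x) \<le> K * nrm x" by blast
  then show ?thesis
    unfolding dual_space_def bounded_clinear_on_def
    by (simp add: dual_spaceD[OF f] dual_spaceD[OF g] scaleC_complex_def algebra_simps)
qed

lemma dual_norm_triangle:
  assumes f: "f \<in> dual_space X nrm" and g: "g \<in> dual_space X nrm" and h: "h \<in> dual_space X nrm" and x0: "x0 \<in> X"
  shows "dual_norm X nrm (f - h) \<le> dual_norm X nrm (f - g) + dual_norm X nrm (g - h)"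
proof (rule dual_norm_le[OF x0])
  fix x assume x: "x \<in> X"
  have "cmod ((f - h) x) \<le> cmod ((f - g) x) + cmod ((g - h) x)"
    using norm_triangle_ineq[of "(f - g) x" "(g - h) x"] by simp
  also have "\<dots> \<le> dual_norm X nrm (f - g) * nrm x + dual_norm X nrm (g - h) * nrm x"
    by (intro add_mono dual_norm_bound dual_space_diff f g h x)
  finally show "cmod ((f - h) x) \<le> (dual_norm X nrm (f - g) + dual_norm X nrm (g - h)) * nrm x"
    by (simp add: distrib_right)
qed (intro add_nonneg_nonneg dual_norm_nonneg[OF _ x0] dual_space_diff f g h)

lemma dual_norm_diff_commute: "dual_norm X nrm (f - g) = dual_norm X nrm (g - f)"
  by (simp add: dual_norm_def norm_minus_commute)

lemma dual_norm_diff_eq_0: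
  assumes f: "f \<in> dual_space X nrm" and g: "g \<in> dual_space X nrm" and 0: "dual_norm X nrm (f - g) = 0"
  shows "f = g"
proof
  fix x
  show "f x = g x"
  proof (cases "x \<in> X")
    case True
    show ?thesis using dual_norm_bound[OF dual_space_diff[OF f g] True] 0 by simp
  qed (simp add: dual_spaceD(3)[OF f] dual_spaceD(3)[OF g])
qed

text \<open>Openness in \<open>norm_topology\<close> unfolds into balls only once the distance is
  known to be a metric. Pairs of a vector and a functional are outside the scope of
  \<open>Metric_space_carrier\<close>, so the axioms are checked by components.\<close>

lemma Metric_space_states:
  "Metric_space (Pi_states X nrm) (\<lambda>p q. if p \<in> Pi_states X nrm \<and> q \<in> Pi_states X nrm
     then (\<lambda>(x, f). max (nrm x) (dual_norm X nrm f)) (p - q) else 0)"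
proof -
  define S where "S = Pi_states X nrm"
  define m where "m p q = max (nrm (fst p - fst q)) (dual_norm X nrm (snd p - snd q))" for p q
  have eq: "(\<lambda>(x, f). max (nrm x) (dual_norm X nrm f)) (p - q) = m p q" for p q
    by (simp add: m_def case_prod_beta)
  have S: "fst p \<in> X" "snd p \<in> dual_space X nrm" if "p \<in> S" for p
    using that by (auto simp: S_def Pi_states_def unit_sphere_def)
  have "Metric_space S (\<lambda>p q. if p \<in> S \<and> q \<in> S then m p q else 0)"
  proof
    show "0 \<le> (if p \<in> S \<and> q \<in> S then m p q else 0)" for p q
      using S by (simp add: m_def le_max_iff_disj nrm_nonneg diff_closed)
    show "(if p \<in> S \<and> q \<in> S then m p q else 0) = (if q \<in> S \<and> p \<in> S then m q p else 0)" for p q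
      using S nrm_diff_commute[of "fst p" "fst q"] dual_norm_diff_commute[of "snd p" "snd q"]
      by (auto simp: m_def)
    show "(if p \<in> S \<and> q \<in> S then m p q else 0) = 0 \<longleftrightarrow> p = q" if "p \<in> S" "q \<in> S" for p q
    proof
      assume "(if p \<in> S \<and> q \<in> S then m p q else 0) = 0"
      then have "m p q = 0" using that by simp
      then have "nrm (fst p - fst q) \<le> 0" "dual_norm X nrm (snd p - snd q) \<le> 0"
        unfolding m_def by linarith+
      then have "nrm (fst p - fst q) = 0" "dual_norm X nrm (snd p - snd q) = 0"
        using nrm_nonneg[OF diff_closed[OF S(1)[OF that(1)] S(1)[OF that(2)]]]
          dual_norm_nonneg[OF dual_space_diff[OF S(2)[OF that(1)] S(2)[OF that(2)]] S(1)[OF that(1)]]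
        by linarith+
      then show "p = q"
        using nrm_eq_0[OF diff_closed[OF S(1)[OF that(1)] S(1)[OF that(2)]]]
          dual_norm_diff_eq_0[OF S(2)[OF that(1)] S(2)[OF that(2)]] by (simp add: prod_eq_iff)
    next
      assume "p = q"
      moreover have "dual_norm X nrm 0 \<le> 0"
        by (rule dual_norm_le[OF S(1)[OF that(1)]]) simp_all
      moreover have "0 \<le> dual_norm X nrm (snd p - snd p)"
        by (rule dual_norm_nonneg[OF dual_space_diff[OF S(2)[OF that(1)] S(2)[OF that(1)]] S(1)[OF that(1)]])
      ultimately show "(if p \<in> S \<and> q \<in> S then m p q else 0) = 0"
        using nrm_zero[OF S(1)[OF that(1)]] by (simp add: m_def)
    qed
    show "(if p \<in> S \<and> r \<in> S then m p r else 0)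
        \<le> (if p \<in> S \<and> q \<in> S then m p q else 0) + (if q \<in> S \<and> r \<in> S then m q r else 0)"
      if "p \<in> S" "q \<in> S" "r \<in> S" for p q r
    proof -
      have "nrm (fst p - fst r) \<le> nrm (fst p - fst q) + nrm (fst q - fst r)"
        using nrm_triangle[OF diff_closed diff_closed, of "fst p" "fst q" "fst q" "fst r"] S(1) that by simp
      moreover have "dual_norm X nrm (snd p - snd r) \<le> dual_norm X nrm (snd p - snd q) + dual_norm X nrm (snd q - snd r)"
        by (intro dual_norm_triangle[OF _ _ _ S(1)[OF that(1)]] S(2) that)
      ultimately have "m p r \<le> m p q + m q r" unfolding m_def by linarith
      then show ?thesis using that by simp
    qed
  qed
  then show ?thesis by (simp only: eq S_def[symmetric])
qed

end

section \<open>The sequence space\<close>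

lemma ell2D: "x \<in> ell2 \<Longrightarrow> summable (\<lambda>j. (cmod (x j))\<^sup>2)"
  by (simp add: ell2_def)

lemma ell2_norm_square: "x \<in> ell2 \<Longrightarrow> (ell2_norm x)\<^sup>2 = (\<Sum>j. (cmod (x j))\<^sup>2)"
  by (simp add: ell2_norm_def suminf_nonneg ell2D)

lemma ell2_norm_nonneg: "x \<in> ell2 \<Longrightarrow> 0 \<le> ell2_norm x"
  by (simp add: ell2_norm_def suminf_nonneg ell2D)

lemma L2_set_le_ell2_norm:
  assumes "x \<in> ell2"
  shows "L2_set (\<lambda>j. cmod (x j)) {..<n} \<le> ell2_norm x"
  unfolding L2_set_def ell2_norm_def
  by (intro real_sqrt_le_mono sum_le_suminf ell2D assms) auto

lemma ell2_intro:
  assumes "0 \<le> K" and le: "\<And>n. L2_set (\<lambda>j. cmod (x j)) {..<n} \<le> K"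
  shows "x \<in> ell2" "ell2_norm x \<le> K"
proof -
  have le': "(\<Sum>j<n. (cmod (x j))\<^sup>2) \<le> K\<^sup>2" for n
    using le[of n] unfolding L2_set_def by (rule sqrt_le_D)
  have s: "summable (\<lambda>j. (cmod (x j))\<^sup>2)"
    by (rule summableI_nonneg_bounded[OF _ le']) simp
  then show "x \<in> ell2" by (simp add: ell2_def)
  have "(\<Sum>j. (cmod (x j))\<^sup>2) \<le> K\<^sup>2" by (rule suminf_le_const[OF s le'])
  then show "ell2_norm x \<le> K"
    unfolding ell2_norm_def by (rule real_le_lsqrt[OF assms(1)])
qed

lemma ell2_finite:
  assumes "\<And>j. j \<ge> N \<Longrightarrow> x j = (0::complex)"
  shows "x \<in> ell2"
proof -
  have "(cmod (x j))\<^sup>2 = 0" if "j \<notin> {..<N}" for j using assms[of j] that by simp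
  from summable_finite[OF finite_lessThan this] show ?thesis by (simp add: ell2_def)
qed

interpretation ell2: normed_carrier ell2 ell2_norm
proof
  fix x y :: "nat \<Rightarrow> complex" assume xy: "x \<in> ell2" "y \<in> ell2"
  have "L2_set (\<lambda>j. cmod ((x + y) j)) {..<n} \<le> ell2_norm x + ell2_norm y" for n
  proof -
    have "L2_set (\<lambda>j. cmod ((x + y) j)) {..<n} \<le> L2_set (\<lambda>j. cmod (x j) + cmod (y j)) {..<n}"
      by (rule L2_set_mono) (simp_all add: norm_triangle_ineq)
    also have "\<dots> \<le> L2_set (\<lambda>j. cmod (x j)) {..<n} + L2_set (\<lambda>j. cmod (y j)) {..<n}"
      by (rule L2_set_triangle_ineq)
    also have "\<dots> \<le> ell2_norm x + ell2_norm y" by (intro add_mono L2_set_le_ell2_norm xy)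
    finally show ?thesis .
  qed
  from ell2_intro[where x = "x + y", OF _ this] show "x + y \<in> ell2" "ell2_norm (x + y) \<le> ell2_norm x + ell2_norm y"
    using ell2_norm_nonneg xy by simp_all
next
  fix x :: "nat \<Rightarrow> complex" and c assume x: "x \<in> ell2"
  show "c *\<^sub>C x \<in> ell2"
    using ell2D[OF x] by (simp add: ell2_def scaleC_fun_def scaleC_complex_def norm_mult power_mult_distrib summable_mult)
  show "ell2_norm (c *\<^sub>C x) = cmod c * ell2_norm x"
    by (simp add: ell2_norm_def scaleC_fun_def scaleC_complex_def norm_mult power_mult_distrib
        suminf_mult[OF ell2D[OF x]] real_sqrt_mult)
next
  fix x :: "nat \<Rightarrow> complex" assume x: "x \<in> ell2" "ell2_norm x = 0"
  have "x j = 0" for j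
  proof -
    have "cmod (x j) \<le> L2_set (\<lambda>j. cmod (x j)) {..<Suc j}"
      by (rule member_le_L2_set) simp_all
    also have "\<dots> \<le> ell2_norm x" by (rule L2_set_le_ell2_norm[OF x(1)])
    finally show ?thesis using x(2) by simp
  qed
  then show "x = 0" by (simp add: fun_eq_iff)
qed

section \<open>Inner product and states of the sequence space\<close>

definition ell2_inner :: "(nat \<Rightarrow> complex) \<Rightarrow> (nat \<Rightarrow> complex) \<Rightarrow> complex" where
  "ell2_inner x y = (\<Sum>j. x j * cnj (y j))"

lemma ell2_inner_finite_le:
  assumes "x \<in> ell2" "y \<in> ell2"
  shows "(\<Sum>j<n. cmod (x j * cnj (y j))) \<le> ell2_norm x * ell2_norm y"
proof -
  have "(\<Sum>j<n. cmod (x j * cnj (y j))) = (\<Sum>j<n. \<bar>cmod (x j)\<bar> * \<bar>cmod (y j)\<bar>)"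
    by (simp add: norm_mult)
  also have "\<dots> \<le> L2_set (\<lambda>j. cmod (x j)) {..<n} * L2_set (\<lambda>j. cmod (y j)) {..<n}"
    by (rule L2_set_mult_ineq)
  also have "\<dots> \<le> ell2_norm x * ell2_norm y"
    by (intro mult_mono L2_set_le_ell2_norm assms L2_set_nonneg ell2_norm_nonneg)
  finally show ?thesis .
qed

lemma ell2_inner_summable:
  assumes "x \<in> ell2" "y \<in> ell2"
  shows "summable (\<lambda>j. cmod (x j * cnj (y j)))" "summable (\<lambda>j. x j * cnj (y j))"
proof -
  show s: "summable (\<lambda>j. cmod (x j * cnj (y j)))"
    by (rule summableI_nonneg_bounded[OF _ ell2_inner_finite_le[OF assms]]) simp
  then show "summable (\<lambda>j. x j * cnj (y j))" by (rule summable_norm_cancel)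
qed

lemma ell2_Cauchy_Schwarz:
  assumes "x \<in> ell2" "y \<in> ell2"
  shows "cmod (ell2_inner x y) \<le> ell2_norm x * ell2_norm y"
proof -
  have "cmod (ell2_inner x y) \<le> (\<Sum>j. cmod (x j * cnj (y j)))"
    unfolding ell2_inner_def by (rule summable_norm[OF ell2_inner_summable(1)[OF assms]])
  also have "\<dots> \<le> ell2_norm x * ell2_norm y"
    by (rule suminf_le_const[OF ell2_inner_summable(1)[OF assms] ell2_inner_finite_le[OF assms]])
  finally show ?thesis .
qed

lemma ell2_inner_add_left:
  assumes "x \<in> ell2" "y \<in> ell2" "z \<in> ell2"
  shows "ell2_inner (x + y) z = ell2_inner x z + ell2_inner y z"
  unfolding ell2_inner_def
  using suminf_add[OF ell2_inner_summable(2)[OF assms(1,3)] ell2_inner_summable(2)[OF assms(2,3)]]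
  by (simp add: distrib_right)

lemma ell2_inner_add_right:
  assumes "x \<in> ell2" "y \<in> ell2" "z \<in> ell2"
  shows "ell2_inner z (x + y) = ell2_inner z x + ell2_inner z y"
  unfolding ell2_inner_def
  using suminf_add[OF ell2_inner_summable(2)[OF assms(3,1)] ell2_inner_summable(2)[OF assms(3,2)]]
  by (simp add: distrib_left)

lemma ell2_inner_diff_right:
  assumes "x \<in> ell2" "y \<in> ell2" "z \<in> ell2"
  shows "ell2_inner z (x - y) = ell2_inner z x - ell2_inner z y"
  unfolding ell2_inner_def
  using suminf_diff[OF ell2_inner_summable(2)[OF assms(3,1)] ell2_inner_summable(2)[OF assms(3,2)]]
  by (simp add: right_diff_distrib)

lemma ell2_inner_scaleC:
  assumes "x \<in> ell2" "y \<in> ell2"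
  shows "ell2_inner (c *\<^sub>C x) y = c * ell2_inner x y" "ell2_inner x (c *\<^sub>C y) = cnj c * ell2_inner x y"
  using suminf_mult[OF ell2_inner_summable(2)[OF assms], of c]
    suminf_mult[OF ell2_inner_summable(2)[OF assms], of "cnj c"]
  by (simp_all add: ell2_inner_def scaleC_fun_def scaleC_complex_def mult_ac)

lemma ell2_inner_self:
  assumes "x \<in> ell2"
  shows "ell2_inner x x = complex_of_real ((ell2_norm x)\<^sup>2)"
proof -
  have "ell2_inner x x = (\<Sum>j. complex_of_real ((cmod (x j))\<^sup>2))"
    unfolding ell2_inner_def by (simp only: complex_norm_square)
  also have "\<dots> = complex_of_real (\<Sum>j. (cmod (x j))\<^sup>2)"
    by (rule suminf_of_real[OF ell2D[OF assms], symmetric])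
  finally show ?thesis by (simp only: ell2_norm_square[OF assms])
qed

text \<open>The value 0 off \<open>ell2\<close> follows the convention of \<open>dual_space\<close>,
  so that a state can equal this functional as a function.\<close>

definition ell2_functional :: "(nat \<Rightarrow> complex) \<Rightarrow> (nat \<Rightarrow> complex) \<Rightarrow> complex" where
  "ell2_functional x z = (if z \<in> ell2 then ell2_inner z x else 0)"

lemma ell2_functional_dual:
  assumes x: "x \<in> ell2"
  shows "ell2_functional x \<in> dual_space ell2 ell2_norm"
proof -
  have "\<exists>K. \<forall>z\<in>ell2. cmod (ell2_functional x z) \<le> K * ell2_norm z"
    by (rule exI[of _ "ell2_norm x"])
      (simp add: ell2_functional_def ell2_Cauchy_Schwarz x mult.commute[of "ell2_norm x"])
  then show ?thesis
    unfolding dual_space_def bounded_clinear_on_def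
    by (simp add: ell2_functional_def ell2_inner_add_left ell2_inner_scaleC x ell2.add_closed ell2.scaleC_closed
        scaleC_complex_def)
qed

text \<open>Closeness of vectors thus controls both components of the metric on states.\<close>

lemma dual_norm_ell2_functional_diff_le:
  assumes "x \<in> ell2" "y \<in> ell2"
  shows "dual_norm ell2 ell2_norm (ell2_functional x - ell2_functional y) \<le> ell2_norm (x - y)"
proof (rule ell2.dual_norm_le[OF assms(1)])
  show "0 \<le> ell2_norm (x - y)" by (intro ell2_norm_nonneg ell2.diff_closed assms)
  fix z assume z: "z \<in> ell2"
  then have "(ell2_functional x - ell2_functional y) z = ell2_inner z (x - y)"
    by (simp add: ell2_functional_def ell2_inner_diff_right assms)
  then show "cmod ((ell2_functional x - ell2_functional y) z) \<le> ell2_norm (x - y) * ell2_norm z"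
    using ell2_Cauchy_Schwarz[OF z ell2.diff_closed[OF assms]] by (simp add: mult.commute)
qed

lemma ell2_functional_state:
  assumes x: "x \<in> ell2" "ell2_norm x = 1"
  shows "(x, ell2_functional x) \<in> Pi_states ell2 ell2_norm"
proof -
  have 1: "ell2_functional x x = 1" using x by (simp add: ell2_functional_def ell2_inner_self)
  have "dual_norm ell2 ell2_norm (ell2_functional x) \<le> 1"
    by (rule ell2.dual_norm_le[OF x(1)])
      (use x ell2_Cauchy_Schwarz[OF _ x(1)] in \<open>simp_all add: ell2_functional_def\<close>)
  moreover have "1 \<le> dual_norm ell2 ell2_norm (ell2_functional x)"
    using ell2.dual_norm_bound[OF ell2_functional_dual[OF x(1)] x(1)] by (simp add: 1 x)
  ultimately show ?thesis
    using x 1 ell2_functional_dual[OF x(1)] by (simp add: Pi_states_def unit_sphere_def)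
qed

text \<open>If \<open>z\<close> is orthogonal to \<open>x\<close>, then \<open>\<bar>1 + t f z\<bar>\<^sup>2 \<le> \<parallel>x + t z\<parallel>\<^sup>2 = 1 + \<bar>t\<bar>\<^sup>2 \<parallel>z\<parallel>\<^sup>2\<close> for
  all \<open>t\<close>, which for small \<open>t\<close> forces \<open>f z = 0\<close>.\<close>

lemma ell2_state_unique:
  assumes "(x, f) \<in> Pi_states ell2 ell2_norm"
  shows "f = ell2_functional x"
proof
  fix z
  have x: "x \<in> ell2" "ell2_norm x = 1" and f: "f \<in> dual_space ell2 ell2_norm" and fn: "dual_norm ell2 ell2_norm f = 1"
    and fx: "f x = 1"
    using assms by (auto simp: Pi_states_def unit_sphere_def)
  note fl = ell2.dual_spaceD[OF f]
  have orth: "f w = 0" if w: "w \<in> ell2" "ell2_inner w x = 0" for w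
  proof (rule ccontr)
    assume "f w \<noteq> 0"
    define p where "p = (cmod (f w))\<^sup>2"
    define q where "q = (ell2_norm w)\<^sup>2"
    have p: "p > 0" using \<open>f w \<noteq> 0\<close> by (simp add: p_def)
    have q: "q \<ge> 0" by (simp add: q_def)
    \<comment> \<open>The choice gives \<open>s * q \<le> 1\<close>, which contradicts the later
      \<open>2 + s * p \<le> s * q\<close>. Taking \<open>t\<close> along \<open>cnj (f w)\<close>
      makes \<open>t * f w\<close> the positive number \<open>s * p\<close>.\<close>
    define s where "s = inverse (q + 1)"
    have s: "s > 0" using q by (simp add: s_def)
    define t where "t = complex_of_real s * cnj (f w)"
    have tw: "t *\<^sub>C w \<in> ell2" by (rule ell2.scaleC_closed[OF w(1)])
    have tf: "t * f w = complex_of_real (s * p)"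
      by (simp add: t_def p_def complex_norm_square mult_ac del: of_real_power)
    have t2: "(cmod t)\<^sup>2 = s\<^sup>2 * p"
      using s by (simp add: t_def p_def norm_mult power_mult_distrib)
    have "ell2_inner x w = cnj (ell2_inner w x)"
    proof -
      have "cnj (ell2_inner w x) = (\<Sum>j. cnj (w j * cnj (x j)))"
        unfolding ell2_inner_def
        by (rule bounded_linear.suminf[OF bounded_linear_cnj ell2_inner_summable(2)[OF w(1) x(1)]])
      then show ?thesis by (simp add: ell2_inner_def mult.commute)
    qed
    then have xw: "ell2_inner x w = 0" using w by simp
    have n: "(ell2_norm (x + t *\<^sub>C w))\<^sup>2 = 1 + s\<^sup>2 * p * q"
    proof -
      have "ell2_inner (x + t *\<^sub>C w) (x + t *\<^sub>C w) = ell2_inner x (x + t *\<^sub>C w) + t * ell2_inner w (x + t *\<^sub>C w)"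
        by (simp add: ell2_inner_add_left ell2_inner_scaleC x w tw ell2.add_closed)
      also have "ell2_inner x (x + t *\<^sub>C w) = 1"
        by (simp add: ell2_inner_add_right[OF x(1) tw x(1)] ell2_inner_scaleC x w xw ell2_inner_self)
      also have "ell2_inner w (x + t *\<^sub>C w) = cnj t * ell2_inner w w"
        by (simp add: ell2_inner_add_right[OF x(1) tw w(1)] ell2_inner_scaleC w)
      also have "t * (cnj t * ell2_inner w w) = complex_of_real ((cmod t)\<^sup>2 * q)"
        by (simp add: ell2_inner_self[OF w(1)] complex_norm_square q_def del: of_real_power)
      finally have "complex_of_real ((ell2_norm (x + t *\<^sub>C w))\<^sup>2) = complex_of_real (1 + (cmod t)\<^sup>2 * q)"
        by (simp only: ell2_inner_self[OF ell2.add_closed[OF x(1) tw], symmetric]) simp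
      then show ?thesis unfolding of_real_eq_iff t2 .
    qed
    have "cmod (f (x + t *\<^sub>C w)) \<le> ell2_norm (x + t *\<^sub>C w)"
      using ell2.dual_norm_bound[OF f ell2.add_closed[OF x(1) tw]] by (simp add: fn)
    moreover have "f (x + t *\<^sub>C w) = complex_of_real (1 + s * p)"
      by (simp add: fl(1)[OF x(1) tw] fl(2)[OF w(1)] fx tf)
    ultimately have "\<bar>1 + s * p\<bar> \<le> ell2_norm (x + t *\<^sub>C w)" by (simp only: norm_of_real)
    then have "(1 + s * p)\<^sup>2 \<le> 1 + s\<^sup>2 * p * q"
      unfolding n[symmetric] using p s by (intro power_mono) auto
    then have "(s * p) * (2 + s * p) \<le> (s * p) * (s * q)"
      by (simp add: power2_eq_square algebra_simps)
    then have "2 + s * p \<le> s * q" using p s by simp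
    moreover have "s * q \<le> 1" using q by (simp add: s_def field_simps)
    ultimately show False using p s by (smt (verit) mult_pos_pos)
  qed
  show "f z = ell2_functional x z"
  proof (cases "z \<in> ell2")
    case True
    define c where "c = ell2_inner z x"
    have cx: "c *\<^sub>C x \<in> ell2" by (rule ell2.scaleC_closed[OF x(1)])
    have w: "z + (- c) *\<^sub>C x \<in> ell2" by (intro ell2.add_closed ell2.scaleC_closed True x)
    have "ell2_inner (z + (- c) *\<^sub>C x) x = 0"
      by (subst ell2_inner_add_left[OF True ell2.scaleC_closed[OF x(1)] x(1)])
        (simp only: ell2_inner_scaleC[OF x(1) x(1)] ell2_inner_self[OF x(1)] x(2), simp add: c_def)
    from orth[OF w this] have "f z + (- c) * f x = 0"
      by (simp only: fl(1)[OF True ell2.scaleC_closed[OF x(1)]] fl(2)[OF x(1)])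
    then show ?thesis using True by (simp add: fx c_def ell2_functional_def)
  qed (simp add: fl(3) ell2_functional_def)
qed

section \<open>The expanding shift of the sequence space\<close>

definition ell2_shift :: "(nat \<Rightarrow> complex) \<Rightarrow> (nat \<Rightarrow> complex)" where
  "ell2_shift x j = (case j of 0 \<Rightarrow> 0 | Suc i \<Rightarrow> 4 * x i)"

lemma ell2_shift_power: "(ell2_shift ^^ n) x j = (if j < n then 0 else 4 ^ n * x (j - n))"
proof (induction n arbitrary: j)
  case (Suc n)
  then show ?case by (cases j) (auto simp: ell2_shift_def)
qed simp

lemma ell2_shift_ell2:
  assumes x: "x \<in> ell2"
  shows "ell2_shift x \<in> ell2" "ell2_norm (ell2_shift x) = 4 * ell2_norm x"
proof -
  have "(\<lambda>j. 16 * (cmod (x j))\<^sup>2) sums (16 * (\<Sum>j. (cmod (x j))\<^sup>2))"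
    by (intro sums_mult summable_sums ell2D x)
  then have s: "(\<lambda>j. (cmod (ell2_shift x j))\<^sup>2) sums (16 * (\<Sum>j. (cmod (x j))\<^sup>2))"
    using sums_Suc_iff[of "\<lambda>j. (cmod (ell2_shift x j))\<^sup>2" "16 * (\<Sum>j. (cmod (x j))\<^sup>2)"]
    by (simp add: ell2_shift_def norm_mult power_mult_distrib)
  then show "ell2_shift x \<in> ell2" by (simp add: ell2_def sums_summable)
  show "ell2_norm (ell2_shift x) = 4 * ell2_norm x"
    unfolding ell2_norm_def sums_unique[OF s, symmetric] by (simp add: real_sqrt_mult)
qed

lemma ell2_trunc_approx:
  assumes x: "x \<in> ell2"
  shows "(\<lambda>N. ell2_norm ((\<lambda>j. if j < N then x j else 0) - x)) \<longlonglongrightarrow> 0"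
proof -
  define g where "g j = (cmod (x j))\<^sup>2" for j
  have sg: "summable g" unfolding g_def by (rule ell2D[OF x])
  have "ell2_norm ((\<lambda>j. if j < N then x j else 0) - x) = sqrt (suminf g - sum g {..<N})" for N
  proof -
    have "(\<lambda>j. g j - (if j \<in> {..<N} then g j else 0)) sums (suminf g - sum g {..<N})"
      by (intro sums_diff summable_sums[OF sg] sums_If_finite_set) simp
    moreover have "g j - (if j \<in> {..<N} then g j else 0) = (cmod (((\<lambda>j. if j < N then x j else 0) - x) j))\<^sup>2" for j
      by (simp add: g_def)
    ultimately have "(\<lambda>j. (cmod (((\<lambda>j. if j < N then x j else 0) - x) j))\<^sup>2) sums (suminf g - sum g {..<N})"
      by simp
    then show ?thesis unfolding ell2_norm_def by (simp only: sums_unique[symmetric])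
  qed
  moreover have "(\<lambda>N. sqrt (suminf g - sum g {..<N})) \<longlonglongrightarrow> sqrt (suminf g - suminf g)"
    by (intro tendsto_real_sqrt tendsto_diff tendsto_const summable_LIMSEQ[OF sg])
  ultimately show ?thesis by simp
qed

definition ell2_unit :: "nat \<Rightarrow> nat \<Rightarrow> complex" where
  "ell2_unit N j = (if j = N then 1 else 0)"

lemma ell2_unit: "ell2_unit N \<in> ell2" "ell2_norm (ell2_unit N) = 1"
proof -
  show "ell2_unit N \<in> ell2" by (rule ell2_finite[of "Suc N"]) (simp add: ell2_unit_def)
  have "(\<lambda>j. (cmod (ell2_unit N j))\<^sup>2) = (\<lambda>j. if j = N then 1 else 0)"
    by (rule ext) (simp add: ell2_unit_def)
  then have "(\<Sum>j. (cmod (ell2_unit N j))\<^sup>2) = 1"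
    using sums_unique[OF sums_single[of N "\<lambda>_. 1::real"]] by simp
  then show "ell2_norm (ell2_unit N) = 1" by (simp add: ell2_norm_def)
qed

text \<open>The error of normalisation when vector and functional are both divided by
  \<open>m\<close>. The constant is \<open>(5/2) / (1/4)\<close>: \<open>m\<close> lies between 1/2
  and 3/2, so \<open>1 + m\<close> is at most 5/2 and \<open>m * m\<close> at least 1/4.\<close>

lemma inverse_square_approx:
  fixes v :: complex and \<eta> m :: real
  assumes "1 - \<eta> < m" "m < 1 + \<eta>" "0 < \<eta>" "\<eta> \<le> 1 / 2"
  shows "cmod (complex_of_real (inverse m * inverse m) * v - v) \<le> 10 * \<eta> * cmod v"
proof -
  have m: "m > 0" "1 / 4 \<le> m * m"
  proof -
    show "m > 0" using assms by linarith
    have "(1/2) * (1/2) \<le> m * m" using assms by (intro mult_mono) auto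
    then show "1 / 4 \<le> m * m" by simp
  qed
  have "\<bar>inverse m * inverse m - 1\<bar> = \<bar>1 - m * m\<bar> / (m * m)"
  proof -
    have "inverse m * inverse m - 1 = (1 - m * m) / (m * m)" using m by (simp add: field_simps)
    then show ?thesis using m by (simp add: abs_divide)
  qed
  also have "\<dots> \<le> (5 / 2 * \<eta>) / (1 / 4)"
  proof (rule frac_le)
    have "\<bar>1 - m * m\<bar> = \<bar>1 - m\<bar> * \<bar>1 + m\<bar>" by (simp add: abs_mult[symmetric] algebra_simps)
    also have "\<dots> \<le> \<eta> * (5 / 2)" using assms m by (intro mult_mono) auto
    finally show "\<bar>1 - m * m\<bar> \<le> 5 / 2 * \<eta>" by simp
  qed (use m assms in auto)
  finally have "\<bar>inverse m * inverse m - 1\<bar> \<le> 10 * \<eta>" by simp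
  moreover have "cmod (complex_of_real (inverse m * inverse m) * v - v) = \<bar>inverse m * inverse m - 1\<bar> * cmod v"
  proof -
    have "complex_of_real (inverse m * inverse m) * v - v = complex_of_real (inverse m * inverse m - 1) * v"
      by (simp add: left_diff_distrib)
    then show ?thesis by (simp only: norm_mult norm_of_real)
  qed
  ultimately show ?thesis by (simp add: mult_right_mono)
qed

lemma ell2_shift_numerically_transitive:
  "topologically_numerically_transitive ell2 ell2_norm ell2_shift"
  unfolding topologically_numerically_transitive_def
proof (intro allI impI, elim conjE)
  fix U :: "((nat \<Rightarrow> complex) \<times> ((nat \<Rightarrow> complex) \<Rightarrow> complex)) set" and V :: "complex set"
  assume U: "openin (norm_topology (Pi_states ell2 ell2_norm)
      (\<lambda>(x, f). max (ell2_norm x) (dual_norm ell2 ell2_norm f))) U" "U \<noteq> {}"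
    and V: "open V" "V \<noteq> {}"
  obtain p0 where "p0 \<in> U" using U(2) by blast
  then obtain r where r: "r > 0" "\<And>p. p \<in> Pi_states ell2 ell2_norm \<Longrightarrow>
      (if p0 \<in> Pi_states ell2 ell2_norm \<and> p \<in> Pi_states ell2 ell2_norm
        then (\<lambda>(x, f). max (ell2_norm x) (dual_norm ell2 ell2_norm f)) (p0 - p) else 0) < r \<Longrightarrow> p \<in> U"
    and p0: "p0 \<in> Pi_states ell2 ell2_norm"
    using Metric_space_openinD[OF ell2.Metric_space_states U(1)[unfolded norm_topology_def]] by metis
  define x0 where "x0 = fst p0"
  have "(x0, snd p0) \<in> Pi_states ell2 ell2_norm" using p0 by (simp add: x0_def)
  \<comment> \<open>The functional of the given state is induced by its vector, so it suffices to
    approximate the vector.\<close>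
  from ell2_state_unique[OF this] have p0eq: "p0 = (x0, ell2_functional x0)" by (simp add: x0_def prod_eq_iff)
  have x0: "x0 \<in> ell2" "ell2_norm x0 = 1"
    using p0 by (auto simp: p0eq Pi_states_def unit_sphere_def)
  obtain v where "v \<in> V" using V(2) by blast
  then obtain \<epsilon> where \<epsilon>: "\<epsilon> > 0" "\<And>w. dist w v < \<epsilon> \<Longrightarrow> w \<in> V"
    using V(1) unfolding open_dist by blast
  \<comment> \<open>The entry with 20 makes the normalisation error
    \<open>10 * \<eta> * cmod v\<close> at most \<open>\<epsilon> / 2\<close>.\<close>
  define \<eta> where "\<eta> = min (1/2) (min (r / 2) (\<epsilon> / (20 * (cmod v + 1))))"
  have v1: "cmod v + 1 > 0" by (simp add: add_nonneg_pos)
  have \<eta>0: "\<eta> > 0" unfolding \<eta>_def using r(1) \<epsilon>(1) v1 by simp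
  have \<eta>: "\<eta> \<le> 1 / 2" "\<eta> \<le> r / 2" "\<eta> \<le> \<epsilon> / (20 * (cmod v + 1))"
    unfolding \<eta>_def by (rule min.cobounded1, rule min.coboundedI2, rule min.cobounded1,
        rule min.coboundedI2, rule min.cobounded2)
  have "0 < \<eta> / 2" using \<eta>0 by simp
  from order_tendstoD(2)[OF ell2_trunc_approx[OF x0(1)] this]
  obtain N where N: "ell2_norm ((\<lambda>j. if j < N then x0 j else 0) - x0) < \<eta> / 2"
    using eventually_happens by force
  have "(1::real) < 2" by simp
  from real_arch_pow[OF this] obtain n0 where n0: "2 * (1 + cmod v) / \<eta> < 2 ^ n0" by blast
  \<comment> \<open>Strictly beyond \<open>N\<close>, unlike in the C*-case: the one vector
    \<open>z\<close> carries both small terms, and for \<open>n = N\<close> its entry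
    \<open>a\<close> at \<open>N\<close> would meet the shifted truncation.\<close>
  define n where "n = max n0 (Suc N)"
  have "(2::real) ^ n0 \<le> 2 ^ n" by (intro power_increasing) (auto simp: n_def)
  with n0 have "2 * (1 + cmod v) / \<eta> < 2 ^ n" by (rule less_le_trans)
  then have n: "(1 + cmod v) / 2 ^ n < \<eta> / 2" "N < n"
    using \<eta>0 by (simp add: field_simps) (simp add: n_def)
  define a where "a = complex_of_real (1 / 2 ^ n)"
  \<comment> \<open>The conjugate undoes the one in the inner product:
    \<open>4 ^ n * a * cnj b = v\<close>.\<close>
  define b where "b = complex_of_real (1 / 2 ^ n) * cnj v"
  define t where "t = (\<lambda>j. if j < N then x0 j else 0)"
  define y where "y = a *\<^sub>C ell2_unit N + b *\<^sub>C ell2_unit (N + n)"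
  define z where "z = t + y"
  have t: "t \<in> ell2" unfolding t_def by (rule ell2_finite[of N]) simp
  have y: "y \<in> ell2" unfolding y_def by (intro ell2.add_closed ell2.scaleC_closed ell2_unit)
  have z: "z \<in> ell2" unfolding z_def by (intro ell2.add_closed t y)
  have "ell2_norm y \<le> ell2_norm (a *\<^sub>C ell2_unit N) + ell2_norm (b *\<^sub>C ell2_unit (N + n))"
    unfolding y_def by (intro ell2.nrm_triangle ell2.scaleC_closed ell2_unit)
  also have "\<dots> = (1 + cmod v) / 2 ^ n"
    by (simp add: ell2.nrm_scaleC ell2_unit a_def b_def norm_mult norm_divide norm_power add_divide_distrib)
  finally have yn: "ell2_norm y < \<eta> / 2" using n(1) by linarith
  have zx: "ell2_norm (z - x0) < \<eta>"
  proof -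
    have eq: "z - x0 = (t - x0) + y" by (simp add: z_def)
    have "ell2_norm (z - x0) \<le> ell2_norm (t - x0) + ell2_norm y"
      unfolding eq by (intro ell2.nrm_triangle ell2.diff_closed t x0 y)
    then show ?thesis using N yn unfolding t_def by linarith
  qed
  have "\<eta> < 1" using \<eta>(1) by linarith
  note nz = ell2.normalise_close[OF x0 z zx this]
  define m where "m = ell2_norm z"
  define u where "u = of_real (inverse m) *\<^sub>C z"
  have u: "u \<in> ell2" "ell2_norm u = 1" "ell2_norm (u - x0) < 2 * \<eta>"
    using nz(1,2) by (simp_all add: u_def m_def unit_sphere_def)
  have up: "(u, ell2_functional u) \<in> Pi_states ell2 ell2_norm" by (rule ell2_functional_state[OF u(1,2)])
  have "(u, ell2_functional u) \<in> U"
  proof (rule r(2)[OF up])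
    have "ell2_norm (x0 - u) < r" using u(3) \<eta>(2) ell2.nrm_diff_commute[OF u(1) x0(1)] by linarith
    moreover have "dual_norm ell2 ell2_norm (ell2_functional x0 - ell2_functional u) < r"
      using dual_norm_ell2_functional_diff_le[OF x0(1) u(1)] calculation by linarith
    ultimately show "(if p0 \<in> Pi_states ell2 ell2_norm \<and> (u, ell2_functional u) \<in> Pi_states ell2 ell2_norm
        then (\<lambda>(x, f). max (ell2_norm x) (dual_norm ell2 ell2_norm f)) (p0 - (u, ell2_functional u)) else 0) < r"
      using r(1) by (simp add: p0eq)
  qed
  moreover have "ell2_functional u ((ell2_shift ^^ n) u) \<in> V"
  proof -
    have Tu: "(ell2_shift ^^ n) u = of_real (inverse m) *\<^sub>C (ell2_shift ^^ n) z"
      by (rule ext) (simp add: ell2_shift_power u_def scaleC_fun_def scaleC_complex_def)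
    have Tz: "(ell2_shift ^^ n) z \<in> ell2" by (rule ell2.funpow_closed[OF ell2_shift_ell2(1) z])
    have Tu2: "(ell2_shift ^^ n) u \<in> ell2" unfolding Tu by (rule ell2.scaleC_closed[OF Tz])
    have "(\<lambda>j. (ell2_shift ^^ n) z j * cnj (z j)) = (\<lambda>j. if j = N + n then v else 0)"
    proof
      fix j
      have four: "(4::complex) ^ n = 2 ^ n * 2 ^ n" by (simp flip: power_mult_distrib)
      have zj: "z j = (if j < N then x0 j else 0) + a * (if j = N then 1 else 0) + b * (if j = N + n then 1 else 0)" for j
        by (simp add: z_def y_def t_def ell2_unit_def scaleC_fun_def scaleC_complex_def)
      show "(ell2_shift ^^ n) z j * cnj (z j) = (if j = N + n then v else 0)"
      proof (cases "j = N + n")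
        case True
        then have "z j = b" "z (j - n) = a" using n(2) by (simp_all add: zj)
        then show ?thesis using True by (simp add: ell2_shift_power a_def b_def four)
      next
        case False
        then have "j < n \<or> z j = 0" using n(2) by (auto simp: zj)
        then show ?thesis using False by (auto simp: ell2_shift_power)
      qed
    qed
    then have "ell2_inner ((ell2_shift ^^ n) z) z = v"
      unfolding ell2_inner_def using sums_unique[OF sums_single[of "N + n" "\<lambda>_. v"]] by simp
    then have "ell2_functional u ((ell2_shift ^^ n) u) = complex_of_real (inverse m * inverse m) * v"
      using Tu2 unfolding ell2_functional_def Tu
      by (simp add: u_def ell2_inner_scaleC z Tz ell2.scaleC_closed)
    moreover have "cmod (complex_of_real (inverse m * inverse m) * v - v) < \<epsilon>"
    proof -
      have "cmod (complex_of_real (inverse m * inverse m) * v - v) \<le> 10 * \<eta> * cmod v"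
        using nz(3,4) \<eta>0 \<eta>(1) by (intro inverse_square_approx) (simp_all add: m_def)
      also have "\<dots> \<le> 10 * \<eta> * (cmod v + 1)" using \<eta>0 by (intro mult_left_mono) simp_all
      also have "\<dots> \<le> \<epsilon> / 2" using \<eta>(3) v1 by (simp add: field_simps)
      finally show ?thesis using \<epsilon>(1) by linarith
    qed
    ultimately show ?thesis by (intro \<epsilon>(2)) (simp add: dist_norm)
  qed
  ultimately show "\<exists>n. \<exists>(x, f)\<in>U. f ((ell2_shift ^^ n) x) \<in> V" by blast
qed

lemma ell2_example:
  "\<exists>T. bounded_op ell2 ell2_norm T \<and> topologically_numerically_transitive ell2 ell2_norm T \<and>
     \<not> Li_Yorke_chaotic ell2 ell2_norm T \<and> \<not> distributionally_chaotic_3 ell2 ell2_norm T"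
proof -
  have "ell2_shift (x + y) = ell2_shift x + ell2_shift y" for x y
    by (rule ext) (simp add: ell2_shift_def distrib_left split: nat.split)
  moreover have "ell2_shift (c *\<^sub>C x) = c *\<^sub>C ell2_shift x" for c x
    by (rule ext) (simp add: ell2_shift_def scaleC_fun_def scaleC_complex_def split: nat.split)
  ultimately show ?thesis
    using ell2.expanding_operator[of ell2_shift] ell2_shift_ell2 ell2_shift_numerically_transitive
    by (intro exI[of _ ell2_shift] conjI; simp)
qed

section \<open>Independence of the enumeration of the basis\<close>

text \<open>The sums are unordered, so a bijective change of index preserves them; this carries
  results for the enumerated basis back to the integer-indexed one.\<close>

lemma hilbert_schmidt_trace_reindex:
  fixes e :: "'j \<Rightarrow> 'h::chilbert_space" and p :: "'i \<Rightarrow> 'j"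
  assumes "bij p"
  shows "hilbert_schmidt_ops (e \<circ> p) = hilbert_schmidt_ops e"
    and "hilbert_schmidt_norm (e \<circ> p) = hilbert_schmidt_norm e"
    and "trace_class_ops (e \<circ> p) = trace_class_ops e"
    and "trace_norm (e \<circ> p) = trace_norm e"
proof -
  have sm: "(\<lambda>i. g (e (p i))) summable_on UNIV \<longleftrightarrow> (\<lambda>j. g (e j)) summable_on UNIV" for g :: "'h \<Rightarrow> real"
    by (rule summable_on_reindex_bij_betw[OF assms])
  have inf: "(\<Sum>\<^sub>\<infinity>i. g (e (p i))) = (\<Sum>\<^sub>\<infinity>j. g (e j))" for g :: "'h \<Rightarrow> real"
    by (rule infsum_reindex_bij_betw[OF assms])
  show "hilbert_schmidt_ops (e \<circ> p) = hilbert_schmidt_ops e"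
    unfolding hilbert_schmidt_ops_def o_apply sm[of "\<lambda>v. (norm (blinfun_apply _ v))\<^sup>2"] ..
  show "trace_class_ops (e \<circ> p) = trace_class_ops e"
    unfolding trace_class_ops_def o_apply sm[of "\<lambda>v. Re (cinner (blinfun_apply _ v) v)"] ..
  show "hilbert_schmidt_norm (e \<circ> p) = hilbert_schmidt_norm e"
    unfolding hilbert_schmidt_norm_def fun_eq_iff o_apply inf[of "\<lambda>v. (norm (blinfun_apply _ v))\<^sup>2"] by simp
  show "trace_norm (e \<circ> p) = trace_norm e"
    unfolding trace_norm_def fun_eq_iff o_apply inf[of "\<lambda>v. Re (cinner (blinfun_apply _ v) v)"] by simp
qed

lemma orthonormal_basis_reindex:
  fixes e :: "int \<Rightarrow> 'h::chilbert_space"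
  assumes "orthonormal_basis e"
  shows "onb_sequence (e \<circ> int_decode)"
proof
  have "inj int_decode" "surj int_decode" using bij_int_decode by (auto simp: bij_def)
  then show "orthonormal (e \<circ> int_decode)"
    using assms by (simp add: orthonormal_basis_def orthonormal_def inj_eq)
  have "range (e \<circ> int_decode) = range e"
    using \<open>surj int_decode\<close> by (simp only: image_comp[symmetric])
  then show "closure (complex_vector.span (range (e \<circ> int_decode))) = UNIV"
    using assms by (simp only: orthonormal_basis_def)
qed

theorem corollary4p13:
  fixes e :: "int \<Rightarrow> 'h::chilbert_space"
  assumes "orthonormal_basis e"
  shows
    "(\<exists>T. bounded_op ell2 ell2_norm T \<and>
          topologically_numerically_transitive ell2 ell2_norm T \<and>
          \<not> Li_Yorke_chaotic ell2 ell2_norm T \<and>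
          \<not> distributionally_chaotic_3 ell2 ell2_norm T) \<and>
     (\<exists>T :: ('h \<Rightarrow>\<^sub>L 'h) \<Rightarrow> ('h \<Rightarrow>\<^sub>L 'h).
          bounded_op compact_ops norm T \<and>
          cstar_transitive compact_ops norm compact_ops norm op_product T \<and>
          \<not> Li_Yorke_chaotic compact_ops norm T \<and>
          \<not> distributionally_chaotic_3 compact_ops norm T) \<and>
     (\<exists>T. bounded_op (hilbert_schmidt_ops e) (hilbert_schmidt_norm e) T \<and>
          cstar_transitive (hilbert_schmidt_ops e) (hilbert_schmidt_norm e)
            (trace_class_ops e) (trace_norm e) op_product T \<and>
          \<not> Li_Yorke_chaotic (hilbert_schmidt_ops e) (hilbert_schmidt_norm e) T \<and>
          \<not> distributionally_chaotic_3 (hilbert_schmidt_ops e) (hilbert_schmidt_norm e) T) \<and>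
     (\<exists>T :: (nat \<Rightarrow> ('h \<Rightarrow>\<^sub>L 'h)) \<Rightarrow> (nat \<Rightarrow> ('h \<Rightarrow>\<^sub>L 'h)).
          bounded_op std_module module_norm T \<and>
          cstar_transitive std_module module_norm compact_ops norm module_product T \<and>
          \<not> Li_Yorke_chaotic std_module module_norm T \<and>
          \<not> distributionally_chaotic_3 std_module module_norm T)"
proof -
  interpret onb_sequence "e \<circ> int_decode" by (rule orthonormal_basis_reindex[OF assms])
  note HS = HS_example[unfolded HS_def hsn_def TC_def trn_def hilbert_schmidt_trace_reindex[OF bij_int_decode]]
  show ?thesis by (intro conjI ell2_example compact_ops_example HS module_example)
qed

end
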